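(* For each of the following mixes of regular convex polyhedra, the number $f_0$ of vertices, $f_1$ of edges, $f_2$ of $2$-faces, and the size $g$ of the automorphism group (which is also the number of flags) are given by $(f_0,f_1,f_2,g)$: Mixes of two: $\{3,3\}\diamond\{3,4\}$: $(24,144,96,576)$; $\{3,3\}\diamond\{3,5\}$: $(48,360,240,1440)$; $\{3,3\}\diamond\{4,3\}$: $(96,144,24,576)$; $\{3,3\}\diamond\{5,3\}$: $(240,360,48,1440)$; $\{3,4\}\diamond\{3,5\}$: $(72,720,480,2880)$; $\{3,4\}\diamond\{4,3\}$: $(48,288,48,1152)$; $\{3,4\}\diamond\{5,3\}$: $(120,720,96,2880)$; $\{3,5\}\diamond\{4,3\}$: $(96,720,120,2880)$; $\{3,5\}\diamond\{5,3\}$: $(240,1800,240,7200)$; $\{4,3\}\diamond\{5,3\}$: $(480,720,72,2880)$. Mixes of three: $\{3,3\}\diamond\{3,4\}\diamond\{3,5\}$: $(288,8640,5760,34560)$; $\{3,3\}\diamond\{3,4\}\diamond\{4,3\}$: $(576,3456,576,13824)$; $\{3,3\}\diamond\{3,4\}\diamond\{5,3\}$: $(1440,8640,1152,34560)$; $\{3,3\}\diamond\{3,5\}\diamond\{4,3\}$: $(1152,8640,1440,34560)$; $\{3,3\}\diamond\{3,5\}\diamond\{5,3\}$: $(2880,21600,2880,86400)$; $\{3,3\}\diamond\{4,3\}\diamond\{5,3\}$: $(5760,8640,288,34560)$; $\{3,4\}\diamond\{3,5\}\diamond\{4,3\}$: $(576,17280,2880,69120)$; $\{3,4\}\diamond\{3,5\}\diamond\{5,3\}$: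 $(1440,43200,5760,172800)$; $\{3,4\}\diamond\{4,3\}\diamond\{5,3\}$: $(2880,17280,576,69120)$; $\{3,5\}\diamond\{4,3\}\diamond\{5,3\}$: $(5760,43200,1440,172800)$. Mixes of four: $\{3,3\}\diamond\{3,4\}\diamond\{3,5\}\diamond\{4,3\}$: $(6912,207360,34560,829440)$; $\{3,3\}\diamond\{3,4\}\diamond\{3,5\}\diamond\{5,3\}$: $(17280,518400,69120,2073600)$; $\{3,3\}\diamond\{3,4\}\diamond\{4,3\}\diamond\{5,3\}$: $(34560,207360,6912,829440)$; $\{3,3\}\diamond\{3,5\}\diamond\{4,3\}\diamond\{5,3\}$: $(69120,518400,17280,2073600)$; $\{3,4\}\diamond\{3,5\}\diamond\{4,3\}\diamond\{5,3\}$: $(34560,1036800,34560,4147200)$. Mix of all five: $\{3,3\}\diamond\{3,4\}\diamond\{3,5\}\diamond\{4,3\}\diamond\{5,3\}$: $(414720,12441600,414720,49766400)$.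
   Context: $\{3,3\},\{3,4\},\{3,5\},\{4,3\},\{5,3\}$ denote the face lattices of the tetrahedron, octahedron, icosahedron, cube and dodecahedron, regarded as abstract regular polytopes of rank $n=3$. For such a polytope $\mathcal P$ with a fixed base flag (maximal chain) $\Phi$, its automorphism group is $\langle\rho_0,\dots,\rho_{n-1}\rangle$, where $\rho_i$ maps $\Phi$ to the unique flag differing from $\Phi$ exactly in its $i$-face. Put $\sigma_i=\rho_{i-1}\rho_i$ for $1\le i\le n-1$; the rotation group is $\Gamma^+(\mathcal P)=\langle\sigma_1,\dots,\sigma_{n-1}\rangle$, of index 2. Mix. For such polytopes $\mathcal P_1,\dots,\mathcal P_m$ of rank $n$ with rotation-group generators $\sigma_i^{(r)}$, let $\beta_i=(\sigma_i^{(1)},\dots,\sigma_i^{(m)})$ for $1\le i\le n-1$ and let $\Gamma^+=\langle\beta_1,\dots,\beta_{n-1}\rangle\le\Gamma^+(\mathcal P_1)\times\cdots\times\Gamma^+(\mathcal P_m)$. For $I\subseteq\{0,\dots,n-1\}$ put $\Gamma^+_I=\langle\beta_i\beta_{i+1}\cdots\beta_j\mid 1\le i\le j\le n-1,\ i-1\in I,\ j\in I\rangle$. The mix $\mathcal P_1\diamond\cdots\diamond\mathcal P_m$ is the poset whose $j$-faces ($0\le j\le n-1$) are the right cosets of $\Gamma^+_{\{0,\dots,n-1\}\setminus\{j\}}$ in $\Gamma^+$, together with a least face of rank $-1$ and a greatest face of rank $n$, where a $j$-face is below a $k$-face ($j<k$) if and only if the two cosets intersect. Its automorphisms are the rank-preserving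 order automorphisms, and its flags are its maximal chains. *)

theory Defs
  imports "HOL-Analysis.Polytope" "HOL-Algebra.Bij" "HOL-Algebra.Product_Groups"
begin

record 'a ranked_poset =
  faces :: "'a set"
  face_le :: "'a \<Rightarrow> 'a \<Rightarrow> bool"
  face_rank :: "'a \<Rightarrow> int"

definition flags :: "('a, 'b) ranked_poset_scheme \<Rightarrow> 'a set set" where
  "flags P = {C. pred_on.maxchain (faces P) (face_le P) C}"

definition automorphisms :: "('a, 'b) ranked_poset_scheme \<Rightarrow> ('a \<Rightarrow> 'a) set" where
  "automorphisms P = {f \<in> Bij (faces P).
     (\<forall>x\<in>faces P. face_rank P (f x) = face_rank P x) \<and>
     (\<forall>x\<in>faces P. \<forall>y\<in>faces P. face_le P (f x) (f y) \<longleftrightarrow> face_le P x y)}"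

definition aut_group :: "('a, 'b) ranked_poset_scheme \<Rightarrow> ('a \<Rightarrow> 'a) monoid" where
  "aut_group P = (BijGroup (faces P))\<lparr>carrier := automorphisms P\<rparr>"

definition adjacent_flag :: "('a, 'b) ranked_poset_scheme \<Rightarrow> 'a set \<Rightarrow> nat \<Rightarrow> 'a set" where
  "adjacent_flag P \<Phi> i = (THE \<Psi>. \<Psi> \<in> flags P \<and> \<Psi> \<noteq> \<Phi> \<and>
     {F \<in> \<Psi>. face_rank P F \<noteq> int i} = {F \<in> \<Phi>. face_rank P F \<noteq> int i})"

text \<open>Products of automorphisms are taken in \<^const>\<open>BijGroup\<close>, that is \<open>f \<otimes> g = f \<circ> g\<close>.
  With the opposite convention every group below is replaced by its opposite, and inversion is an
  isomorphism that fixes the involutions \<open>\<rho>\<^sub>i\<close>, so the resulting mixes are isomorphic.\<close>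

definition rho :: "('a, 'b) ranked_poset_scheme \<Rightarrow> 'a set \<Rightarrow> nat \<Rightarrow> 'a \<Rightarrow> 'a" where
  "rho P \<Phi> i = (THE f. f \<in> automorphisms P \<and> f ` \<Phi> = adjacent_flag P \<Phi> i)"

definition sigma :: "('a, 'b) ranked_poset_scheme \<Rightarrow> 'a set \<Rightarrow> nat \<Rightarrow> 'a \<Rightarrow> 'a" where
  "sigma P \<Phi> i = rho P \<Phi> (i - 1) \<otimes>\<^bsub>aut_group P\<^esub> rho P \<Phi> i"

definition rotation_group ::
  "nat \<Rightarrow> ('a, 'b) ranked_poset_scheme \<Rightarrow> 'a set \<Rightarrow> ('a \<Rightarrow> 'a) monoid" where
  "rotation_group n P \<Phi> = subgroup_generated (aut_group P) (sigma P \<Phi> ` {1..n - 1})"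

text \<open>The polytopes to be mixed are given as a list of pairs of a poset and a base flag; \<open>n\<close> is
  their common rank.\<close>

definition mix_beta ::
  "(('a, 'b) ranked_poset_scheme \<times> 'a set) list \<Rightarrow> nat \<Rightarrow> nat \<Rightarrow> 'a \<Rightarrow> 'a" where
  "mix_beta Ps i = (\<lambda>r\<in>{..<length Ps}. sigma (fst (Ps ! r)) (snd (Ps ! r)) i)"

definition mix_group ::
  "nat \<Rightarrow> (('a, 'b) ranked_poset_scheme \<times> 'a set) list \<Rightarrow> (nat \<Rightarrow> 'a \<Rightarrow> 'a) monoid" where
  "mix_group n Ps = subgroup_generated
     (product_group {..<length Ps} (\<lambda>r. rotation_group n (fst (Ps ! r)) (snd (Ps ! r))))
     (mix_beta Ps ` {1..n - 1})"

definition mix_beta_prod ::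
  "nat \<Rightarrow> (('a, 'b) ranked_poset_scheme \<times> 'a set) list \<Rightarrow> nat \<Rightarrow> nat \<Rightarrow> nat \<Rightarrow> 'a \<Rightarrow> 'a" where
  "mix_beta_prod n Ps i j =
     foldr (\<otimes>\<^bsub>mix_group n Ps\<^esub>) (map (mix_beta Ps) [i..<Suc j]) \<one>\<^bsub>mix_group n Ps\<^esub>"

definition mix_subgroup ::
  "nat \<Rightarrow> (('a, 'b) ranked_poset_scheme \<times> 'a set) list \<Rightarrow> nat set \<Rightarrow> (nat \<Rightarrow> 'a \<Rightarrow> 'a) set" where
  "mix_subgroup n Ps I = generate (mix_group n Ps)
     {mix_beta_prod n Ps i j | i j. 1 \<le> i \<and> i \<le> j \<and> j \<le> n - 1 \<and> i - 1 \<in> I \<and> j \<in> I}"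

text \<open>The rank is part of a proper face, since cosets of different ranks may coincide as sets.\<close>

datatype 'g mix_face = Least_Face | Proper_Face nat "'g set" | Greatest_Face

fun mix_face_le :: "'g mix_face \<Rightarrow> 'g mix_face \<Rightarrow> bool" where
  "mix_face_le Least_Face y \<longleftrightarrow> True"
| "mix_face_le (Proper_Face j A) Least_Face \<longleftrightarrow> False"
| "mix_face_le (Proper_Face j A) (Proper_Face k B) \<longleftrightarrow> (j = k \<and> A = B) \<or> (j < k \<and> A \<inter> B \<noteq> {})"
| "mix_face_le (Proper_Face j A) Greatest_Face \<longleftrightarrow> True"
| "mix_face_le Greatest_Face y \<longleftrightarrow> y = Greatest_Face"

fun mix_face_rank :: "nat \<Rightarrow> 'g mix_face \<Rightarrow> int" where
  "mix_face_rank n Least_Face = - 1"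
| "mix_face_rank n (Proper_Face j A) = int j"
| "mix_face_rank n Greatest_Face = int n"

definition mix ::
  "nat \<Rightarrow> (('a, 'b) ranked_poset_scheme \<times> 'a set) list \<Rightarrow> (nat \<Rightarrow> 'a \<Rightarrow> 'a) mix_face ranked_poset" where
  "mix n Ps = \<lparr>
     faces = {Least_Face, Greatest_Face} \<union>
       {Proper_Face j A | j A. j < n \<and>
          A \<in> rcosets\<^bsub>mix_group n Ps\<^esub> (mix_subgroup n Ps ({0..<n} - {j}))},
     face_le = mix_face_le,
     face_rank = mix_face_rank n\<rparr>"

text \<open>\<open>g\<close> is both the size of the automorphism group and the number of flags.\<close>

fun has_parameters :: "('a, 'b) ranked_poset_scheme \<Rightarrow> nat \<times> nat \<times> nat \<times> nat \<Rightarrow> bool" where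
  "has_parameters P (f0, f1, f2, g) \<longleftrightarrow>
     card {F \<in> faces P. face_rank P F = 0} = f0 \<and>
     card {F \<in> faces P. face_rank P F = 1} = f1 \<and>
     card {F \<in> faces P. face_rank P F = 2} = f2 \<and>
     card (automorphisms P) = g \<and>
     card (flags P) = g"

definition face_lattice :: "'a::euclidean_space set \<Rightarrow> 'a set ranked_poset" where
  "face_lattice K = \<lparr>faces = {F. F face_of K}, face_le = (\<subseteq>), face_rank = aff_dim\<rparr>"

definition golden_ratio :: real where
  "golden_ratio = (1 + sqrt 5) / 2"

definition tetrahedron :: "(real ^ 3) set" where
  "tetrahedron = convex hull
     {vector [1, 1, 1], vector [1, -1, -1], vector [-1, 1, -1], vector [-1, -1, 1]}"

definition octahedron :: "(real ^ 3) set" where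
  "octahedron = convex hull {axis i s | i s. s \<in> {-1, 1}}"

definition cube :: "(real ^ 3) set" where
  "cube = convex hull {vector [s, t, u] | s t u. s \<in> {-1, 1} \<and> t \<in> {-1, 1} \<and> u \<in> {-1, 1}}"

text \<open>The vertices of the icosahedron are the cyclic permutations of \<open>(0, \<plusminus>1, \<plusminus>\<phi>)\<close>; those of the
  dodecahedron are the vertices of the cube and the cyclic permutations of \<open>(0, \<plusminus>1/\<phi>, \<plusminus>\<phi>)\<close>, where
  \<open>\<phi>\<close> is the golden ratio.\<close>

definition icosahedron :: "(real ^ 3) set" where
  "icosahedron = convex hull (\<Union>s\<in>{-1, 1}. \<Union>t\<in>{- golden_ratio, golden_ratio}.
     {vector [0, s, t], vector [s, t, 0], vector [t, 0, s]})"

definition dodecahedron :: "(real ^ 3) set" where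
  "dodecahedron = convex hull
     ({vector [s, t, u] | s t u. s \<in> {-1, 1} \<and> t \<in> {-1, 1} \<and> u \<in> {-1, 1}} \<union>
      (\<Union>s\<in>{- 1 / golden_ratio, 1 / golden_ratio}. \<Union>t\<in>{- golden_ratio, golden_ratio}.
         {vector [0, s, t], vector [s, t, 0], vector [t, 0, s]}))"

text \<open>The names carry the Schlaefli symbols: \<open>P34\<close> is the polytope of type \<open>{3,4}\<close>.\<close>

abbreviation "P33 \<equiv> face_lattice tetrahedron"
abbreviation "P34 \<equiv> face_lattice octahedron"
abbreviation "P35 \<equiv> face_lattice icosahedron"
abbreviation "P43 \<equiv> face_lattice cube"
abbreviation "P53 \<equiv> face_lattice dodecahedron"

end

theory Submission
  imports Defs "HOL-Algebra.Multiplicative_Group" "HOL-Analysis.Determinants"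
begin

text \<open>The mix of regular polyhedra is a coset geometry of the group \<open>\<Gamma>\<^sup>+\<close> generated by the two diagonal rotations
  \<open>\<beta>\<^sub>1\<close> and \<open>\<beta>\<^sub>2\<close>, and every number in the table is determined by the order of \<open>\<Gamma>\<^sup>+\<close> and the orders of \<open>\<beta>\<^sub>1\<close>, \<open>\<beta>\<^sub>2\<close>
  and \<open>\<beta>\<^sub>1\<beta>\<^sub>2\<close>.

  The decisive fact is that \<open>\<Gamma>\<^sup>+\<close> is the full direct product of the rotation groups (lemma \<open>all_full\<close>). The
  rotations have orders \<open>p\<close> and \<open>q\<close>. If, say, \<open>p = 5\<close> in one factor, then \<open>\<beta>\<^sub>1\<^sup>1\<^sup>2\<close> is trivial in all other
  factors, and its normal closure is the whole factor: modulo \<open>\<sigma>\<^sub>1\<close> the relation \<open>(\<sigma>\<^sub>1\<sigma>\<^sub>2)\<^sup>2 = 1\<close> gives \<open>\<sigma>\<^sub>2\<^sup>2 = 1\<close>,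
  while \<open>\<sigma>\<^sub>2\<close> has order 3. In this way all factors but the tetrahedral one split off, and then that one as well.

  In the product, \<open>\<langle>\<beta>\<^sub>1\<rangle>\<close> and \<open>\<langle>\<beta>\<^sub>2\<rangle>\<close> meet trivially, \<open>\<beta>\<^sub>1\<close> and \<open>\<beta>\<^sub>2\<close> have the least common multiples of the \<open>p\<close> and of the \<open>q\<close>
  as their orders, and \<open>\<beta>\<^sub>1\<beta>\<^sub>2\<close> is an involution. Lagrange's theorem counts the cosets. Each edge lies in four flags, so
  there are \<open>2 |\<Gamma>\<^sup>+|\<close> flags. An automorphism fixing a flag fixes the adjacent ones, hence is trivial;
  right translations and the reflection induced by conjugation with \<open>(\<rho>\<^sub>2, \<dots>, \<rho>\<^sub>2)\<close> reach every flag. So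
  automorphisms and flags are equinumerous (lemma \<open>bij_automorphisms_flags\<close>).

  It remains to know the rotation groups of the five solids, for an arbitrary base flag. Each solid is invariant
  under a finite group \<open>W\<close> generated by three reflections. A nonempty proper face is exposed by a linear functional, which
  an element of \<open>W\<close> moves into the fundamental chamber, where the functional exposes one of three base faces. Refined
  to chains, this shows that the flags are the images of one base flag under \<open>W\<close> (lemma \<open>flags_eq\<close>). An orthogonal
  map fixing two of the three base faces is the identity or a reflection, which yields the adjacent flags, the
  rigidity of automorphisms, and \<open>\<rho>\<^sub>i\<close> as a conjugate of a simple reflection. The determinant singles out the
  rotations, and they are counted by their simply transitive action on directed edges.\<close>

section \<open>Automorphisms and flags of ranked posets\<close>

lemma less_3_cases: "(j :: nat) < 3 \<Longrightarrow> j = 0 \<or> j = 1 \<or> j = 2"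
  by linarith

lemma automorphismsD:
  assumes "f \<in> automorphisms P"
  shows "f \<in> extensional (faces P)" "bij_betw f (faces P) (faces P)"
    "\<And>x. x \<in> faces P \<Longrightarrow> f x \<in> faces P"
    "\<And>x. x \<in> faces P \<Longrightarrow> face_rank P (f x) = face_rank P x"
    "\<And>x y. x \<in> faces P \<Longrightarrow> y \<in> faces P \<Longrightarrow> face_le P (f x) (f y) \<longleftrightarrow> face_le P x y"
  using assms by (auto simp: automorphisms_def Bij_def bij_betw_def)

lemma automorphismsI:
  assumes "f \<in> extensional (faces P)" "bij_betw f (faces P) (faces P)"
    "\<And>x. x \<in> faces P \<Longrightarrow> face_rank P (f x) = face_rank P x"
    "\<And>x y. x \<in> faces P \<Longrightarrow> y \<in> faces P \<Longrightarrow> face_le P (f x) (f y) \<longleftrightarrow> face_le P x y"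
  shows "f \<in> automorphisms P"
  using assms by (auto simp: automorphisms_def Bij_def)

lemma automorphism_compose:
  assumes "f \<in> automorphisms P" "g \<in> automorphisms P"
  shows "compose (faces P) f g \<in> automorphisms P"
proof -
  have "compose (faces P) f g \<in> Bij (faces P)"
    using assms by (auto simp: automorphisms_def intro: compose_Bij)
  then show ?thesis
    using automorphismsD(3-5)[OF assms(1)] automorphismsD(3-5)[OF assms(2)]
    by (simp add: automorphisms_def compose_eq)
qed

lemma automorphism_inverse:
  assumes "f \<in> automorphisms P"
  shows "restrict (inv_into (faces P) f) (faces P) \<in> automorphisms P"
proof -
  let ?g = "restrict (inv_into (faces P) f) (faces P)"
  have f: "f \<in> Bij (faces P)" "f ` faces P = faces P"
    using assms by (auto simp: automorphisms_def Bij_def bij_betw_def)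
  have g: "?g x \<in> faces P" "f (?g x) = x" if "x \<in> faces P" for x
    using f that by (auto simp: inv_into_into f_inv_into_f)
  have "face_rank P (?g x) = face_rank P x" if "x \<in> faces P" for x
    using automorphismsD(4)[OF assms g(1)[OF that]] g(2)[OF that] by simp
  moreover have "face_le P (?g x) (?g y) \<longleftrightarrow> face_le P x y" if "x \<in> faces P" "y \<in> faces P" for x y
    using automorphismsD(5)[OF assms g(1)[OF that(1)] g(1)[OF that(2)]]
      g(2)[OF that(1)] g(2)[OF that(2)] by simp
  ultimately show ?thesis
    using restrict_inv_into_Bij[OF f(1)] unfolding automorphisms_def by blast
qed

lemma automorphism_inverseE:
  assumes "f \<in> automorphisms P"
  obtains g where "g \<in> automorphisms P"
    "\<And>x. x \<in> faces P \<Longrightarrow> g (f x) = x" "\<And>x. x \<in> faces P \<Longrightarrow> f (g x) = x"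
proof
  have fP: "f ` faces P = faces P" "inj_on f (faces P)"
    using automorphismsD(2)[OF assms] by (auto simp: bij_betw_def)
  fix x assume x: "x \<in> faces P"
  show "restrict (inv_into (faces P) f) (faces P) (f x) = x"
    using automorphismsD(3)[OF assms x] inv_into_f_f[OF fP(2) x] by simp
  show "f (restrict (inv_into (faces P) f) (faces P) x) = x"
    using f_inv_into_f[of x f "faces P"] fP(1) x by simp
qed (rule automorphism_inverse[OF assms])

lemma subgroup_automorphisms: "subgroup (automorphisms P) (BijGroup (faces P))"
proof (rule subgroup.intro)
  show sub: "automorphisms P \<subseteq> carrier (BijGroup (faces P))"
    by (auto simp: automorphisms_def BijGroup_def)
  show "\<one>\<^bsub>BijGroup (faces P)\<^esub> \<in> automorphisms P"
    by (auto simp: automorphisms_def BijGroup_def id_Bij)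
  fix f g
  assume f: "f \<in> automorphisms P"
  have "f \<in> Bij (faces P)"
    using f by (simp add: automorphisms_def)
  then show "inv\<^bsub>BijGroup (faces P)\<^esub> f \<in> automorphisms P"
    using automorphism_inverse[OF f] by (simp add: inv_BijGroup)
  assume g: "g \<in> automorphisms P"
  have "g \<in> Bij (faces P)"
    using g by (simp add: automorphisms_def)
  with \<open>f \<in> Bij (faces P)\<close> show "f \<otimes>\<^bsub>BijGroup (faces P)\<^esub> g \<in> automorphisms P"
    using automorphism_compose[OF f g] by (simp add: BijGroup_def)
qed

lemma group_aut_group: "group (aut_group P)"
  unfolding aut_group_def
  by (rule subgroup.subgroup_is_group[OF subgroup_automorphisms group_BijGroup])

lemma aut_group_simps:
  "carrier (aut_group P) = automorphisms P"
  "\<one>\<^bsub>aut_group P\<^esub> = (\<lambda>x\<in>faces P. x)"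
  "f \<in> automorphisms P \<Longrightarrow> g \<in> automorphisms P \<Longrightarrow> f \<otimes>\<^bsub>aut_group P\<^esub> g = compose (faces P) f g"
  by (auto simp: aut_group_def BijGroup_def automorphisms_def)

abbreviation "face_chain P \<equiv> pred_on.chain (faces P) (face_le P)"

lemma chain_faces_iff:
  "face_chain P C \<longleftrightarrow>
     C \<subseteq> faces P \<and> (\<forall>x\<in>C. \<forall>y\<in>C. x = y \<or> face_le P x y \<or> face_le P y x)"
  by (auto simp: pred_on.chain_def)

lemma flag_iff:
  "C \<in> flags P \<longleftrightarrow> face_chain P C \<and>
     (\<forall>D. face_chain P D \<longrightarrow> C \<subseteq> D \<longrightarrow> D = C)"
  by (auto simp: flags_def pred_on.maxchain_def)

text \<open>The flags of a concrete poset are found by guessing them: chains of one common finite size that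
  cover every chain are exactly the maximal ones.\<close>

lemma flags_eqI:
  assumes chain: "\<And>C. C \<in> \<F> \<Longrightarrow> face_chain P C"
    and card: "\<And>C. C \<in> \<F> \<Longrightarrow> finite C \<and> card C = n"
    and cover: "\<And>C. face_chain P C \<Longrightarrow> \<exists>D\<in>\<F>. C \<subseteq> D"
  shows "flags P = \<F>"
proof (intro equalityI subsetI)
  fix C assume "C \<in> flags P"
  then show "C \<in> \<F>"
    using chain cover unfolding flag_iff by metis
next
  fix C assume C: "C \<in> \<F>"
  have "D = C" if D: "face_chain P D" "C \<subseteq> D" for D
  proof -
    obtain E where "E \<in> \<F>" "D \<subseteq> E"
      using cover[OF D(1)] by blast
    then have "C = E"
      using D(2) card C by (metis card_subset_eq order.trans)
    then show ?thesis
      using D(2) \<open>D \<subseteq> E\<close> by blast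
  qed
  then show "C \<in> flags P"
    using chain[OF C] unfolding flag_iff by blast
qed

lemma automorphism_chain:
  assumes "f \<in> automorphisms P" "face_chain P C"
  shows "face_chain P (f ` C)"
  using assms(2) automorphismsD(3,5)[OF assms(1)] unfolding chain_faces_iff
  by (simp add: subset_iff image_iff) metis

lemma automorphism_flag:
  assumes f: "f \<in> automorphisms P" and C: "C \<in> flags P"
  shows "f ` C \<in> flags P"
proof -
  obtain g where g: "g \<in> automorphisms P"
    and gf: "\<And>x. x \<in> faces P \<Longrightarrow> g (f x) = x" and fg: "\<And>x. x \<in> faces P \<Longrightarrow> f (g x) = x"
    using automorphism_inverseE[OF f] by blast
  have CP: "C \<subseteq> faces P"
    using C unfolding flag_iff chain_faces_iff by blast
  have "D = f ` C" if D: "face_chain P D" "f ` C \<subseteq> D" for D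
  proof -
    have DP: "D \<subseteq> faces P"
      using D unfolding chain_faces_iff by blast
    have "C \<subseteq> g ` D"
    proof
      fix x assume "x \<in> C"
      then show "x \<in> g ` D"
        using D(2) CP gf[of x] by (intro image_eqI[of _ _ "f x"]) auto
    qed
    then have gD: "g ` D = C"
      using C automorphism_chain[OF g D(1)] unfolding flag_iff by blast
    have "D \<subseteq> f ` C"
    proof
      fix x assume "x \<in> D"
      then show "x \<in> f ` C"
        using gD DP fg[of x] by (intro image_eqI[of _ _ "g x"]) auto
    qed
    with D(2) show ?thesis by blast
  qed
  then show ?thesis
    using C automorphism_chain[OF f] unfolding flag_iff by blast
qed

lemma automorphisms_agree_on_flag:
  assumes f: "f \<in> automorphisms P" and g: "g \<in> automorphisms P"
    and \<Phi>: "\<Phi> \<subseteq> faces P" "inj_on (face_rank P) \<Phi>" and eq: "f ` \<Phi> = g ` \<Phi>" and x: "x \<in> \<Phi>"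
  shows "f x = g x"
proof -
  obtain y where y: "y \<in> \<Phi>" "f x = g y"
    using eq x by blast
  have "x \<in> faces P" "y \<in> faces P"
    using x y(1) \<Phi>(1) by auto
  then have "face_rank P x = face_rank P y"
    using automorphismsD(4)[OF f] automorphismsD(4)[OF g] y(2) by metis
  then show ?thesis
    using \<Phi>(2) x y by (auto dest: inj_onD)
qed

text \<open>If only the identity fixes every face of a flag, an automorphism is determined by the image of
  that flag as a set, since an automorphism preserves ranks.\<close>

lemma rigid_flag_imp_eq:
  assumes f: "f \<in> automorphisms P" and g: "g \<in> automorphisms P"
    and \<Phi>: "\<Phi> \<subseteq> faces P" "inj_on (face_rank P) \<Phi>" and eq: "f ` \<Phi> = g ` \<Phi>"
    and rigid: "\<And>h x. h \<in> automorphisms P \<Longrightarrow> (\<And>y. y \<in> \<Phi> \<Longrightarrow> h y = y) \<Longrightarrow> x \<in> faces P \<Longrightarrow> h x = x"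
  shows "f = g"
proof -
  obtain k where k: "k \<in> automorphisms P"
    and kg: "\<And>x. x \<in> faces P \<Longrightarrow> k (g x) = x" and gk: "\<And>x. x \<in> faces P \<Longrightarrow> g (k x) = x"
    using automorphism_inverseE[OF g] by blast
  have h: "compose (faces P) k f \<in> automorphisms P"
    by (intro automorphism_compose k f)
  have "compose (faces P) k f y = y" if "y \<in> \<Phi>" for y
  proof -
    have "y \<in> faces P" using that \<Phi> by blast
    then show ?thesis
      using automorphisms_agree_on_flag[OF f g \<Phi> eq that] kg by (simp add: compose_eq)
  qed
  then have "compose (faces P) k f x = x" if "x \<in> faces P" for x
    using rigid[OF h _ that] by blast
  then have "f x = g x" if x: "x \<in> faces P" for x
    using gk[OF automorphismsD(3)[OF f x]] x by (simp add: compose_eq)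
  then show ?thesis
    using automorphismsD(1)[OF f] automorphismsD(1)[OF g] by (rule extensionalityI[rotated 2])
qed

section \<open>The coset geometry of a rotation group\<close>

definition coset_geometry ::
  "('g, 'b) monoid_scheme \<Rightarrow> (nat \<Rightarrow> 'g set) \<Rightarrow> 'g mix_face ranked_poset" where
  "coset_geometry G H = \<lparr>
     faces = {Least_Face, Greatest_Face} \<union>
       {Proper_Face j A | j A. j < 3 \<and> A \<in> rcosets\<^bsub>G\<^esub> (H j)},
     face_le = mix_face_le,
     face_rank = mix_face_rank 3\<rparr>"

text \<open>The situation of a mix, reduced to its group: two generators whose product is an involution, cyclic
  groups \<open>\<langle>a\<rangle>\<close> and \<open>\<langle>b\<rangle>\<close> meeting trivially, and an endomorphism \<open>\<alpha>\<close>. With \<open>a = \<rho>\<^sub>0\<rho>\<^sub>1\<close> and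
  \<open>b = \<rho>\<^sub>1\<rho>\<^sub>2\<close>, conjugation by \<open>\<rho>\<^sub>2\<close> is such an \<open>\<alpha>\<close>; this is all that remains of the reflections,
  and it is what makes the coset geometry reflexible instead of chiral.\<close>

locale rotation_pair = group G for G (structure) +
  fixes a b :: 'a and \<alpha> :: "'a \<Rightarrow> 'a"
  assumes fin: "finite (carrier G)"
    and a_in [simp]: "a \<in> carrier G" and b_in [simp]: "b \<in> carrier G"
    and gen: "generate G {a, b} = carrier G"
    and invol: "(a \<otimes> b) \<otimes> (a \<otimes> b) = \<one>"
    and a_ne: "a \<noteq> \<one>" and b_ne: "b \<noteq> \<one>"
    and inter: "generate G {a} \<inter> generate G {b} = {\<one>}"
    and \<alpha>_hom: "\<alpha> \<in> hom G G" and \<alpha>_a: "\<alpha> a = a \<otimes> b \<otimes> b" and \<alpha>_b: "\<alpha> b = inv b"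
begin

text \<open>The faces of rank \<open>j\<close> are the cosets of the cyclic group \<open>H j\<close>, so that \<open>F j x\<close> is the \<open>j\<close>-face
  through \<open>x\<close>, and two faces are incident iff they are \<open>F j z\<close> and \<open>F k z\<close> for a common \<open>z\<close>.\<close>

definition h :: "nat \<Rightarrow> 'a" where
  "h j = (if j = 0 then b else if j = 1 then a \<otimes> b else a)"

definition H :: "nat \<Rightarrow> 'a set" where
  "H j = generate G {h j}"

definition F :: "nat \<Rightarrow> 'a \<Rightarrow> 'a mix_face" where
  "F j x = Proper_Face j (H j #> x)"

abbreviation "P \<equiv> coset_geometry G H"

lemma h_simps [simp]: "h 0 = b" "h (Suc 0) = a \<otimes> b" "h 2 = a"
  by (auto simp: h_def)

lemma h_in [simp]: "h j \<in> carrier G"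
  by (simp add: h_def)

lemma subgroup_H: "subgroup (H j) G"
  unfolding H_def by (rule generate_is_subgroup) simp

lemma H_sub: "H j \<subseteq> carrier G"
  using subgroup_H subgroup.subset by blast

lemma h_in_H: "h j \<in> H j"
  by (simp add: H_def generate.incl)

lemma H_eq: "H j = {h j [^] k | k. k \<in> (UNIV :: nat set)}"
  unfolding H_def by (rule generate_pow_on_finite_carrier[OF fin]) simp

lemma F_inj: "F j x = F k y \<longleftrightarrow> j = k \<and> H j #> x = H j #> y"
  by (auto simp: F_def)

lemma coset_eq_iff:
  assumes "x \<in> carrier G" "y \<in> carrier G"
  shows "H j #> x = H j #> y \<longleftrightarrow> x \<in> H j #> y"
  using assms repr_independence[OF _ _ subgroup_H] rcos_self[OF _ subgroup_H] by metis

lemma coset_mult_left: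
  assumes "x \<in> carrier G" "g \<in> H j"
  shows "H j #> (g \<otimes> x) = H j #> x"
  using assms coset_eq_iff[of "g \<otimes> x" x j] H_sub
  by (auto simp: r_coset_def)

lemma coset_eqE:
  assumes "H j #> x = H j #> y" "x \<in> carrier G" "y \<in> carrier G"
  obtains g where "g \<in> H j" "x = g \<otimes> y"
  using assms coset_eq_iff[of x y j] by (auto simp: r_coset_def)

lemma t_inv: "inv (a \<otimes> b) = a \<otimes> b"
  using invol by (simp add: inv_equality)

lemma bab: "b \<otimes> (a \<otimes> b) = inv a"
proof -
  have "a \<otimes> (b \<otimes> (a \<otimes> b)) = \<one>"
    using invol by (simp add: m_assoc)
  then show ?thesis
    by (metis a_in b_in inv_comm inv_equality m_closed)
qed

lemma t_eq: "a \<otimes> b = inv b \<otimes> inv a"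
  using t_inv by (simp add: inv_mult_group)

lemma H1: "H 1 = {\<one>, a \<otimes> b}"
proof -
  have "(a \<otimes> b) [^] k \<in> {\<one>, a \<otimes> b}" for k :: nat
    by (induction k) (auto simp: invol)
  moreover have "\<one> \<in> H 1" "a \<otimes> b \<in> H 1"
    using subgroup.one_closed[OF subgroup_H] h_in_H[of 1] by auto
  ultimately show ?thesis
    unfolding H_eq by auto
qed

lemma t_notin: "a \<otimes> b \<notin> H 0" "a \<otimes> b \<notin> H 2"
proof -
  show "a \<otimes> b \<notin> H 0"
  proof
    assume "a \<otimes> b \<in> H 0"
    then have "a \<otimes> b \<otimes> inv b \<in> H 0"
      using subgroup_H h_in_H[of 0] by (auto simp: subgroup_def)
    then have "a \<in> H 0"
      by (simp add: m_assoc)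
    then show False
      using inter a_ne h_in_H[of 2] by (auto simp: H_def)
  qed
  show "a \<otimes> b \<notin> H 2"
  proof
    assume "a \<otimes> b \<in> H 2"
    then have "inv a \<otimes> (a \<otimes> b) \<in> H 2"
      using subgroup_H h_in_H[of 2] by (auto simp: subgroup_def)
    then have "b \<in> H 2"
      by (simp add: m_assoc[symmetric])
    then show False
      using inter b_ne h_in_H[of 0] by (auto simp: H_def)
  qed
qed

lemma t_ne: "a \<otimes> b \<noteq> \<one>"
  using t_notin(1) subgroup.one_closed[OF subgroup_H] by metis

lemma H_inter: "j < 3 \<Longrightarrow> k < 3 \<Longrightarrow> j \<noteq> k \<Longrightarrow> H j \<inter> H k = {\<one>}"
proof -
  have "H 0 \<inter> H 1 = {\<one>}" "H 1 \<inter> H 2 = {\<one>}"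
    unfolding H1 using t_notin subgroup.one_closed[OF subgroup_H] by auto
  moreover have "H 0 \<inter> H 2 = {\<one>}"
    using inter by (auto simp: H_def)
  ultimately have "H 0 \<inter> H 1 = {\<one>}" "H 1 \<inter> H 2 = {\<one>}" "H 0 \<inter> H 2 = {\<one>}"
    by auto
  then show "j < 3 \<Longrightarrow> k < 3 \<Longrightarrow> j \<noteq> k \<Longrightarrow> H j \<inter> H k = {\<one>}"
    by (auto simp: numeral_3_eq_3 less_Suc_eq Int_commute numeral_2_eq_2)
qed

text \<open>Two faces of different ranks meet in at most one group element, so a pair of incident faces
  pins down the group element they share.\<close>

lemma eq_if_two_cosets_eq:
  assumes "H j #> x = H j #> y" "H k #> x = H k #> y" "j \<noteq> k" "j < 3" "k < 3"
    "x \<in> carrier G" "y \<in> carrier G"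
  shows "x = y"
proof -
  obtain g where g: "g \<in> H j" "x = g \<otimes> y" by (rule coset_eqE[OF assms(1,6,7)])
  obtain g' where g': "g' \<in> H k" "x = g' \<otimes> y" by (rule coset_eqE[OF assms(2,6,7)])
  have "g = g'"
    using g g' assms(7) H_sub by (metis right_cancel subsetD)
  then have "g \<in> H j \<inter> H k" using g g' by simp
  then have "g = \<one>" using H_inter[of j k] assms by blast
  then show ?thesis using g assms by simp
qed

lemma coset_b: "x \<in> carrier G \<Longrightarrow> H 0 #> (b \<otimes> x) = H 0 #> x"
  using coset_mult_left h_in_H[of 0] by simp

lemma coset_inv_b: "x \<in> carrier G \<Longrightarrow> H 0 #> (inv b \<otimes> x) = H 0 #> x"
  using coset_mult_left[of x "inv b" 0] h_in_H[of 0] subgroup.m_inv_closed[OF subgroup_H] by simp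

lemma coset_t: "x \<in> carrier G \<Longrightarrow> H 1 #> (a \<otimes> b \<otimes> x) = H 1 #> x"
  using coset_mult_left[of x "a \<otimes> b" 1] h_in_H[of 1] by simp

lemma coset_a: "x \<in> carrier G \<Longrightarrow> H 2 #> (a \<otimes> x) = H 2 #> x"
  using coset_mult_left[of x a 2] h_in_H[of 2] by simp

lemma coset_inv_a: "x \<in> carrier G \<Longrightarrow> H 2 #> (inv a \<otimes> x) = H 2 #> x"
  using coset_mult_left[of x "inv a" 2] h_in_H[of 2] subgroup.m_inv_closed[OF subgroup_H, of a 2] by simp

lemma coset2_t: "x \<in> carrier G \<Longrightarrow> H 2 #> (a \<otimes> b \<otimes> x) = H 2 #> (b \<otimes> x)"
  using coset_a[of "b \<otimes> x"] by (simp add: m_assoc)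

lemma coset0_t: "x \<in> carrier G \<Longrightarrow> H 0 #> (a \<otimes> b \<otimes> x) = H 0 #> (inv a \<otimes> x)"
  using coset_inv_b[of "inv a \<otimes> x"] by (simp add: m_assoc t_eq)

lemma edge_cases:
  assumes "H 1 #> y = H 1 #> x" "x \<in> carrier G" "y \<in> carrier G"
  shows "y = x \<or> y = a \<otimes> b \<otimes> x"
proof -
  obtain g where "g \<in> H 1" "y = g \<otimes> x"
    by (rule coset_eqE[OF assms(1,3,2)])
  then show ?thesis
    using H1 assms(2) by auto
qed

subsection \<open>Incidence\<close>

lemma faces_P: "faces P = {Least_Face, Greatest_Face} \<union> {F j x | j x. j < 3 \<and> x \<in> carrier G}"
  by (auto simp: coset_geometry_def F_def RCOSETS_def)

lemma face_le_P [simp]: "face_le P = mix_face_le"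
  and face_rank_P [simp]: "face_rank P = mix_face_rank 3"
  by (auto simp: coset_geometry_def)

lemma F_in [simp]: "j < 3 \<Longrightarrow> x \<in> carrier G \<Longrightarrow> F j x \<in> faces P"
  by (auto simp: faces_P)

lemma bounds_in [simp]: "Least_Face \<in> faces P" "Greatest_Face \<in> faces P"
  by (auto simp: faces_P)

lemma le_Greatest: "mix_face_le X Greatest_Face"
  by (cases X) auto

lemma F_ne [simp]: "F j x \<noteq> Least_Face" "F j x \<noteq> Greatest_Face" "Least_Face \<noteq> F j x" "Greatest_Face \<noteq> F j x"
  by (auto simp: F_def)

lemma F_rank_ne [simp]: "j \<noteq> k \<Longrightarrow> F j x \<noteq> F k y"
  by (simp add: F_def)

lemma rank_F [simp]: "mix_face_rank 3 (F j x) = int j"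
  by (auto simp: F_def)

lemma le_F_same: "mix_face_le (F j x) (F j y) \<longleftrightarrow> F j x = F j y"
  by (auto simp: F_def)

lemma le_F_iff:
  assumes "x \<in> carrier G" "y \<in> carrier G"
  shows "mix_face_le (F j x) (F k y) \<longleftrightarrow>
    F j x = F k y \<or> (j < k \<and> (\<exists>z\<in>carrier G. F j z = F j x \<and> F k z = F k y))"
proof -
  have "(H j #> x) \<inter> (H k #> y) \<noteq> {} \<longleftrightarrow> (\<exists>z\<in>carrier G. z \<in> H j #> x \<and> z \<in> H k #> y)"
    using r_coset_subset_G[OF H_sub assms(1)] by blast
  then show ?thesis
    using assms coset_eq_iff by (auto simp: F_def)
qed

lemma le_F_common: "j < k \<Longrightarrow> z \<in> carrier G \<Longrightarrow> mix_face_le (F j z) (F k z)"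
  using le_F_iff by blast

lemma chainD:
  assumes "face_chain P C" "F j x \<in> C" "F k y \<in> C" "j < k"
    "x \<in> carrier G" "y \<in> carrier G"
  shows "\<exists>z\<in>carrier G. F j z = F j x \<and> F k z = F k y"
proof -
  have "F j x = F k y \<or> mix_face_le (F j x) (F k y) \<or> mix_face_le (F k y) (F j x)"
    using assms(1-3) unfolding chain_faces_iff by fastforce
  then have "mix_face_le (F j x) (F k y)"
    using assms(4) by (auto simp: F_def)
  then show ?thesis
    using assms le_F_iff[of x y j k] by (auto simp: F_inj)
qed

lemma chain_same:
  assumes "face_chain P C" "F j x \<in> C" "F j y \<in> C"
  shows "F j x = F j y"
  using assms le_F_same unfolding chain_faces_iff by (metis face_le_P)

text \<open>An edge \<open>{x, abx}\<close> has two ends and two sides. Choosing the end \<open>F 0 x\<close> names the edge by \<open>x\<close>, and the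
  sides are \<open>F 2 x\<close> and \<open>F 2 (abx) = F 2 (bx)\<close>; this yields two flags for each \<open>x\<close>.\<close>

definition flag :: "'a \<Rightarrow> 'a mix_face set" where
  "flag x = {Least_Face, F 0 x, F 1 x, F 2 x, Greatest_Face}"

definition mirror_flag :: "'a \<Rightarrow> 'a mix_face set" where
  "mirror_flag x = {Least_Face, F 0 x, F 1 x, F 2 (b \<otimes> x), Greatest_Face}"

lemma card_flag: "card (flag x) = 5" "card (mirror_flag x) = 5"
  by (auto simp: flag_def mirror_flag_def)

lemma le_F1_mirror: 
  assumes "x \<in> carrier G" shows "mix_face_le (F 1 x) (F 2 (b \<otimes> x))" "mix_face_le (F 0 x) (F 2 (b \<otimes> x))"
proof -
  show "mix_face_le (F 1 x) (F 2 (b \<otimes> x))"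
    using le_F_common[of 1 2 "a \<otimes> b \<otimes> x"] assms coset_t coset2_t by (simp add: F_def)
  show "mix_face_le (F 0 x) (F 2 (b \<otimes> x))"
    using le_F_common[of 0 2 "b \<otimes> x"] assms coset_b by (simp add: F_def)
qed

lemma chain_flag:
  assumes "x \<in> carrier G" shows "face_chain P (flag x)"
    "face_chain P (mirror_flag x)"
proof -
  have le: "mix_face_le (F 0 x) (F 1 x)" "mix_face_le (F 0 x) (F 2 x)" "mix_face_le (F 1 x) (F 2 x)"
    using le_F_common[of 0 1 x] le_F_common[of 0 2 x] le_F_common[of 1 2 x] assms
    by simp_all
  show "face_chain P (flag x)"
    "face_chain P (mirror_flag x)"
    using assms le le_F1_mirror[OF assms]
    unfolding chain_faces_iff flag_def mirror_flag_def by (simp_all add: le_Greatest del: One_nat_def)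
qed

text \<open>If a chain has an edge, pick \<open>z\<close> on the edge and on the vertex (if any): the 2-face is then one of the
  two sides of the edge. Otherwise any common element \<open>z\<close> of the faces of the chain will do.\<close>

lemma chain_in_flag:
  assumes C: "face_chain P C"
  shows "\<exists>D\<in>flag ` carrier G \<union> mirror_flag ` carrier G. C \<subseteq> D"
proof -
  have same: "F j x = F j y" if "F j x \<in> C" "F j y \<in> C" for j x y
    using chain_same[OF C that] .
  have meet: "\<exists>z\<in>carrier G. F j z = F j x \<and> F k z = F k y"
    if "F j x \<in> C" "F k y \<in> C" "j < k" "x \<in> carrier G" "y \<in> carrier G" for j k x y
    using chainD[OF C that] .
  define has where "has j \<longleftrightarrow> (\<exists>x\<in>carrier G. F j x \<in> C)" for j
  have two: "\<exists>z\<in>carrier G. F j z \<in> C \<and> F k z \<in> C" if has: "has j" "has k" and jk: "j < k" for j k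
  proof -
    obtain x y where xy: "x \<in> carrier G" "F j x \<in> C" "y \<in> carrier G" "F k y \<in> C"
      using has unfolding has_def by blast
    obtain z where "z \<in> carrier G" "F j z = F j x" "F k z = F k y"
      using meet[OF xy(2,4) jk xy(1,3)] by blast
    then show ?thesis
      using xy by (intro bexI[of _ z]) simp_all
  qed
  have "\<exists>z\<in>carrier G. (has 0 \<longrightarrow> F 0 z \<in> C) \<and> (has 1 \<longrightarrow> F 1 z \<in> C) \<and>
      (has 1 \<or> (has 2 \<longrightarrow> F 2 z \<in> C))"
  proof (cases "has 0")
    case h0: True
    show ?thesis
    proof (cases "has 1")
      case True
      with h0 two[of 0 1] show ?thesis by auto
    next
      case no1: False
      show ?thesis
      proof (cases "has 2")
        case True
        with h0 no1 two[of 0 2] show ?thesis by auto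
      next
        case False
        with h0 no1 show ?thesis unfolding has_def[of 0] by auto
      qed
    qed
  next
    case no0: False
    show ?thesis
    proof (cases "has 1")
      case True
      with no0 show ?thesis unfolding has_def[of 1] by auto
    next
      case no1: False
      show ?thesis
      proof (cases "has 2")
        case True
        with no0 no1 show ?thesis unfolding has_def[of 2] by auto
      next
        case False
        with no0 no1 show ?thesis by auto
      qed
    qed
  qed
  then obtain z where z: "z \<in> carrier G"
    and zC: "has 0 \<Longrightarrow> F 0 z \<in> C" "has 1 \<Longrightarrow> F 1 z \<in> C" "has 1 \<or> (has 2 \<longrightarrow> F 2 z \<in> C)"
    by blast
  have z0: "F 0 y = F 0 z" if "y \<in> carrier G" "F 0 y \<in> C" for y
    using same[OF that(2) zC(1)] that unfolding has_def by blast
  have z1: "F 1 y = F 1 z" if "y \<in> carrier G" "F 1 y \<in> C" for y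
    using same[OF that(2) zC(2)] that unfolding has_def by blast
  have z2': "F 2 w = F 2 z \<or> F 2 w = F 2 (b \<otimes> z)" if w: "w \<in> carrier G" "F 2 w \<in> C" for w
  proof (cases "has 1")
    case True
    then have "F 1 z \<in> C" by (rule zC)
    then obtain u where u: "u \<in> carrier G" "F 1 u = F 1 z" "F 2 u = F 2 w"
      using meet[of 1 z 2 w] z w by auto
    then have "u = z \<or> u = a \<otimes> b \<otimes> z"
      using edge_cases[of u z] z by (simp add: F_inj)
    then show ?thesis
      using u(3) coset2_t[OF z] by (auto simp: F_inj)
  next
    case False
    then have "F 2 z \<in> C" using zC(3) w unfolding has_def by blast
    then show ?thesis using same[OF w(2)] by blast
  qed
  define \<xi> where "\<xi> = (if \<exists>y\<in>carrier G. F 2 y \<in> C \<and> F 2 y = F 2 (b \<otimes> z) then b \<otimes> z else z)"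
  have z2'': "F 2 y = F 2 \<xi>" if "y \<in> carrier G" "F 2 y \<in> C" for y
  proof (cases "\<exists>y\<in>carrier G. F 2 y \<in> C \<and> F 2 y = F 2 (b \<otimes> z)")
    case True
    then obtain w where "w \<in> carrier G" "F 2 w \<in> C" "F 2 w = F 2 (b \<otimes> z)" by blast
    moreover have "\<xi> = b \<otimes> z" unfolding \<xi>_def using True by (rule if_P)
    ultimately show ?thesis
      using same[OF that(2), of w] by simp
  next
    case False
    then have "\<xi> = z" unfolding \<xi>_def by (rule if_not_P)
    then show ?thesis
      using z2'[OF that] False that by blast
  qed
  have "C \<subseteq> {Least_Face, F 0 z, F 1 z, F 2 \<xi>, Greatest_Face}"
  proof
    fix X assume X: "X \<in> C"
    then have "X \<in> faces P"
      using C unfolding chain_faces_iff by blast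
    then consider "X = Least_Face" | "X = Greatest_Face" | j y where "j < 3" "y \<in> carrier G" "X = F j y"
      unfolding faces_P by auto
    then show "X \<in> {Least_Face, F 0 z, F 1 z, F 2 \<xi>, Greatest_Face}"
    proof cases
      case 3
      then have "j = 0 \<or> j = 1 \<or> j = 2" by linarith
      then show ?thesis
        using z0[OF 3(2)] z1[OF 3(2)] z2''[OF 3(2)] 3(3) X by blast
    qed auto
  qed
  moreover have "\<xi> = z \<or> \<xi> = b \<otimes> z"
    by (simp add: \<xi>_def)
  ultimately have "C \<subseteq> flag z \<or> C \<subseteq> mirror_flag z"
    unfolding flag_def mirror_flag_def by blast
  then show ?thesis
    using z by blast
qed

lemma flags_P: "flags P = flag ` carrier G \<union> mirror_flag ` carrier G"
proof (rule flags_eqI)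
  fix C assume "C \<in> flag ` carrier G \<union> mirror_flag ` carrier G"
  then show "face_chain P C" "finite C \<and> card C = 5"
    using chain_flag card_flag by (auto simp: flag_def mirror_flag_def)
qed (rule chain_in_flag)

lemma flag_eqD:
  assumes "flag x = flag y"
  shows "F 0 x = F 0 y" "F 1 x = F 1 y"
proof -
  have "F 0 x \<in> flag x" "F 1 x \<in> flag x" by (auto simp: flag_def)
  then show "F 0 x = F 0 y" "F 1 x = F 1 y"
    unfolding assms by (auto simp: flag_def F_inj)
qed

lemma mirror_flag_eqD:
  assumes "mirror_flag x = mirror_flag y \<or> mirror_flag x = flag y"
  shows "F 0 x = F 0 y" "F 1 x = F 1 y"
proof -
  have "F 0 x \<in> mirror_flag x" "F 1 x \<in> mirror_flag x" by (auto simp: mirror_flag_def)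
  then have "F 0 x \<in> mirror_flag y \<or> F 0 x \<in> flag y" "F 1 x \<in> mirror_flag y \<or> F 1 x \<in> flag y"
    using assms by auto
  then show "F 0 x = F 0 y" "F 1 x = F 1 y"
    by (auto simp: mirror_flag_def flag_def F_inj)
qed

lemma eq_if_F01_eq:
  assumes "F 0 x = F 0 y" "F 1 x = F 1 y" "x \<in> carrier G" "y \<in> carrier G"
  shows "x = y"
  using eq_if_two_cosets_eq[of 0 x y 1] assms by (simp add: F_inj)

lemma card_flags: "card (flags P) = 2 * card (carrier G)"
proof -
  have inj: "inj_on flag (carrier G)"
    by (rule inj_onI) (blast intro: eq_if_F01_eq flag_eqD)
  have inj': "inj_on mirror_flag (carrier G)"
    by (rule inj_onI) (blast intro: eq_if_F01_eq mirror_flag_eqD)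
  have "mirror_flag x \<noteq> flag y" if xy: "x \<in> carrier G" "y \<in> carrier G" for x y
  proof
    assume eq: "mirror_flag x = flag y"
    then have "x = y"
      using mirror_flag_eqD[of x y] eq_if_F01_eq[of x y] xy by blast
    moreover have "F 2 (b \<otimes> x) \<in> mirror_flag x" by (auto simp: mirror_flag_def)
    ultimately have "F 2 (b \<otimes> x) = F 2 x"
      using eq by (auto simp: flag_def F_inj)
    then have "b \<otimes> x = x"
      using eq_if_two_cosets_eq[of 0 "b \<otimes> x" x 2] coset_b xy by (simp add: F_inj)
    then show False
      using xy(1) b_ne r_cancel_one[of x b] by simp
  qed
  then have "flag ` carrier G \<inter> mirror_flag ` carrier G = {}"
    by blast
  then show ?thesis
    using fin inj inj' by (simp add: flags_P card_Un_disjoint card_image)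
qed

subsection \<open>Automorphisms\<close>

text \<open>A family of bijections of the group, one for each rank, induces an automorphism as soon as it respects
  the cosets and maps incident cosets to incident ones. It need not be a single bijection: the
  reflection below requires a different one in rank 2.\<close>

lemma pointwise_automorphism:
  assumes m: "\<And>j x. j < 3 \<Longrightarrow> x \<in> carrier G \<Longrightarrow> m j x \<in> carrier G"
    and m': "\<And>j x. j < 3 \<Longrightarrow> x \<in> carrier G \<Longrightarrow> m' j x \<in> carrier G"
    and m'm: "\<And>j x. j < 3 \<Longrightarrow> x \<in> carrier G \<Longrightarrow> m' j (m j x) = x"
    and mm': "\<And>j x. j < 3 \<Longrightarrow> x \<in> carrier G \<Longrightarrow> m j (m' j x) = x"
    and coset: "\<And>j x. j < 3 \<Longrightarrow> x \<in> carrier G \<Longrightarrow> F j (m j (h j \<otimes> x)) = F j (m j x)"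
    and coset': "\<And>j x. j < 3 \<Longrightarrow> x \<in> carrier G \<Longrightarrow> F j (m' j (h j \<otimes> x)) = F j (m' j x)"
    and meet: "\<And>j k z. j < k \<Longrightarrow> k < 3 \<Longrightarrow> z \<in> carrier G \<Longrightarrow>
      \<exists>u\<in>carrier G. F j u = F j (m j z) \<and> F k u = F k (m k z)"
    and meet': "\<And>j k z. j < k \<Longrightarrow> k < 3 \<Longrightarrow> z \<in> carrier G \<Longrightarrow>
      \<exists>u\<in>carrier G. F j u = F j (m' j z) \<and> F k u = F k (m' k z)"
  shows "\<exists>f\<in>automorphisms P. \<forall>j<3. \<forall>x\<in>carrier G. f (F j x) = F j (m j x)"
proof -
  define lift where "lift n X = (case X of Proper_Face j A \<Rightarrow>
      F j (n j (SOME x. x \<in> carrier G \<and> A = H j #> x)) | _ \<Rightarrow> X)" for n X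
  have lift_bounds: "lift n Least_Face = Least_Face" "lift n Greatest_Face = Greatest_Face" for n
    by (auto simp: lift_def)
  have respects: "F j (n j x) = F j (n j y)"
    if n: "\<And>x. x \<in> carrier G \<Longrightarrow> F j (n j (h j \<otimes> x)) = F j (n j x)"
      and xy: "H j #> x = H j #> y" "x \<in> carrier G" "y \<in> carrier G" for j x y and n :: "nat \<Rightarrow> 'a \<Rightarrow> 'a"
  proof -
    obtain g where g: "g \<in> H j" "x = g \<otimes> y"
      by (rule coset_eqE[OF xy])
    then obtain k :: nat where k: "x = h j [^] k \<otimes> y"
      unfolding H_eq by blast
    have "F j (n j (h j [^] k \<otimes> y)) = F j (n j y)" for k :: nat
    proof (induction k)
      case (Suc k)
      have "h j [^] Suc k \<otimes> y = h j \<otimes> (h j [^] k \<otimes> y)"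
        using xy unfolding nat_pow_Suc2[OF h_in] by (simp add: m_assoc)
      then show ?case
        using n[of "h j [^] k \<otimes> y"] Suc xy by simp
    qed (use xy in simp)
    then show ?thesis using k by simp
  qed
  have lift_F: "lift n (F j x) = F j (n j x)"
    if n: "\<And>x. x \<in> carrier G \<Longrightarrow> F j (n j (h j \<otimes> x)) = F j (n j x)"
      and x: "x \<in> carrier G" for j x n
  proof -
    let ?y = "SOME y. y \<in> carrier G \<and> H j #> x = H j #> y"
    have y: "?y \<in> carrier G \<and> H j #> x = H j #> ?y"
      using x by (intro someI[of "\<lambda>y. y \<in> carrier G \<and> H j #> x = H j #> y" x]) simp
    have "F j (n j x) = F j (n j ?y)"
      by (rule respects[OF _ conjunct2[OF y] x conjunct1[OF y]]) (rule n)
    then show ?thesis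
      by (simp add: lift_def F_def)
  qed
  have lm: "lift m (F j x) = F j (m j x)" if "j < 3" "x \<in> carrier G" for j x
    using lift_F[of j m x] coset that by blast
  have lm': "lift m' (F j x) = F j (m' j x)" if "j < 3" "x \<in> carrier G" for j x
    using lift_F[of j m' x] coset' that by blast
  have face_cases: "X = Least_Face \<or> X = Greatest_Face \<or> (\<exists>j<3. \<exists>x\<in>carrier G. X = F j x)"
    if "X \<in> faces P" for X
    using that unfolding faces_P by blast
  have closed: "lift m X \<in> faces P" "lift m' X \<in> faces P" "lift m' (lift m X) = X" "lift m (lift m' X) = X"
    "mix_face_rank 3 (lift m X) = mix_face_rank 3 X"
    if "X \<in> faces P" for X
    using face_cases[OF that] lm lm' m m' mm' m'm by (auto simp: lift_bounds)
  have mono: "mix_face_le (lift n X) (lift n Y)"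
    if n: "\<And>j x. j < 3 \<Longrightarrow> x \<in> carrier G \<Longrightarrow> n j x \<in> carrier G"
      "\<And>j x. j < 3 \<Longrightarrow> x \<in> carrier G \<Longrightarrow> lift n (F j x) = F j (n j x)"
      "\<And>j k z. j < k \<Longrightarrow> k < 3 \<Longrightarrow> z \<in> carrier G \<Longrightarrow>
        \<exists>u\<in>carrier G. F j u = F j (n j z) \<and> F k u = F k (n k z)"
      and XY: "X \<in> faces P" "Y \<in> faces P" "mix_face_le X Y" for n X Y
  proof -
    consider "X = Least_Face" | "Y = Greatest_Face" | "X = Greatest_Face" | "Y = Least_Face"
      | j x k y where "j < 3" "x \<in> carrier G" "X = F j x" "k < 3" "y \<in> carrier G" "Y = F k y"
      using face_cases[OF XY(1)] face_cases[OF XY(2)] by blast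
    then show ?thesis
    proof cases
      case 5
      then consider "X = Y" | z where "j < k" "z \<in> carrier G" "F j z = F j x" "F k z = F k y"
        using XY(3) le_F_iff[OF 5(2,5)] by blast
      then show ?thesis
      proof cases
        case 1
        then show ?thesis using n(2)[OF 5(1,2)] 5(3) le_F_same by auto
      next
        case 2
        then have XY': "X = F j z" "Y = F k z" using 5 by auto
        obtain u where "u \<in> carrier G" "F j u = F j (n j z)" "F k u = F k (n k z)"
          using n(3)[OF 2(1) 5(4) 2(2)] by blast
        then show ?thesis
          unfolding XY' n(2)[OF 5(1) 2(2)] n(2)[OF 5(4) 2(2)]
          using le_F_common[OF 2(1), of u] by simp
      qed
    next
      case 4
      then have "X = Least_Face" using XY(3) by (cases X) auto
      then show ?thesis by (simp add: lift_bounds)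
    next
      case 3
      then show ?thesis using XY(3) by (simp add: lift_bounds)
    qed (simp_all add: lift_bounds le_Greatest)
  qed
  have le: "mix_face_le (lift m X) (lift m Y) \<longleftrightarrow> mix_face_le X Y" if "X \<in> faces P" "Y \<in> faces P" for X Y
  proof
    assume "mix_face_le (lift m X) (lift m Y)"
    then show "mix_face_le X Y"
      using mono[OF m' lm' meet', of "lift m X" "lift m Y"] closed(1,3) that by simp
  next
    assume "mix_face_le X Y"
    then show "mix_face_le (lift m X) (lift m Y)"
      using mono[OF m lm meet, of X Y] that by simp
  qed
  have bij: "bij_betw (lift m) (faces P) (faces P)"
    by (rule bij_betw_byWitness[where f' = "lift m'"]) (use closed in auto)
  let ?f = "restrict (lift m) (faces P)"
  have "?f \<in> automorphisms P"
  proof (rule automorphismsI)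
    show "bij_betw ?f (faces P) (faces P)"
      using bij by (simp cong: bij_betw_cong)
  qed (use closed le in auto)
  moreover have "?f (F j x) = F j (m j x)" if "j < 3" "x \<in> carrier G" for j x
    using that lm by simp
  ultimately show ?thesis by blast
qed

lemma right_translation:
  assumes g: "g \<in> carrier G"
  shows "\<exists>f\<in>automorphisms P. \<forall>j<3. \<forall>x\<in>carrier G. f (F j x) = F j (x \<otimes> g)"
proof -
  have coset: "F j (h j \<otimes> x \<otimes> g) = F j (x \<otimes> g)" if "x \<in> carrier G" "g \<in> carrier G" for j x g
    using that coset_mult_left[OF _ h_in_H, of "x \<otimes> g" j] by (simp add: F_inj m_assoc)
  show ?thesis
    by (rule pointwise_automorphism[where m = "\<lambda>j x. x \<otimes> g" and m' = "\<lambda>j x. x \<otimes> inv g"])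
      (use g coset in \<open>auto simp: m_assoc\<close>)
qed

lemma cancel: "x \<in> carrier G \<Longrightarrow> y \<in> carrier G \<Longrightarrow> x \<otimes> (inv x \<otimes> y) = y"
  by (simp add: m_assoc[symmetric])

lemma \<alpha>_in: "x \<in> carrier G \<Longrightarrow> \<alpha> x \<in> carrier G"
  and \<alpha>_mult: "x \<in> carrier G \<Longrightarrow> y \<in> carrier G \<Longrightarrow> \<alpha> (x \<otimes> y) = \<alpha> x \<otimes> \<alpha> y"
  using \<alpha>_hom by (auto simp: hom_def)

lemma \<alpha>_group_hom: "group_hom G G \<alpha>"
  using \<alpha>_hom by unfold_locales

lemma \<alpha>_inv: "x \<in> carrier G \<Longrightarrow> \<alpha> (inv x) = inv (\<alpha> x)"
  using group_hom.hom_inv[OF \<alpha>_group_hom] by simp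

lemma \<alpha>_\<alpha>: assumes "x \<in> carrier G" shows "\<alpha> (\<alpha> x) = x"
proof -
  have "\<alpha> (\<alpha> a) = a"
    by (simp add: \<alpha>_a \<alpha>_b \<alpha>_mult m_assoc cancel)
  moreover have "\<alpha> (\<alpha> b) = b"
    by (simp add: \<alpha>_b \<alpha>_inv)
  moreover have "x \<in> generate G {a, b}"
    using assms gen by simp
  then have "x \<in> carrier G \<and> (\<alpha> (\<alpha> a) = a \<longrightarrow> \<alpha> (\<alpha> b) = b \<longrightarrow> \<alpha> (\<alpha> x) = x)"
  proof (induction rule: generate.induct)
    case one
    then show ?case using group_hom.hom_one[OF \<alpha>_group_hom] by simp
  next
    case (inv g)
    then show ?case by (auto simp: \<alpha>_inv \<alpha>_in)
  next
    case (eng g g')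
    then show ?case by (auto simp: \<alpha>_mult \<alpha>_in)
  qed auto
  ultimately show ?thesis by blast
qed

text \<open>The automorphism \<open>\<alpha>\<close> plays the role of conjugation by the reflection fixing the base vertex and
  the base edge. That reflection moves the base 2-face to the one containing \<open>b\<close>, which explains the
  factor \<open>b\<close> in rank 2.\<close>

lemma reflection:
  "\<exists>f\<in>automorphisms P. \<forall>x\<in>carrier G.
     f (F 0 x) = F 0 (\<alpha> x) \<and> f (F 1 x) = F 1 (\<alpha> x) \<and> f (F 2 x) = F 2 (b \<otimes> \<alpha> x)"
proof -
  define m where "m j x = (if j = 2 then b \<otimes> \<alpha> x else \<alpha> x)" for j :: nat and x
  have m_simps: "m 0 x = \<alpha> x" "m 1 x = \<alpha> x" "m 2 x = b \<otimes> \<alpha> x" for x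
    by (auto simp: m_def)
  have m_in: "m j x \<in> carrier G" if "x \<in> carrier G" for j x
    using that \<alpha>_in by (simp add: m_def)
  have mm: "m j (m j x) = x" if "x \<in> carrier G" for j x
    using that by (simp add: m_def \<alpha>_in \<alpha>_mult \<alpha>_\<alpha> \<alpha>_b cancel)
  have coset: "F j (m j (h j \<otimes> x)) = F j (m j x)" if j: "j < 3" and x: "x \<in> carrier G" for j x
  proof -
    have y: "\<alpha> x \<in> carrier G" using x \<alpha>_in by simp
    have "F 0 (\<alpha> (b \<otimes> x)) = F 0 (\<alpha> x)"
      using coset_inv_b[OF y] x by (simp add: F_inj \<alpha>_mult \<alpha>_b)
    moreover have "\<alpha> (a \<otimes> b \<otimes> x) = a \<otimes> b \<otimes> \<alpha> x"
      using x y by (simp add: \<alpha>_mult \<alpha>_a \<alpha>_b m_assoc cancel)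
    then have "F 1 (\<alpha> (a \<otimes> b \<otimes> x)) = F 1 (\<alpha> x)"
      using coset_t[OF y] by (simp add: F_inj)
    moreover have "b \<otimes> \<alpha> (a \<otimes> x) = (b \<otimes> (a \<otimes> b)) \<otimes> (b \<otimes> \<alpha> x)"
      using x y by (simp add: \<alpha>_mult \<alpha>_a m_assoc)
    then have "F 2 (b \<otimes> \<alpha> (a \<otimes> x)) = F 2 (b \<otimes> \<alpha> x)"
      using coset_inv_a[of "b \<otimes> \<alpha> x"] y by (simp add: F_inj bab)
    ultimately show ?thesis
      using less_3_cases[OF j] by (auto simp: m_simps[unfolded One_nat_def])
  qed
  have meet: "\<exists>u\<in>carrier G. F j u = F j (m j z) \<and> F k u = F k (m k z)"
    if jk: "j < k" "k < 3" and z: "z \<in> carrier G" for j k z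
  proof -
    have y: "\<alpha> z \<in> carrier G" using z \<alpha>_in by simp
    have "j = 0 \<and> k = 1 \<or> j = 0 \<and> k = 2 \<or> j = 1 \<and> k = 2" using jk by linarith
    then show ?thesis
    proof (elim disjE conjE)
      assume "j = 0" "k = 1" then show ?thesis using y by (auto simp: m_def)
    next
      assume "j = 0" "k = 2" then show ?thesis
        using y coset_b[OF y] by (intro bexI[of _ "b \<otimes> \<alpha> z"]) (auto simp: m_def F_inj)
    next
      assume "j = 1" "k = 2" then show ?thesis
        using y coset_t[OF y] coset2_t[OF y] by (intro bexI[of _ "a \<otimes> b \<otimes> \<alpha> z"]) (auto simp: m_def F_inj)
    qed
  qed
  have "\<exists>f\<in>automorphisms P. \<forall>j<3. \<forall>x\<in>carrier G. f (F j x) = F j (m j x)"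
    by (rule pointwise_automorphism[of m m, OF m_in m_in mm mm coset coset meet meet])
  then obtain f where f: "f \<in> automorphisms P" "\<forall>j<3. \<forall>x\<in>carrier G. f (F j x) = F j (m j x)"
    by blast
  show ?thesis
    by (rule bexI[OF _ f(1)]) (use f(2) in \<open>simp add: m_def\<close>)
qed

subsection \<open>An automorphism fixing the base flag is trivial\<close>

lemma automorphism_F:
  assumes "f \<in> automorphisms P" "j < 3" "x \<in> carrier G"
  obtains y where "y \<in> carrier G" "f (F j x) = F j y"
proof -
  have "f (F j x) \<in> faces P" "mix_face_rank 3 (f (F j x)) = int j"
    using automorphismsD(3,4)[OF assms(1) F_in[OF assms(2,3)]] by auto
  then obtain k y where "y \<in> carrier G" "f (F j x) = F k y" "int k = int j"
    using assms(2) unfolding faces_P by auto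
  then show ?thesis using that by auto
qed

lemma automorphism_inj:
  assumes "f \<in> automorphisms P" "f X = f Y" "X \<in> faces P" "Y \<in> faces P"
  shows "X = Y"
  using automorphismsD(2)[OF assms(1)] assms(2-) by (auto simp: bij_betw_def dest: inj_onD)

text \<open>The diamond condition in rank 1: of the edges at the vertex \<open>F 0 y\<close>, only two lie on a given 2-face.
  Here \<open>\<langle>a\<rangle> \<inter> \<langle>b\<rangle> = 1\<close> enters.\<close>

lemma edge_between:
  assumes le: "mix_face_le (F 0 y) (F 1 w)" "mix_face_le (F 1 w) (F 2 (b \<otimes> y))"
    and y: "y \<in> carrier G" and w: "w \<in> carrier G"
  shows "F 1 w = F 1 y \<or> F 1 w = F 1 (b \<otimes> y)"
proof -
  obtain z where z: "z \<in> carrier G" "F 0 z = F 0 y" "F 1 z = F 1 w"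
    using le(1) le_F_iff[OF y w] by auto
  obtain u where u: "u \<in> carrier G" "F 1 u = F 1 w" "F 2 u = F 2 (b \<otimes> y)"
    using le(2) le_F_iff[OF w, of "b \<otimes> y"] y by auto
  have "u = z \<or> u = a \<otimes> b \<otimes> z"
    using edge_cases[of u z] z u by (simp add: F_inj)
  then show ?thesis
  proof
    assume "u = z"
    then have "z = b \<otimes> y"
      using eq_if_two_cosets_eq[of 0 z "b \<otimes> y" 2] z u y coset_b[OF y] by (simp add: F_inj)
    then show ?thesis using z by simp
  next
    assume "u = a \<otimes> b \<otimes> z"
    then have "b \<otimes> z = b \<otimes> y"
      using eq_if_two_cosets_eq[of 0 "b \<otimes> z" "b \<otimes> y" 2] z u y coset_b coset2_t[of z]
      by (simp add: F_inj)
    then show ?thesis using z y by simp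
  qed
qed

lemma fixes_next_edge:
  assumes f: "f \<in> automorphisms P" and y: "y \<in> carrier G"
    and fixed: "f (F 0 y) = F 0 y" "f (F 1 y) = F 1 y" "f (F 2 (b \<otimes> y)) = F 2 (b \<otimes> y)"
  shows "f (F 1 (b \<otimes> y)) = F 1 (b \<otimes> y)"
proof -
  obtain w where w: "w \<in> carrier G" "f (F 1 (b \<otimes> y)) = F 1 w"
    using automorphism_F[OF f, of 1 "b \<otimes> y"] y by auto
  have 0: "F 0 (b \<otimes> y) = F 0 y" using coset_b[OF y] by (simp add: F_inj)
  have "mix_face_le (F 0 y) (F 1 w)"
    using automorphismsD(5)[OF f, of "F 0 y" "F 1 (b \<otimes> y)"] le_F_common[of 0 1 "b \<otimes> y"] y w fixed 0 by simp
  moreover have "mix_face_le (F 1 w) (F 2 (b \<otimes> y))"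
    using automorphismsD(5)[OF f, of "F 1 (b \<otimes> y)" "F 2 (b \<otimes> y)"] le_F_common[of 1 2 "b \<otimes> y"] y w fixed by simp
  ultimately have "F 1 w = F 1 y \<or> F 1 w = F 1 (b \<otimes> y)"
    using edge_between y w by blast
  then show ?thesis
  proof
    assume "F 1 w = F 1 y"
    then have "f (F 1 (b \<otimes> y)) = f (F 1 y)" using w fixed by simp
    then have "F 1 (b \<otimes> y) = F 1 y"
      using automorphism_inj[OF f, of "F 1 (b \<otimes> y)" "F 1 y"] y by simp
    then show ?thesis using fixed by simp
  qed (use w in simp)
qed

lemma fixes_other_end:
  assumes f: "f \<in> automorphisms P" and y: "y \<in> carrier G" and j: "j = 0 \<or> j = 2"
    and fixed: "f (F 1 y) = F 1 y" "f (F j y) = F j y"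
  shows "f (F j (a \<otimes> b \<otimes> y)) = F j (a \<otimes> b \<otimes> y)"
proof -
  let ?y = "a \<otimes> b \<otimes> y"
  have j3: "j < 3" using j by auto
  obtain w where w: "w \<in> carrier G" "f (F j ?y) = F j w"
    using automorphism_F[OF f j3, of ?y] y by auto
  have 1: "F 1 ?y = F 1 y" using coset_t[OF y] by (simp add: F_inj)
  have "\<exists>z\<in>carrier G. F 1 z = F 1 y \<and> F j z = F j w"
    using j
  proof
    assume j: "j = 0"
    have "mix_face_le (F 0 w) (F 1 y)"
      using automorphismsD(5)[OF f, of "F 0 ?y" "F 1 y"] le_F_common[of 0 1 ?y] y w fixed 1 j by simp
    then show ?thesis using le_F_iff[OF w(1) y] j by auto
  next
    assume j: "j = 2"
    have "mix_face_le (F 1 y) (F 2 w)"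
      using automorphismsD(5)[OF f, of "F 1 y" "F 2 ?y"] le_F_common[of 1 2 ?y] y w fixed 1 j by simp
    then show ?thesis using le_F_iff[OF y w(1)] j by auto
  qed
  then obtain z where z: "z \<in> carrier G" "F 1 z = F 1 y" "F j z = F j w" by blast
  then have "z = y \<or> z = ?y"
    using edge_cases[of z y] y by (simp add: F_inj)
  then show ?thesis
  proof
    assume "z = y"
    then have "f (F j ?y) = f (F j y)" using w z fixed by simp
    then have "F j ?y = F j y"
      using automorphism_inj[OF f, of "F j ?y" "F j y"] y j3 by simp
    then show ?thesis using fixed by simp
  qed (use w z in simp)
qed

definition fixes_at :: "('a mix_face \<Rightarrow> 'a mix_face) \<Rightarrow> 'a \<Rightarrow> bool" where
  "fixes_at f x \<longleftrightarrow> f (F 0 x) = F 0 x \<and> f (F 1 x) = F 1 x \<and> f (F 2 x) = F 2 x"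

text \<open>Walking from a fixed flag to the two flags named by \<open>bx\<close> and \<open>inv a x\<close> passes only through adjacent flags,
  each of which is determined by its predecessor.\<close>

lemma fixes_at_step:
  assumes f: "f \<in> automorphisms P" and x: "x \<in> carrier G" and fixed: "fixes_at f x"
  shows "fixes_at f (b \<otimes> x)" "fixes_at f (inv a \<otimes> x)"
proof -
  let ?t = "a \<otimes> b \<otimes> x"
  have t0: "f (F 0 ?t) = F 0 ?t" and t2: "f (F 2 ?t) = F 2 ?t"
    using fixes_other_end[OF f x, of 0] fixes_other_end[OF f x, of 2] fixed by (auto simp: fixes_at_def)
  have "F 2 ?t = F 2 (b \<otimes> x)" "F 0 (b \<otimes> x) = F 0 x"
    using coset2_t[OF x] coset_b[OF x] by (auto simp: F_inj)
  then show "fixes_at f (b \<otimes> x)"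
    using t2 fixed fixes_next_edge[OF f x] by (simp add: fixes_at_def)
  have eqs: "F 1 ?t = F 1 x" "F 0 ?t = F 0 (inv a \<otimes> x)" "F 2 (inv a \<otimes> x) = F 2 x"
    using coset_t[OF x] coset0_t[OF x] coset_inv_a[OF x] by (auto simp: F_inj)
  have bt: "b \<otimes> ?t = inv a \<otimes> x"
    using bab x by (simp add: m_assoc[symmetric])
  have "f (F 1 (b \<otimes> ?t)) = F 1 (b \<otimes> ?t)"
    by (rule fixes_next_edge[OF f _ t0]) (use x fixed bt eqs in \<open>auto simp: fixes_at_def\<close>)
  then show "fixes_at f (inv a \<otimes> x)"
    using t0 eqs fixed bt by (simp add: fixes_at_def)
qed

text \<open>The group is finite, so a set closed under left multiplication by \<open>b\<close> and \<open>inv a\<close> is also closed under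
  their inverses.\<close>

lemma fixes_everywhere:
  assumes f: "f \<in> automorphisms P" and base: "fixes_at f \<one>" and x: "x \<in> carrier G"
  shows "fixes_at f x"
proof -
  define X where "X = {x \<in> carrier G. fixes_at f x}"
  have finX: "finite X" using fin by (simp add: X_def)
  have surj: "(\<otimes>) g ` X = X" if g: "g \<in> carrier G" "\<And>x. x \<in> X \<Longrightarrow> g \<otimes> x \<in> X" for g
  proof (rule endo_inj_surj[OF finX])
    show "inj_on ((\<otimes>) g) X"
      by (rule inj_onI) (use g in \<open>auto simp: X_def\<close>)
  qed (use g in auto)
  have inv_step: "inv g \<otimes> x \<in> X" if g: "g \<in> carrier G" "\<And>x. x \<in> X \<Longrightarrow> g \<otimes> x \<in> X" and x: "x \<in> X" for g x
  proof -
    have "x \<in> (\<otimes>) g ` X" using surj[OF g] x by simp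
    then obtain y where "y \<in> X" "x = g \<otimes> y" by blast
    then show ?thesis using g by (simp add: X_def m_assoc[symmetric])
  qed
  have b: "b \<otimes> x \<in> X" and a': "inv a \<otimes> x \<in> X" if "x \<in> X" for x
    using fixes_at_step[OF f, of x] that by (auto simp: X_def)
  have b': "inv b \<otimes> x \<in> X" and a: "a \<otimes> x \<in> X" if "x \<in> X" for x
    using inv_step[of b x] inv_step[of "inv a" x] a' b that by auto
  have "x \<in> generate G {a, b}" using x gen by simp
  then have "x \<in> carrier G \<and> (\<forall>y\<in>X. x \<otimes> y \<in> X)"
  proof (induction rule: generate.induct)
    case (eng g g')
    then show ?case by (auto simp: m_assoc X_def)
  qed (use a b a' b' in \<open>auto simp: X_def\<close>)
  moreover have "\<one> \<in> X" using base by (simp add: X_def)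
  ultimately show ?thesis by (auto simp: X_def)
qed

lemma automorphism_bounds:
  assumes f: "f \<in> automorphisms P"
  shows "f Least_Face = Least_Face" "f Greatest_Face = Greatest_Face"
proof -
  have "f Least_Face \<in> faces P" "mix_face_rank 3 (f Least_Face) = -1"
    "f Greatest_Face \<in> faces P" "mix_face_rank 3 (f Greatest_Face) = 3"
    using automorphismsD(3,4)[OF f, of Least_Face] automorphismsD(3,4)[OF f, of Greatest_Face] by auto
  then show "f Least_Face = Least_Face" "f Greatest_Face = Greatest_Face"
    unfolding faces_P by auto
qed

lemma flag_rigid:
  assumes f: "f \<in> automorphisms P" and fixed: "\<And>X. X \<in> flag \<one> \<Longrightarrow> f X = X" and X: "X \<in> faces P"
  shows "f X = X"
proof -
  have "fixes_at f \<one>" using fixed by (auto simp: fixes_at_def flag_def)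
  then have "fixes_at f x" if "x \<in> carrier G" for x
    using fixes_everywhere[OF f _ that] by blast
  then have "f (F j x) = F j x" if "j < 3" "x \<in> carrier G" for j x
    using less_3_cases[OF that(1)] that(2) by (auto simp: fixes_at_def)
  then show ?thesis
    using X automorphism_bounds[OF f] unfolding faces_P by auto
qed

text \<open>Right translations reach the flags \<open>flag g\<close>, and following the reflection they reach the
  mirror images; with rigidity, automorphisms and flags correspond one to one.\<close>

lemma bij_automorphisms_flags: "bij_betw (\<lambda>f. f ` flag \<one>) (automorphisms P) (flags P)"
proof -
  have sub: "flag \<one> \<subseteq> faces P" and rank: "inj_on (face_rank P) (flag \<one>)"
    by (auto simp: flag_def inj_on_def)
  have "inj_on (\<lambda>f. f ` flag \<one>) (automorphisms P)"
  proof (rule inj_onI)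
    fix f f' assume *: "f \<in> automorphisms P" "f' \<in> automorphisms P" "f ` flag \<one> = f' ` flag \<one>"
    show "f = f'"
      by (rule rigid_flag_imp_eq[OF *(1,2) sub rank *(3)]) (rule flag_rigid)
  qed
  moreover have "f ` flag \<one> \<in> flags P" if "f \<in> automorphisms P" for f
    using automorphism_flag[OF that, of "flag \<one>"] flags_P by auto
  moreover have "\<exists>f\<in>automorphisms P. D = f ` flag \<one>" if D: "D \<in> flags P" for D
  proof -
    have "D \<in> flag ` carrier G \<or> D \<in> mirror_flag ` carrier G"
      using D by (simp add: flags_P)
    then obtain g where g: "g \<in> carrier G" "D = flag g \<or> D = mirror_flag g" by blast
    obtain r where r: "r \<in> automorphisms P"
      "\<forall>j<3. \<forall>x\<in>carrier G. r (F j x) = F j (x \<otimes> g)"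
      using right_translation[OF g(1)] by blast
    obtain s where s: "s \<in> automorphisms P" "\<forall>x\<in>carrier G.
        s (F 0 x) = F 0 (\<alpha> x) \<and> s (F 1 x) = F 1 (\<alpha> x) \<and> s (F 2 x) = F 2 (b \<otimes> \<alpha> x)"
      using reflection by blast
    have \<alpha>1: "\<alpha> \<one> = \<one>" using group_hom.hom_one[OF \<alpha>_group_hom] .
    from g(2) show ?thesis
    proof
      assume "D = flag g"
      moreover have "r ` flag \<one> = flag g"
        using r(2) g(1) automorphism_bounds[OF r(1)] by (simp add: flag_def)
      ultimately show ?thesis using r(1) by blast
    next
      assume D: "D = mirror_flag g"
      let ?f = "compose (faces P) r s"
      have f: "?f (F 0 \<one>) = F 0 g" "?f (F 1 \<one>) = F 1 g" "?f (F 2 \<one>) = F 2 (b \<otimes> g)"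
        using s(2) \<alpha>1 r(2) g(1) by (simp_all add: compose_eq)
      have "?f \<in> automorphisms P"
        by (rule automorphism_compose[OF r(1) s(1)])
      moreover have "?f ` flag \<one> = D"
        unfolding D mirror_flag_def flag_def
        using f automorphism_bounds[OF \<open>?f \<in> automorphisms P\<close>] by simp
      ultimately show ?thesis by blast
    qed
  qed
  ultimately show ?thesis
    unfolding bij_betw_def by blast
qed

subsection \<open>Counting\<close>

lemma card_rank:
  assumes "j < 3"
  shows "card {X \<in> faces P. face_rank P X = int j} * ord (h j) = card (carrier G)"
proof -
  have "{X \<in> faces P. face_rank P X = int j} = Proper_Face j ` (rcosets (H j))"
    using assms by (auto simp: coset_geometry_def)
  moreover have "inj_on (Proper_Face j) (rcosets (H j))"
    by (auto simp: inj_on_def)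
  ultimately have "card {X \<in> faces P. face_rank P X = int j} = card (rcosets (H j))"
    by (simp add: card_image)
  moreover have "card (rcosets (H j)) * card (H j) = card (carrier G)"
    using lagrange[OF subgroup_H] by (simp add: order_def)
  moreover have "card (H j) = ord (h j)"
    unfolding H_def using generate_pow_card[of "h j"] by simp
  ultimately show ?thesis by simp
qed

lemma ord_t: "ord (a \<otimes> b) = 2"
proof -
  have "card (H 1) = 2" unfolding H1 using t_ne by auto
  moreover have "card (H 1) = ord (h 1)"
    unfolding H_def using generate_pow_card[of "h 1"] by simp
  ultimately show ?thesis by simp
qed

theorem has_parameters_coset_geometry:
  assumes "card (carrier G) = n"
  shows "has_parameters P (n div ord b, n div 2, n div ord a, 2 * n)"
proof -
  have ord0: "ord b > 0" "ord a > 0"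
    using ord_ge_1[OF fin, of a] ord_ge_1[OF fin, of b] by auto
  have "card {X \<in> faces P. face_rank P X = 0} = n div ord b"
    using card_rank[of 0] assms ord0 by (simp del: face_rank_P) (metis nonzero_mult_div_cancel_right not_gr_zero)
  moreover have "card {X \<in> faces P. face_rank P X = 1} = n div 2"
    using card_rank[of 1] assms ord_t by (simp del: face_rank_P)
  moreover have "card {X \<in> faces P. face_rank P X = 2} = n div ord a"
    using card_rank[of 2] assms ord0 by (simp del: face_rank_P) (metis nonzero_mult_div_cancel_right not_gr_zero)
  ultimately show ?thesis
    using card_flags bij_betw_same_card[OF bij_automorphisms_flags] assms by simp
qed

end

section \<open>Products of rotation groups\<close>

text \<open>The mixing problem: in the product of rotation groups \<open>R r\<close> with generators \<open>u r\<close>, \<open>v r\<close>, how large is the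
  subgroup \<open>K\<close> generated by the diagonal elements?\<close>

locale rotation_family =
  fixes I :: "'i set" and R :: "'i \<Rightarrow> 'g monoid" and u v :: "'i \<Rightarrow> 'g" and \<alpha> :: "'i \<Rightarrow> 'g \<Rightarrow> 'g"
  assumes fin_I: "finite I" and I_ne: "I \<noteq> {}"
    and pair: "\<And>r. r \<in> I \<Longrightarrow> rotation_pair (R r) (u r) (v r) (\<alpha> r)"
begin

definition "D = product_group I R"

definition diag :: "('i \<Rightarrow> 'g) \<Rightarrow> 'i \<Rightarrow> 'g" where
  "diag x = (\<lambda>r\<in>I. x r)"

definition "K = generate D {diag u, diag v}"

definition single :: "'i \<Rightarrow> 'g \<Rightarrow> 'i \<Rightarrow> 'g" where
  "single r x = (\<lambda>s\<in>I. if s = r then x else \<one>\<^bsub>R s\<^esub>)"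

definition full :: "'i \<Rightarrow> bool" where
  "full r \<longleftrightarrow> (\<forall>x\<in>carrier (R r). single r x \<in> K)"

lemma group_R: "r \<in> I \<Longrightarrow> group (R r)"
  by (rule rotation_pair.axioms(1)[OF pair])

lemma monoid_R: "r \<in> I \<Longrightarrow> monoid (R r)"
  by (rule group.is_monoid[OF group_R])

lemma uv_in: "r \<in> I \<Longrightarrow> u r \<in> carrier (R r)" "r \<in> I \<Longrightarrow> v r \<in> carrier (R r)"
  by (rule rotation_pair.a_in[OF pair], assumption) (rule rotation_pair.b_in[OF pair])

lemma group_D: "group D"
  unfolding D_def by (rule product_group) (rule group_R)

lemma D_simps:
  "carrier D = (\<Pi>\<^sub>E r\<in>I. carrier (R r))"
  "\<one>\<^bsub>D\<^esub> = (\<lambda>r\<in>I. \<one>\<^bsub>R r\<^esub>)"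
  "x \<otimes>\<^bsub>D\<^esub> y = (\<lambda>r\<in>I. x r \<otimes>\<^bsub>R r\<^esub> y r)"
  by (auto simp: D_def)

lemma D_eqI:
  assumes "x \<in> carrier D" "y \<in> carrier D" "\<And>r. r \<in> I \<Longrightarrow> x r = y r"
  shows "x = y"
  using assms unfolding D_simps by (rule PiE_ext)

lemma D_at:
  assumes "r \<in> I" "x \<in> carrier D"
  shows "x r \<in> carrier (R r)"
  using assms by (auto simp: D_simps)

lemma inv_at:
  assumes "r \<in> I" "x \<in> carrier D"
  shows "(inv\<^bsub>D\<^esub> x) r = inv\<^bsub>R r\<^esub> x r"
  using assms inv_product_group[of x I R] group_R by (simp add: D_def)

lemma mult_at: "r \<in> I \<Longrightarrow> (x \<otimes>\<^bsub>D\<^esub> y) r = x r \<otimes>\<^bsub>R r\<^esub> y r"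
  and one_at: "r \<in> I \<Longrightarrow> \<one>\<^bsub>D\<^esub> r = \<one>\<^bsub>R r\<^esub>"
  by (auto simp: D_simps)

lemma pow_at:
  assumes "r \<in> I"
  shows "(x [^]\<^bsub>D\<^esub> (k :: nat)) r = x r [^]\<^bsub>R r\<^esub> k"
  by (induction k) (simp_all add: mult_at one_at assms)

lemma diag_in: "(\<And>r. r \<in> I \<Longrightarrow> x r \<in> carrier (R r)) \<Longrightarrow> diag x \<in> carrier D"
  by (auto simp: diag_def D_simps)

lemma diag_uv_in: "diag u \<in> carrier D" "diag v \<in> carrier D"
  by (rule diag_in, erule uv_in)+

lemma diag_at [simp]: "r \<in> I \<Longrightarrow> diag x r = x r"
  by (simp add: diag_def)

lemma single_in:
  assumes "r \<in> I" "x \<in> carrier (R r)"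
  shows "single r x \<in> carrier D"
  using assms monoid.one_closed[OF monoid_R] by (auto simp: single_def D_simps)

lemma single_at: "s \<in> I \<Longrightarrow> single r x s = (if s = r then x else \<one>\<^bsub>R s\<^esub>)"
  by (simp add: single_def)

lemma subgroup_K: "subgroup K D"
  unfolding K_def by (rule group.generate_is_subgroup[OF group_D]) (use diag_uv_in in auto)

lemma K_sub: "K \<subseteq> carrier D"
  using subgroup_K subgroup.subset by blast

lemma K_mult: "x \<in> K \<Longrightarrow> y \<in> K \<Longrightarrow> x \<otimes>\<^bsub>D\<^esub> y \<in> K"
  and K_inv: "x \<in> K \<Longrightarrow> inv\<^bsub>D\<^esub> x \<in> K"
  and K_one: "\<one>\<^bsub>D\<^esub> \<in> K"
  using subgroup_K by (auto simp: subgroup_def)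

lemma K_pow: "x \<in> K \<Longrightarrow> x [^]\<^bsub>D\<^esub> (k :: nat) \<in> K"
  using K_mult K_one by (induction k) (auto simp: monoid.nat_pow_Suc)

lemma diag_uv_K: "diag u \<in> K" "diag v \<in> K"
  unfolding K_def by (auto intro: generate.incl)

text \<open>Multiply together the coordinates of \<open>x\<close>, one full factor at a time.\<close>

lemma supported_on_full_in_K:
  assumes "x \<in> carrier D" "\<And>r. r \<in> I \<Longrightarrow> x r \<noteq> \<one>\<^bsub>R r\<^esub> \<Longrightarrow> full r"
  shows "x \<in> K"
proof -
  have "x \<in> K" if "finite J" "J \<subseteq> I" "x \<in> carrier D"
    "\<And>r. r \<in> J \<Longrightarrow> full r" "\<And>r. r \<in> I - J \<Longrightarrow> x r = \<one>\<^bsub>R r\<^esub>" for J x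
    using that
  proof (induction J arbitrary: x rule: finite_induct)
    case empty
    then have "x = \<one>\<^bsub>D\<^esub>"
      by (intro D_eqI) (auto simp: one_at monoid.one_closed[OF group.is_monoid[OF group_D]])
    then show ?case using K_one by simp
  next
    case (insert r J)
    define y where "y = (\<lambda>s\<in>I. if s = r then \<one>\<^bsub>R s\<^esub> else x s)"
    have r: "r \<in> I" using insert by auto
    have y: "y \<in> carrier D"
      using insert.prems(2) monoid.one_closed[OF monoid_R] by (auto simp: y_def D_simps)
    have y_at: "y s = (if s = r then \<one>\<^bsub>R s\<^esub> else x s)" if "s \<in> I" for s
      using that by (simp add: y_def)
    have "y \<in> K"
      by (rule insert.IH) (use insert y y_at in auto)
    moreover have "single r (x r) \<in> K"
      using insert.prems(3)[of r] D_at[OF r insert.prems(2)] by (simp add: full_def)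
    moreover have "x = y \<otimes>\<^bsub>D\<^esub> single r (x r)"
    proof (rule D_eqI[OF insert.prems(2)])
      show "y \<otimes>\<^bsub>D\<^esub> single r (x r) \<in> carrier D"
        using group_D y single_in[OF r D_at[OF r insert.prems(2)]]
        by (simp add: group.is_monoid monoid.m_closed)
      show "x s = (y \<otimes>\<^bsub>D\<^esub> single r (x r)) s" if s: "s \<in> I" for s
        using s monoid_R[OF s] D_at[OF s insert.prems(2)]
        by (cases "s = r") (auto simp: mult_at single_at y_at monoid.l_one monoid.r_one)
    qed
    ultimately show ?case using K_mult by metis
  qed
  note cover = this
  show ?thesis
  proof (rule cover[of "{r \<in> I. x r \<noteq> \<one>\<^bsub>R r\<^esub>}"])
    show "full r" if "r \<in> {r \<in> I. x r \<noteq> \<one>\<^bsub>R r\<^esub>}" for r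
      using assms(2)[of r] that by simp
  qed (use assms(1) fin_I in simp_all)
qed

lemma K_full:
  assumes "\<And>r. r \<in> I \<Longrightarrow> full r"
  shows "K = carrier D"
  using supported_on_full_in_K assms K_sub by blast

lemma single_mult:
  assumes "r \<in> I" "x \<in> carrier (R r)" "y \<in> carrier (R r)"
  shows "single r x \<otimes>\<^bsub>D\<^esub> single r y = single r (x \<otimes>\<^bsub>R r\<^esub> y)"
proof (rule D_eqI)
  have "x \<otimes>\<^bsub>R r\<^esub> y \<in> carrier (R r)"
    using assms monoid_R by (simp add: monoid.m_closed)
  then show "single r (x \<otimes>\<^bsub>R r\<^esub> y) \<in> carrier D"
    by (rule single_in[OF assms(1)])
  show "single r x \<otimes>\<^bsub>D\<^esub> single r y \<in> carrier D"
    using assms group_D by (simp add: group.is_monoid monoid.m_closed single_in)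
  show "(single r x \<otimes>\<^bsub>D\<^esub> single r y) s = single r (x \<otimes>\<^bsub>R r\<^esub> y) s" if "s \<in> I" for s
    using that monoid_R[OF that] by (simp add: mult_at single_at monoid.l_one monoid.one_closed)
qed

text \<open>The elements of one factor that \<open>K\<close> contains form a normal subgroup of that factor, because
  \<open>K\<close> projects onto it.\<close>

definition slice :: "'i \<Rightarrow> 'g set" where
  "slice r = {x \<in> carrier (R r). single r x \<in> K}"

lemma subgroup_slice:
  assumes r: "r \<in> I"
  shows "subgroup (slice r) (R r)"
proof (rule group.subgroupI[OF group_R[OF r]])
  have "single r \<one>\<^bsub>R r\<^esub> = \<one>\<^bsub>D\<^esub>"
    by (auto simp: single_def D_simps)
  then show "slice r \<noteq> {}"
    using K_one monoid.one_closed[OF monoid_R[OF r]] by (auto simp: slice_def)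
  show "slice r \<subseteq> carrier (R r)"
    by (auto simp: slice_def)
  fix x y assume x: "x \<in> slice r"
  have x': "x \<in> carrier (R r)" "single r x \<in> K" using x by (auto simp: slice_def)
  have ix: "inv\<^bsub>R r\<^esub> x \<in> carrier (R r)" using x' group_R[OF r] by (simp add: group.inv_closed)
  have "single r (inv\<^bsub>R r\<^esub> x) = inv\<^bsub>D\<^esub> single r x"
  proof (rule D_eqI)
    show "inv\<^bsub>D\<^esub> single r x \<in> carrier D"
      using K_inv[OF x'(2)] K_sub by auto
    show "single r (inv\<^bsub>R r\<^esub> x) s = (inv\<^bsub>D\<^esub> single r x) s" if "s \<in> I" for s
      using that inv_at[OF that single_in[OF r x'(1)]] monoid.inv_one[OF monoid_R[OF that]]
      by (simp add: single_at)
  qed (rule single_in[OF r ix])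
  then show "inv\<^bsub>R r\<^esub> x \<in> slice r"
    using ix K_inv[OF x'(2)] by (simp add: slice_def)
  assume y: "y \<in> slice r"
  then show "x \<otimes>\<^bsub>R r\<^esub> y \<in> slice r"
    using x' K_mult[of "single r x" "single r y"] single_mult[OF r] monoid_R[OF r]
    by (simp add: slice_def monoid.m_closed)
qed

lemma slice_normal:
  assumes r: "r \<in> I" and g: "g \<in> K" and x: "x \<in> slice r"
  shows "g r \<otimes>\<^bsub>R r\<^esub> x \<otimes>\<^bsub>R r\<^esub> inv\<^bsub>R r\<^esub> (g r) \<in> slice r"
proof -
  have gD: "g \<in> carrier D" using g K_sub by auto
  have gr: "g r \<in> carrier (R r)" by (rule D_at[OF r gD])
  have x': "x \<in> carrier (R r)" "single r x \<in> K" using x by (auto simp: slice_def)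
  let ?c = "g r \<otimes>\<^bsub>R r\<^esub> x \<otimes>\<^bsub>R r\<^esub> inv\<^bsub>R r\<^esub> (g r)"
  have c: "?c \<in> carrier (R r)"
    using gr x' group_R[OF r] by (simp add: group.is_monoid group.inv_closed monoid.m_closed)
  have conj: "g \<otimes>\<^bsub>D\<^esub> single r x \<otimes>\<^bsub>D\<^esub> inv\<^bsub>D\<^esub> g \<in> K"
    using g x' K_mult K_inv by blast
  have "single r ?c = g \<otimes>\<^bsub>D\<^esub> single r x \<otimes>\<^bsub>D\<^esub> inv\<^bsub>D\<^esub> g"
  proof (rule D_eqI[OF single_in[OF r c]])
    show "g \<otimes>\<^bsub>D\<^esub> single r x \<otimes>\<^bsub>D\<^esub> inv\<^bsub>D\<^esub> g \<in> carrier D"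
      using conj K_sub by auto
    show "single r ?c s = (g \<otimes>\<^bsub>D\<^esub> single r x \<otimes>\<^bsub>D\<^esub> inv\<^bsub>D\<^esub> g) s" if s: "s \<in> I" for s
      using D_at[OF s gD] group_R[OF s]
      by (simp add: mult_at[OF s] inv_at[OF s gD] single_at[OF s] monoid.r_one[OF monoid_R[OF s]] group.r_inv)
  qed
  then show ?thesis using c conj by (simp add: slice_def)
qed

lemma full_if_uv_in_slice:
  assumes r: "r \<in> I" and uv: "u r \<in> slice r" "v r \<in> slice r"
  shows "full r"
proof -
  have "generate (R r) {u r, v r} \<subseteq> slice r"
    by (rule group.generate_subgroup_incl[OF group_R[OF r] _ subgroup_slice[OF r]]) (use uv in auto)
  then show ?thesis
    using rotation_pair.gen[OF pair[OF r]] by (auto simp: full_def slice_def)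
qed

lemma slice_pow: "r \<in> I \<Longrightarrow> x \<in> slice r \<Longrightarrow> x [^]\<^bsub>R r\<^esub> (k :: nat) \<in> slice r"
  using subgroup_slice[of r] by (induction k) (auto simp: subgroup_def)

text \<open>If \<open>k\<close> kills the generator \<open>x\<close> in every other factor and is prime to its order in the factor \<open>r\<close>, then the
  \<open>k\<close>-th power isolates \<open>x r\<close>. Modulo the normal closure of \<open>x r\<close> the relation \<open>(y x)\<^sup>2 = 1\<close> becomes
  \<open>y\<^sup>2 = 1\<close>, so \<open>y r\<close> lies in that normal closure when its order is odd.\<close>

lemma isolated_generator:
  assumes r: "r \<in> I" and K: "diag x \<in> K" "diag y \<in> K"
    and xy: "x r \<in> carrier (R r)" "y r \<in> carrier (R r)"
    and rel: "y r \<otimes>\<^bsub>R r\<^esub> x r \<otimes>\<^bsub>R r\<^esub> (y r \<otimes>\<^bsub>R r\<^esub> x r) = \<one>\<^bsub>R r\<^esub>"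
    and others: "\<And>s. s \<in> I \<Longrightarrow> s \<noteq> r \<Longrightarrow> x s [^]\<^bsub>R s\<^esub> k = \<one>\<^bsub>R s\<^esub>"
    and k: "coprime k (group.ord (R r) (x r))" and odd: "odd (group.ord (R r) (y r))"
  shows "x r \<in> slice r" "y r \<in> slice r"
proof -
  interpret group "R r" by (rule group_R[OF r])
  have "single r (x r [^]\<^bsub>R r\<^esub> k) = diag x [^]\<^bsub>D\<^esub> k"
  proof (rule D_eqI)
    show "diag x [^]\<^bsub>D\<^esub> k \<in> carrier D" using K_pow[OF K(1)] K_sub by auto
    show "single r (x r [^]\<^bsub>R r\<^esub> k) s = (diag x [^]\<^bsub>D\<^esub> k) s" if "s \<in> I" for s
      using that others[OF that] by (simp add: single_at pow_at)
  qed (use r xy single_in in simp)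
  then have "x r [^]\<^bsub>R r\<^esub> k \<in> slice r"
    using K_pow[OF K(1), of k] xy by (simp add: slice_def)
  then have pows: "x r [^]\<^bsub>R r\<^esub> (k * m) \<in> slice r" for m :: nat
    using slice_pow[OF r, of "x r [^]\<^bsub>R r\<^esub> k" m] xy by (simp add: nat_pow_pow)
  show x: "x r \<in> slice r"
  proof (cases "k = 0")
    case True
    then have "x r = \<one>\<^bsub>R r\<^esub>"
      using k xy ord_eq_1[of "x r"] by simp
    then show ?thesis using pows[of 0] by simp
  next
    case False
    then obtain m l where "k * m = ord (x r) * l + 1"
      using bezout_nat[of k "ord (x r)"] k by auto
    then have "x r [^]\<^bsub>R r\<^esub> (k * m) = x r"
      using xy by (simp add: nat_pow_pow[symmetric])
    then show ?thesis using pows[of m] by simp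
  qed
  interpret S: subgroup "slice r" "R r" by (rule subgroup_slice[OF r])
  have "y r \<otimes>\<^bsub>R r\<^esub> y r \<in> slice r"
  proof -
    let ?c = "y r \<otimes>\<^bsub>R r\<^esub> x r \<otimes>\<^bsub>R r\<^esub> inv\<^bsub>R r\<^esub> (y r)"
    have c: "?c \<in> slice r"
      using slice_normal[OF r K(2) x] r by simp
    have cancel: "inv\<^bsub>R r\<^esub> (y r) \<otimes>\<^bsub>R r\<^esub> (y r \<otimes>\<^bsub>R r\<^esub> z) = z" if "z \<in> carrier (R r)" for z
      using that xy by (simp add: m_assoc[symmetric])
    have "(?c \<otimes>\<^bsub>R r\<^esub> (y r \<otimes>\<^bsub>R r\<^esub> y r)) \<otimes>\<^bsub>R r\<^esub> x r = y r \<otimes>\<^bsub>R r\<^esub> x r \<otimes>\<^bsub>R r\<^esub> (y r \<otimes>\<^bsub>R r\<^esub> x r)"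
      using xy cancel by (simp add: m_assoc)
    then have "?c \<otimes>\<^bsub>R r\<^esub> (y r \<otimes>\<^bsub>R r\<^esub> y r) = inv\<^bsub>R r\<^esub> (x r)"
      using rel xy by (metis inv_closed inv_equality m_closed)
    then have "y r \<otimes>\<^bsub>R r\<^esub> y r = inv\<^bsub>R r\<^esub> ?c \<otimes>\<^bsub>R r\<^esub> inv\<^bsub>R r\<^esub> (x r)"
      using xy by (metis inv_closed inv_solve_left m_closed)
    then show ?thesis using c x by simp
  qed
  then have "(y r \<otimes>\<^bsub>R r\<^esub> y r) [^]\<^bsub>R r\<^esub> m \<in> slice r" for m :: nat
    by (rule slice_pow[OF r])
  moreover have "y r \<otimes>\<^bsub>R r\<^esub> y r = y r [^]\<^bsub>R r\<^esub> (2 :: nat)"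
    using xy by (simp add: numeral_2_eq_2)
  ultimately have sq: "y r [^]\<^bsub>R r\<^esub> (2 * m) \<in> slice r" for m :: nat
    using xy by (simp add: nat_pow_pow)
  obtain m where "ord (y r) = 2 * m + 1" using odd by (elim oddE)
  then have "y r = y r [^]\<^bsub>R r\<^esub> (2 * (m + 1))"
    using xy pow_ord_eq_1[of "y r"] by (simp add: nat_pow_mult[symmetric] algebra_simps)
  then show "y r \<in> slice r" using sq by metis
qed

text \<open>Divide a diagonal element by its part in the other factors.\<close>

lemma full_last:
  assumes r: "r \<in> I" and others: "\<And>s. s \<in> I \<Longrightarrow> s \<noteq> r \<Longrightarrow> full s"
  shows "full r"
proof -
  have "x r \<in> slice r" if x: "diag x \<in> K" "\<And>s. s \<in> I \<Longrightarrow> x s \<in> carrier (R s)" for x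
  proof -
    define y where "y = diag (\<lambda>s. if s = r then \<one>\<^bsub>R s\<^esub> else x s)"
    have y: "y \<in> carrier D"
      unfolding y_def by (rule diag_in) (use x(2) monoid.one_closed[OF monoid_R] in auto)
    have y_at: "y s = (if s = r then \<one>\<^bsub>R s\<^esub> else x s)" if "s \<in> I" for s
      using that by (simp add: y_def)
    have "y \<in> K"
      by (rule supported_on_full_in_K[OF y]) (use others y_at in \<open>auto split: if_splits\<close>)
    then have K: "diag x \<otimes>\<^bsub>D\<^esub> inv\<^bsub>D\<^esub> y \<in> K"
      using x K_mult K_inv by blast
    have "single r (x r) = diag x \<otimes>\<^bsub>D\<^esub> inv\<^bsub>D\<^esub> y"
    proof (rule D_eqI)
      show "diag x \<otimes>\<^bsub>D\<^esub> inv\<^bsub>D\<^esub> y \<in> carrier D" using K K_sub by auto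
      show "single r (x r) s = (diag x \<otimes>\<^bsub>D\<^esub> inv\<^bsub>D\<^esub> y) s" if s: "s \<in> I" for s
        using x(2)[OF s] group_R[OF s] monoid_R[OF s]
        by (cases "s = r") (auto simp: mult_at inv_at y single_at y_at s r group.r_inv
          monoid.inv_one monoid.r_one)
    qed (use r x single_in in blast)
    then show ?thesis using K x(2)[OF r] by (simp add: slice_def)
  qed
  then show ?thesis
    using full_if_uv_in_slice[OF r] diag_uv_K uv_in by blast
qed

text \<open>Each type occurs at most once, so \<open>u\<close> has order 4 only in the factor of type \<open>(4, 3)\<close> and order 5 only in
  that of type \<open>(5, 3)\<close>. As 15 is a multiple of 3 and 5, and 12 of 3 and 4, the powers \<open>u\<^sup>1\<^sup>5\<close> and \<open>u\<^sup>1\<^sup>2\<close>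
  isolate these two factors. The same powers of \<open>v\<close> isolate \<open>(3, 4)\<close> and \<open>(3, 5)\<close>, and the tetrahedral factor
  \<open>(3, 3)\<close> is what is left at the end.\<close>

lemma all_full:
  assumes types: "\<And>r. r \<in> I \<Longrightarrow> (group.ord (R r) (u r), group.ord (R r) (v r)) \<in>
      {(3, 3), (3, 4), (3, 5), (4, 3), (5, 3)}"
    and inj: "inj_on (\<lambda>r. (group.ord (R r) (u r), group.ord (R r) (v r))) I"
    and r: "r \<in> I"
  shows "full r"
proof -
  define p where "p s = group.ord (R s) (u s)" for s
  define q where "q s = group.ord (R s) (v s)" for s
  have ty: "(p s, q s) \<in> {(3, 3), (3, 4), (3, 5), (4, 3), (5, 3)}" if "s \<in> I" for s
    using types[OF that] by (simp add: p_def q_def)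
  have ne: "(p s, q s) \<noteq> (p r, q r)" if "s \<in> I" "r \<in> I" "s \<noteq> r" for r s
    using inj that by (auto simp: inj_on_def p_def q_def)
  have pow_u: "u s [^]\<^bsub>R s\<^esub> k = \<one>\<^bsub>R s\<^esub>" if "s \<in> I" "p s dvd k" for s k
    using group.pow_eq_id[OF group_R[OF that(1)]] uv_in[OF that(1)] that(2) by (simp add: p_def)
  have pow_v: "v s [^]\<^bsub>R s\<^esub> k = \<one>\<^bsub>R s\<^esub>" if "s \<in> I" "q s dvd k" for s k
    using group.pow_eq_id[OF group_R[OF that(1)]] uv_in[OF that(1)] that(2) by (simp add: q_def)
  have rel: "u r \<otimes>\<^bsub>R r\<^esub> v r \<otimes>\<^bsub>R r\<^esub> (u r \<otimes>\<^bsub>R r\<^esub> v r) = \<one>\<^bsub>R r\<^esub>"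
    "v r \<otimes>\<^bsub>R r\<^esub> u r \<otimes>\<^bsub>R r\<^esub> (v r \<otimes>\<^bsub>R r\<^esub> u r) = \<one>\<^bsub>R r\<^esub>" if r: "r \<in> I" for r
  proof -
    interpret group "R r" by (rule group_R[OF r])
    show *: "u r \<otimes>\<^bsub>R r\<^esub> v r \<otimes>\<^bsub>R r\<^esub> (u r \<otimes>\<^bsub>R r\<^esub> v r) = \<one>\<^bsub>R r\<^esub>"
      by (rule rotation_pair.invol[OF pair[OF r]])
    have "v r \<otimes>\<^bsub>R r\<^esub> (u r \<otimes>\<^bsub>R r\<^esub> v r) = inv\<^bsub>R r\<^esub> (u r)"
      by (rule rotation_pair.bab[OF pair[OF r]])
    then show "v r \<otimes>\<^bsub>R r\<^esub> u r \<otimes>\<^bsub>R r\<^esub> (v r \<otimes>\<^bsub>R r\<^esub> u r) = \<one>\<^bsub>R r\<^esub>"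
      using uv_in[OF r] by (simp add: m_assoc[symmetric])
  qed
  have full_ne: "full r" if r: "r \<in> I" and nt: "(p r, q r) \<noteq> (3, 3)" for r
  proof -
    have by_u: "full r" if "\<And>s. s \<in> I \<Longrightarrow> s \<noteq> r \<Longrightarrow> p s dvd k" "coprime k (p r)" "odd (q r)" for k
      using isolated_generator[OF r diag_uv_K uv_in[OF r] rel(2)[OF r], of k] that pow_u
        full_if_uv_in_slice[OF r] by (auto simp: p_def q_def)
    have by_v: "full r" if "\<And>s. s \<in> I \<Longrightarrow> s \<noteq> r \<Longrightarrow> q s dvd k" "coprime k (q r)" "odd (p r)" for k
      using isolated_generator[OF r diag_uv_K(2,1) uv_in(2)[OF r] uv_in(1)[OF r] rel(1)[OF r], of k] that pow_v
        full_if_uv_in_slice[OF r] by (auto simp: p_def q_def)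
    have cop: "coprime (15 :: nat) 4" "coprime (12 :: nat) 5"
      by (simp_all add: coprime_iff_gcd_eq_1 gcd_non_0_nat)
    consider "(p r, q r) = (3, 4)" | "(p r, q r) = (3, 5)" | "(p r, q r) = (4, 3)" | "(p r, q r) = (5, 3)"
      using ty[OF r] nt by auto
    then show ?thesis
    proof cases
      case 1 then show ?thesis using by_v[of 15] cop ne[OF _ r] ty by force
    next
      case 2 then show ?thesis using by_v[of 12] cop ne[OF _ r] ty by force
    next
      case 3 then show ?thesis using by_u[of 15] cop ne[OF _ r] ty by force
    next
      case 4 then show ?thesis using by_u[of 12] cop ne[OF _ r] ty by force
    qed
  qed
  show ?thesis
  proof (cases "(p r, q r) = (3, 3)")
    case True
    then show ?thesis
      using full_last[OF r] full_ne ne[OF _ r] by metis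
  qed (rule full_ne[OF r])
qed

lemma generate_at:
  assumes "x \<in> generate D {diag w}" "r \<in> I" "\<And>s. s \<in> I \<Longrightarrow> w s \<in> carrier (R s)"
  shows "x r \<in> generate (R r) {w r}"
  using assms(1)
proof (induction rule: generate.induct)
  case one then show ?case using assms(2) by (simp add: one_at generate.one)
next
  case (incl h) then show ?case using assms(2) by (simp add: generate.incl)
next
  case (inv h)
  then show ?case
    using assms(2) inv_at[OF assms(2) diag_in[of w]] assms(3) by (simp add: generate.inv)
next
  case (eng h h') then show ?case using assms(2) by (simp add: mult_at generate.eng)
qed

lemma rotation_pair_D:
  assumes full: "\<And>r. r \<in> I \<Longrightarrow> full r"
  shows "rotation_pair D (diag u) (diag v) (\<lambda>x. \<lambda>r\<in>I. \<alpha> r (x r))"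
proof -
  obtain r0 where r0: "r0 \<in> I" using I_ne by blast
  note mD = group.is_monoid[OF group_D]
  show ?thesis
  proof (intro rotation_pair.intro rotation_pair_axioms.intro group_D diag_uv_in)
    show "finite (carrier D)"
      unfolding D_simps by (intro finite_PiE fin_I rotation_pair.fin[OF pair])
    show "generate D {diag u, diag v} = carrier D"
      using K_full[OF full] by (simp add: K_def)
    show "diag u \<otimes>\<^bsub>D\<^esub> diag v \<otimes>\<^bsub>D\<^esub> (diag u \<otimes>\<^bsub>D\<^esub> diag v) = \<one>\<^bsub>D\<^esub>"
      using rotation_pair.invol[OF pair] by (auto simp: D_simps)
    show "diag u \<noteq> \<one>\<^bsub>D\<^esub>" "diag v \<noteq> \<one>\<^bsub>D\<^esub>"
      using rotation_pair.a_ne[OF pair[OF r0]] rotation_pair.b_ne[OF pair[OF r0]] r0 one_at diag_at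
      by metis+
    have "x = \<one>\<^bsub>D\<^esub>" if x: "x \<in> generate D {diag u}" "x \<in> generate D {diag v}" for x
    proof (rule D_eqI)
      show "x \<in> carrier D"
        using group.generate_in_carrier[OF group_D _ x(1)] diag_uv_in by simp
      show "\<one>\<^bsub>D\<^esub> \<in> carrier D" using mD by (rule monoid.one_closed)
      show "x r = \<one>\<^bsub>D\<^esub> r" if r: "r \<in> I" for r
        using generate_at[OF x(1) r] generate_at[OF x(2) r] uv_in rotation_pair.inter[OF pair[OF r]] r
        by (auto simp: one_at)
    qed
    then show "generate D {diag u} \<inter> generate D {diag v} = {\<one>\<^bsub>D\<^esub>}"
      by (auto intro: generate.one)
    show "(\<lambda>x. \<lambda>r\<in>I. \<alpha> r (x r)) \<in> hom D D"
    proof (rule homI)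
      show "(\<lambda>r\<in>I. \<alpha> r (x r)) \<in> carrier D" if "x \<in> carrier D" for x
        using that rotation_pair.\<alpha>_in[OF pair] by (auto simp: D_simps)
      show "(\<lambda>r\<in>I. \<alpha> r ((x \<otimes>\<^bsub>D\<^esub> y) r)) = (\<lambda>r\<in>I. \<alpha> r (x r)) \<otimes>\<^bsub>D\<^esub> (\<lambda>r\<in>I. \<alpha> r (y r))"
        if "x \<in> carrier D" "y \<in> carrier D" for x y
        using D_at[OF _ that(1)] D_at[OF _ that(2)] rotation_pair.\<alpha>_mult[OF pair]
        by (auto simp: D_simps)
    qed
    show "(\<lambda>r\<in>I. \<alpha> r (diag u r)) = diag u \<otimes>\<^bsub>D\<^esub> diag v \<otimes>\<^bsub>D\<^esub> diag v"
      using rotation_pair.\<alpha>_a[OF pair] by (auto simp: D_simps)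
    show "(\<lambda>r\<in>I. \<alpha> r (diag v r)) = inv\<^bsub>D\<^esub> (diag v)"
    proof -
      have iv: "inv\<^bsub>D\<^esub> (diag v) = (\<lambda>r\<in>I. inv\<^bsub>R r\<^esub> (diag v r))"
        unfolding D_def using diag_uv_in(2) by (intro inv_product_group group_R) (auto simp: D_simps)
      show ?thesis
        unfolding iv using rotation_pair.\<alpha>_b[OF pair] by auto
    qed
  qed
qed

lemma ord_diag:
  assumes "\<And>r. r \<in> I \<Longrightarrow> w r \<in> carrier (R r)"
  shows "group.ord D (diag w) = (LCM r\<in>I. group.ord (R r) (w r))"
proof -
  have wD: "diag w \<in> carrier D" using diag_in assms .
  have "diag w [^]\<^bsub>D\<^esub> k = \<one>\<^bsub>D\<^esub> \<longleftrightarrow> (\<forall>r\<in>I. w r [^]\<^bsub>R r\<^esub> k = \<one>\<^bsub>R r\<^esub>)" for k :: nat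
  proof -
    have "diag w [^]\<^bsub>D\<^esub> k = \<one>\<^bsub>D\<^esub> \<longleftrightarrow> (\<forall>r\<in>I. (diag w [^]\<^bsub>D\<^esub> k) r = \<one>\<^bsub>D\<^esub> r)"
      using D_eqI[of "diag w [^]\<^bsub>D\<^esub> k" "\<one>\<^bsub>D\<^esub>"] wD group.is_monoid[OF group_D]
      by (metis monoid.nat_pow_closed monoid.one_closed)
    then show ?thesis by (simp add: pow_at one_at)
  qed
  also have "\<dots> k \<longleftrightarrow> (LCM r\<in>I. group.ord (R r) (w r)) dvd k" for k :: nat
    using group.pow_eq_id[OF group_R] assms by (simp add: Lcm_dvd_iff)
  finally show ?thesis
    using group.ord_unique[OF group_D wD] by blast
qed

lemma card_D: "card (carrier D) = (\<Prod>r\<in>I. card (carrier (R r)))"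
  unfolding D_simps by (rule card_PiE[OF fin_I])

end

section \<open>Mixes\<close>

text \<open>What the mix needs to know about a polyhedron with a base flag: \<open>p\<close> and \<open>q\<close> are the entries of the
  Schlaefli symbol, \<open>N\<close> is the order of the rotation group.\<close>

definition rotary :: "('a, 'b) ranked_poset_scheme \<Rightarrow> 'a set \<Rightarrow> nat \<Rightarrow> nat \<Rightarrow> nat \<Rightarrow> bool" where
  "rotary P \<Phi> p q N \<longleftrightarrow>
     (\<exists>\<alpha>. rotation_pair (rotation_group 3 P \<Phi>) (sigma P \<Phi> 1) (sigma P \<Phi> 2) \<alpha>) \<and>
     group.ord (rotation_group 3 P \<Phi>) (sigma P \<Phi> 1) = p \<and>
     group.ord (rotation_group 3 P \<Phi>) (sigma P \<Phi> 2) = q \<and>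
     card (carrier (rotation_group 3 P \<Phi>)) = N"

theorem has_parameters_mix:
  assumes ne: "Ps \<noteq> []"
    and rot: "\<And>r. r < length Ps \<Longrightarrow> rotary (fst (Ps ! r)) (snd (Ps ! r)) (p r) (q r) (N r)"
    and types: "\<And>r. r < length Ps \<Longrightarrow> (p r, q r) \<in> {(3, 3), (3, 4), (3, 5), (4, 3), (5, 3)}"
    and inj: "inj_on (\<lambda>r. (p r, q r)) {..<length Ps}"
    and M: "M = (\<Prod>r<length Ps. N r)"
  shows "has_parameters (mix 3 Ps)
     (M div (LCM r\<in>{..<length Ps}. q r), M div 2, M div (LCM r\<in>{..<length Ps}. p r), 2 * M)"
proof -
  define I where "I = {..<length Ps}"
  define R where "R r = rotation_group 3 (fst (Ps ! r)) (snd (Ps ! r))" for r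
  define u where "u r = sigma (fst (Ps ! r)) (snd (Ps ! r)) 1" for r
  define v where "v r = sigma (fst (Ps ! r)) (snd (Ps ! r)) 2" for r
  have "\<forall>r\<in>I. \<exists>\<alpha>. rotation_pair (R r) (u r) (v r) \<alpha>"
    using rot by (auto simp: rotary_def I_def R_def u_def v_def)
  then obtain \<alpha> where \<alpha>: "\<forall>r\<in>I. rotation_pair (R r) (u r) (v r) (\<alpha> r)"
    by metis
  have ords: "group.ord (R r) (u r) = p r" "group.ord (R r) (v r) = q r" "card (carrier (R r)) = N r"
    if "r \<in> I" for r
    using rot that by (auto simp: rotary_def I_def R_def u_def v_def)
  interpret fam: rotation_family I R u v \<alpha>
    by (rule rotation_family.intro) (use ne \<alpha> in \<open>auto simp: I_def\<close>)
  have full: "fam.full r" if "r \<in> I" for r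
  proof (rule fam.all_full[OF _ _ that])
    show "(group.ord (R r) (u r), group.ord (R r) (v r)) \<in> {(3, 3), (3, 4), (3, 5), (4, 3), (5, 3)}"
      if "r \<in> I" for r
      using types[of r] ords[OF that] that by (simp add: I_def)
    show "inj_on (\<lambda>r. (group.ord (R r) (u r), group.ord (R r) (v r))) I"
      using inj ords by (simp add: inj_on_def I_def)
  qed
  interpret rp: rotation_pair fam.D "fam.diag u" "fam.diag v" "\<lambda>x. \<lambda>r\<in>I. \<alpha> r (x r)"
    by (rule fam.rotation_pair_D[OF full])
  have \<beta>: "mix_beta Ps 1 = fam.diag u" "mix_beta Ps 2 = fam.diag v"
    by (simp_all add: mix_beta_def fam.diag_def u_def v_def flip: I_def)
  have group: "mix_group 3 Ps = fam.D"
  proof -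
    have "{1..3 - 1} = {1, 2 :: nat}" by auto
    then have "mix_group 3 Ps = subgroup_generated fam.D {fam.diag u, fam.diag v}"
      unfolding mix_group_def fam.D_def by (simp add: \<beta>[unfolded One_nat_def] I_def R_def[abs_def])
    also have "\<dots> = fam.D"
      using rp.gen rp.a_in rp.b_in by (simp add: subgroup_generated_def)
    finally show ?thesis .
  qed
  have sub: "mix_subgroup 3 Ps ({0..<3} - {j}) = rp.H j" if "j < 3" for j
  proof -
    have b: "mix_beta_prod 3 Ps 1 1 = fam.diag u" "mix_beta_prod 3 Ps 2 2 = fam.diag v"
      "mix_beta_prod 3 Ps 1 2 = fam.diag u \<otimes>\<^bsub>fam.D\<^esub> fam.diag v"
      by (simp_all add: mix_beta_prod_def group \<beta>[unfolded One_nat_def] upt_rec[of 1] upt_rec[of 2] upt_rec[of 3]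
        numeral_2_eq_2 \<beta>[unfolded numeral_2_eq_2])
    have "{mix_beta_prod 3 Ps i k | i k. 1 \<le> i \<and> i \<le> k \<and> k \<le> 3 - 1 \<and>
        i - 1 \<in> {0..<3} - {j} \<and> k \<in> {0..<3} - {j}} = {rp.h j}"
    proof -
      have "(1 \<le> i \<and> i \<le> k \<and> k \<le> 3 - 1 \<and> i - 1 \<in> {0..<3} - {j} \<and> k \<in> {0..<3} - {j}) \<longleftrightarrow>
        (i, k) = (if j = 0 then (2, 2) else if j = 1 then (1, 2) else (1, 1))" for i k :: nat
        using that by auto
      then have "{mix_beta_prod 3 Ps i k | i k. 1 \<le> i \<and> i \<le> k \<and> k \<le> 3 - 1 \<and>
          i - 1 \<in> {0..<3} - {j} \<and> k \<in> {0..<3} - {j}} =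
        {mix_beta_prod 3 Ps i k | i k. (i, k) = (if j = 0 then (2, 2) else if j = 1 then (1, 2) else (1, 1))}"
        by blast
      also have "\<dots> = {rp.h j}"
        using b by (auto simp: rp.h_def)
      finally show ?thesis .
    qed
    then show ?thesis
      unfolding mix_subgroup_def group rp.H_def by simp
  qed
  have "mix 3 Ps = coset_geometry fam.D rp.H"
    unfolding mix_def coset_geometry_def group using sub by (auto intro!: arg_cong2[where f = "(\<union>)"])
  moreover have "group.ord fam.D (fam.diag u) = (LCM r\<in>I. p r)"
    using fam.ord_diag[OF fam.uv_in(1)] ords by (simp cong: image_cong_simp)
  moreover have "group.ord fam.D (fam.diag v) = (LCM r\<in>I. q r)"
    using fam.ord_diag[OF fam.uv_in(2)] ords by (simp cong: image_cong_simp)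
  moreover have "card (carrier fam.D) = M"
    unfolding fam.card_D M using ords by (simp add: I_def)
  ultimately show ?thesis
    using rp.has_parameters_coset_geometry[of M] by (simp add: I_def)
qed

section \<open>Polytopes of finite reflection groups\<close>

definition reflect :: "'a::real_inner \<Rightarrow> 'a \<Rightarrow> 'a" where
  "reflect a x = x - (2 * (a \<bullet> x) / (a \<bullet> a)) *\<^sub>R a"

lemma reflect_inner:
  "reflect a x \<bullet> y = x \<bullet> y - 2 * (a \<bullet> x) / (a \<bullet> a) * (a \<bullet> y)"
  by (simp add: reflect_def inner_diff_left)

lemma reflect_reflect [simp]: "reflect a (reflect a x) = x"
proof (cases "a = 0")
  case False
  then have "a \<bullet> reflect a x = - (a \<bullet> x)"
    by (simp add: reflect_def inner_diff_right)
  then show ?thesis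
    by (simp add: reflect_def)
qed (simp add: reflect_def)

lemma reflect_adjoint: "reflect a x \<bullet> y = x \<bullet> reflect a y"
  by (simp add: reflect_def inner_diff_left inner_diff_right inner_commute)

lemma orthogonal_reflect: "orthogonal_transformation (reflect a)"
proof -
  have "linear (reflect a)"
    by (rule linearI) (simp_all add: reflect_def inner_add_right algebra_simps add_divide_distrib)
  moreover have "reflect a x \<bullet> reflect a y = x \<bullet> y" for x y
    by (metis reflect_adjoint reflect_reflect)
  ultimately show ?thesis by (simp add: orthogonal_transformation_def)
qed

lemma reflect_fix_iff: "a \<noteq> 0 \<Longrightarrow> reflect a x = x \<longleftrightarrow> a \<bullet> x = 0"
  by (simp add: reflect_def)

lemma reflect_comp: "reflect a \<circ> reflect a = id"
  by (simp add: fun_eq_iff)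

lemma det_reflect:
  fixes a :: "real^3"
  assumes "a \<noteq> 0"
  shows "det (matrix (reflect a)) = - 1"
proof -
  define c where "c = 2 / (a \<bullet> a)"
  have c: "c * (a$1 * a$1 + a$2 * a$2 + a$3 * a$3) = 2"
  proof -
    have "a$1 * a$1 + a$2 * a$2 + a$3 * a$3 = a \<bullet> a" by (simp add: inner_vec_def sum_3)
    then show ?thesis using assms by (simp add: c_def)
  qed
  have m: "matrix (reflect a) $ i $ j = (if i = j then 1 else 0) - c * a$j * a$i" for i j
    by (cases "i = j") (simp_all add: matrix_def reflect_def c_def inner_axis axis_def[of j "1 :: real"])
  show ?thesis
    unfolding det_3 m using c by (simp add: algebra_simps)
qed

lemma finite_maximizer:
  fixes f :: "'a \<Rightarrow> real"
  assumes "finite X" "X \<noteq> {}"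
  obtains g where "g \<in> X" "\<And>h. h \<in> X \<Longrightarrow> f h \<le> f g"
proof -
  have "Max (f ` X) \<in> f ` X" using assms by simp
  then obtain g where "g \<in> X" "f g = Max (f ` X)" by auto
  then show ?thesis using that[of g] assms by simp
qed

text \<open>A finite vertex set \<open>V\<close> invariant under the reflections in three simple roots \<open>al i\<close>; the \<open>w i\<close> are the dual
  basis, that is, the generators of the fundamental chamber. The assumptions say that the \<open>w i\<close> attain
  their maximum over \<open>V\<close> at \<open>v0\<close>, that the face exposed by \<open>w 0\<close> is \<open>v0\<close> itself and the one exposed by \<open>w 1\<close>
  is the edge from \<open>v0\<close> to its mirror image, that \<open>V\<close> lies on a sphere, that \<open>p\<close> and \<open>q\<close> are the lengths of the
  cycles of \<open>v0\<close> about the base face and of its neighbour about \<open>v0\<close>, and that the latter cycle consists of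
  all neighbours of \<open>v0\<close>. They are finitely many identities and inequalities between explicit
  vectors, and everything else about the polytope follows from them.\<close>

locale reflection_polytope =
  fixes V :: "(real^3) set" and al w :: "nat \<Rightarrow> real^3" and v0 :: "real^3" and p q :: nat
  assumes finV: "finite V"
    and dual: "\<And>i j. i < 3 \<Longrightarrow> j < 3 \<Longrightarrow> al i \<bullet> w j = (if i = j then 1 else 0)"
    and expand: "\<And>x. x = (x \<bullet> al 0) *\<^sub>R w 0 + (x \<bullet> al 1) *\<^sub>R w 1 + (x \<bullet> al 2) *\<^sub>R w 2"
    and ortho: "al 0 \<bullet> al 2 = 0"
    and closed: "\<And>i x. i < 3 \<Longrightarrow> x \<in> V \<Longrightarrow> reflect (al i) x \<in> V"
    and v0V: "v0 \<in> V"
    and maximal: "\<And>i x. i < 3 \<Longrightarrow> x \<in> V \<Longrightarrow> w i \<bullet> x \<le> w i \<bullet> v0"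
    and w_pos: "\<And>i. i < 3 \<Longrightarrow> w i \<bullet> v0 > 0"
    and vertex: "\<And>x. x \<in> V \<Longrightarrow> w 0 \<bullet> x = w 0 \<bullet> v0 \<Longrightarrow> x = v0"
    and edge: "\<And>x. x \<in> V \<Longrightarrow> w 1 \<bullet> x = w 1 \<bullet> v0 \<Longrightarrow> x = v0 \<or> x = reflect (al 0) v0"
    and sphere: "\<And>x. x \<in> V \<Longrightarrow> x \<bullet> x = v0 \<bullet> v0"
    and p: "p > 1" and q: "q > 1"
    and p_cycle: "((reflect (al 0) \<circ> reflect (al 1)) ^^ p) v0 = v0"
      "\<And>k. 0 < k \<Longrightarrow> k < p \<Longrightarrow> ((reflect (al 0) \<circ> reflect (al 1)) ^^ k) v0 \<noteq> v0"
    and q_cycle: "((reflect (al 1) \<circ> reflect (al 2)) ^^ q) (reflect (al 0) v0) = reflect (al 0) v0"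
      "\<And>k. 0 < k \<Longrightarrow> k < q \<Longrightarrow>
        ((reflect (al 1) \<circ> reflect (al 2)) ^^ k) (reflect (al 0) v0) \<noteq> reflect (al 0) v0"
    and neighbours: "\<And>x. x \<in> V \<Longrightarrow> v0 \<bullet> x = v0 \<bullet> reflect (al 0) v0 \<Longrightarrow>
        \<exists>k<q. x = ((reflect (al 1) \<circ> reflect (al 2)) ^^ k) (reflect (al 0) v0)"
begin

abbreviation "s i \<equiv> reflect (al i)"

text \<open>\<open>B 0\<close>, \<open>B 1\<close>, \<open>B 2\<close> are the base vertex, edge and 2-face, exposed by the dual basis vectors.\<close>

definition "K = convex hull V"

definition B :: "nat \<Rightarrow> (real^3) set" where
  "B j = K \<inter> {x. w j \<bullet> x = w j \<bullet> v0}"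

primrec word :: "nat list \<Rightarrow> real^3 \<Rightarrow> real^3" where
  "word [] = id"
| "word (i # is) = word is \<circ> s i"

definition "W = word ` {is. set is \<subseteq> {..<3}}"

lemma W_id: "id \<in> W"
  unfolding W_def by (rule image_eqI[of _ _ "[]"]) simp_all

lemma W_step: "g \<in> W \<Longrightarrow> i < 3 \<Longrightarrow> g \<circ> s i \<in> W"
proof -
  assume "g \<in> W" "i < 3"
  then obtain "is" where "set is \<subseteq> {..<3}" "g = word is" by (auto simp: W_def)
  then show ?thesis
    unfolding W_def using \<open>i < 3\<close> by (intro image_eqI[of _ _ "i # is"]) simp_all
qed

lemma W_induct [consumes 1, case_names id step]:
  assumes "g \<in> W" "Q id" "\<And>g i. g \<in> W \<Longrightarrow> Q g \<Longrightarrow> i < 3 \<Longrightarrow> Q (g \<circ> s i)"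
  shows "Q g"
proof -
  obtain "is" where "set is \<subseteq> {..<3}" "g = word is" using assms(1) by (auto simp: W_def)
  moreover have "set is \<subseteq> {..<3} \<longrightarrow> word is \<in> W \<and> Q (word is)" for "is"
  proof (induct "is")
    case Nil
    show ?case unfolding word.simps using assms(2) W_id by blast
  next
    case (Cons i "is")
    have "word (i # is) \<in> W \<and> Q (word (i # is))" if "set (i # is) \<subseteq> {..<3}"
    proof -
      have *: "word is \<in> W" "Q (word is)" "i < 3" using Cons that by auto
      show ?thesis
        unfolding word.simps(2) by (rule conjI[OF W_step[OF *(1,3)] assms(3)[OF *]])
    qed
    then show ?case by blast
  qed
  ultimately show ?thesis by blast
qed

lemma all_lt3: "(\<forall>i<3. Q i) \<longleftrightarrow> Q 0 \<and> Q 1 \<and> Q (2::nat)"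
  by (auto simp: numeral_3_eq_3 less_Suc_eq numeral_2_eq_2)

subsection \<open>The reflection group\<close>

lemma al_ne: "i < 3 \<Longrightarrow> al i \<noteq> 0"
  using dual[of i i] by auto

lemma s_w: "i < 3 \<Longrightarrow> j < 3 \<Longrightarrow> i \<noteq> j \<Longrightarrow> s i (w j) = w j"
  and s_w_ne: "i < 3 \<Longrightarrow> s i (w i) \<noteq> w i"
  using reflect_fix_iff[OF al_ne] dual by auto

lemma s_comm: "s 0 \<circ> s 2 = s 2 \<circ> s 0"
proof -
  have "s 0 (s 2 x) = s 2 (s 0 x)" for x
    using ortho by (simp add: reflect_def inner_diff_right inner_commute algebra_simps)
  then show ?thesis by (simp add: fun_eq_iff)
qed

lemma s_W: "i < 3 \<Longrightarrow> s i \<in> W"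
  using W_step[OF W_id] by simp

lemma W_comp: assumes "g \<in> W" "h \<in> W" shows "g \<circ> h \<in> W"
  using assms(2)
proof (induction rule: W_induct)
  case id
  show ?case using assms(1) by simp
next
  case (step h i)
  show ?case using W_step[OF step(3) step(2)] unfolding comp_assoc .
qed

lemma W_inv: assumes "g \<in> W" obtains h where "h \<in> W" "g \<circ> h = id" "h \<circ> g = id"
proof -
  have "\<exists>h\<in>W. g \<circ> h = id \<and> h \<circ> g = id"
    using assms
  proof (induction rule: W_induct)
    case id show ?case using W_id by (intro bexI[of _ id]) simp_all
  next
    case (step g i)
    then obtain h where h: "h \<in> W" "g \<circ> h = id" "h \<circ> g = id" by blast
    have "g (h x) = x" "h (g x) = x" for x
      using h(2,3) by (auto simp: fun_eq_iff)
    then have "g \<circ> s i \<circ> (s i \<circ> h) = id \<and> s i \<circ> h \<circ> (g \<circ> s i) = id"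
      by (simp add: fun_eq_iff)
    then show ?case
      using W_comp[OF s_W[OF step(2)] h(1)] by blast
  qed
  then show ?thesis using that by blast
qed

lemma W_orth: "g \<in> W \<Longrightarrow> orthogonal_transformation g"
proof (induction rule: W_induct)
  case id
  show ?case unfolding id_def by (rule orthogonal_transformation_id)
next
  case (step g i)
  show ?case by (rule orthogonal_transformation_compose[OF step(3) orthogonal_reflect])
qed

lemma W_linear: "g \<in> W \<Longrightarrow> linear g"
  and W_inner: "g \<in> W \<Longrightarrow> g x \<bullet> g y = x \<bullet> y"
  and W_inj: "g \<in> W \<Longrightarrow> inj g"
proof -
  assume "g \<in> W"
  note g = W_orth[OF this]
  show "linear g" "inj g" "g x \<bullet> g y = x \<bullet> y"
    using g orthogonal_transformation_inj[OF g] by (auto simp: orthogonal_transformation_def)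
qed

lemma W_V_sub: "g \<in> W \<Longrightarrow> x \<in> V \<Longrightarrow> g x \<in> V"
  by (induction arbitrary: x rule: W_induct) (auto intro: closed)

lemma W_V: assumes "g \<in> W" shows "g ` V = V"
  by (rule endo_inj_surj[OF finV]) (use W_V_sub[OF assms] inj_on_subset[OF W_inj[OF assms]] in auto)

lemma W_K: "g \<in> W \<Longrightarrow> g ` K = K"
  unfolding K_def by (simp add: convex_hull_linear_image W_linear W_V)

lemma W_section:
  assumes g: "g \<in> W"
  shows "g ` (K \<inter> {x. c \<bullet> x = b}) = K \<inter> {x. g c \<bullet> x = b}"
proof -
  have "x \<in> g ` (K \<inter> {x. c \<bullet> x = b}) \<longleftrightarrow> x \<in> g ` K \<and> g c \<bullet> x = b" for x
    using W_inner[OF g] by auto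
  then show ?thesis unfolding W_K[OF g] by blast
qed

lemma convex_K: "convex K"
  by (simp add: K_def)

lemma V_K: "V \<subseteq> K"
  by (simp add: K_def hull_subset)

lemma K_le: assumes "\<And>x. x \<in> V \<Longrightarrow> c \<bullet> x \<le> b" "x \<in> K" shows "c \<bullet> x \<le> b"
proof -
  have "K \<subseteq> {x. c \<bullet> x \<le> b}"
    unfolding K_def by (rule hull_minimal) (use assms convex_halfspace_le in auto)
  then show ?thesis using assms(2) by blast
qed

lemma maximal_K: "i < 3 \<Longrightarrow> x \<in> K \<Longrightarrow> w i \<bullet> x \<le> w i \<bullet> v0"
  by (rule K_le) (rule maximal)

lemma v0_B: "v0 \<in> B j"
  using v0V V_K by (auto simp: B_def)

lemma face_B: "i < 3 \<Longrightarrow> B i face_of K"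
  unfolding B_def by (rule face_of_Int_supporting_hyperplane_le[OF convex_K]) (rule maximal_K)

lemma face_hull: assumes "F face_of K" shows "F = convex hull (F \<inter> V)"
proof -
  obtain S where S: "S \<subseteq> V" "F = convex hull S"
    using face_of_convex_hull_subset[of V F] assms finV unfolding K_def by (metis finite_imp_compact)
  have "convex hull S \<subseteq> convex hull (F \<inter> V)"
    by (rule hull_mono) (use S hull_subset[of S convex] in auto)
  moreover have "convex hull (F \<inter> V) \<subseteq> F"
    by (rule hull_minimal) (use face_of_imp_convex[OF assms] in auto)
  ultimately show ?thesis using S by blast
qed

lemma B0: "B 0 = {v0}"
proof -
  have "B 0 \<inter> V = {v0}"
    using vertex v0V v0_B[of 0] by (auto simp: B_def)
  then show ?thesis using face_hull[OF face_B[of 0]] by simp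
qed

abbreviation "v1 \<equiv> s 0 v0"

lemma v1V: "v1 \<in> V"
  using closed[of 0] v0V by simp

lemma v1_B: "j = 1 \<or> j = 2 \<Longrightarrow> v1 \<in> B j"
proof -
  assume j: "j = 1 \<or> j = 2"
  then have "w j \<bullet> v1 = s 0 (w j) \<bullet> v0" by (simp add: reflect_adjoint)
  also have "s 0 (w j) = w j" using s_w[of 0 j] j by auto
  finally show ?thesis using v1V V_K by (auto simp: B_def)
qed

lemma B1: "B 1 = convex hull {v0, v1}"
proof -
  have "B 1 \<inter> V = {v0, v1}"
    using edge v0V v1V v0_B[of 1] v1_B[of 1] by (auto simp: B_def)
  then show ?thesis using face_hull[OF face_B[of 1]] by simp
qed

lemma B_nested: "B 0 \<subseteq> B 1" "B 1 \<subseteq> B 2"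
proof -
  show "B 0 \<subseteq> B 1" using B0 v0_B by simp
  show "B 1 \<subseteq> B 2"
    unfolding B1 by (rule hull_minimal)
      (use v0_B[of 2] v1_B[of 2] face_of_imp_convex[OF face_B[of 2]] in auto)
qed

lemma s_B: "i < 3 \<Longrightarrow> j < 3 \<Longrightarrow> i \<noteq> j \<Longrightarrow> s i ` B j = B j"
  unfolding B_def by (simp add: W_section s_W s_w)

text \<open>The sum of the vertices of \<open>B j\<close> is fixed by the reflections other than \<open>s j\<close>, so it is a multiple
  of \<open>w j\<close>. Hence a group element preserving the face \<open>B j\<close> fixes \<open>w j\<close>.\<close>

lemma stabilizer_fixes_w:
  assumes g: "g \<in> W" and j: "j < 3" and gB: "g ` B j = B j"
  shows "g (w j) = w j"
proof -
  define S where "S = (\<Sum>x\<in>V \<inter> B j. x)"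
  have inv_sum: "h S = S" if h: "h \<in> W" "h ` B j = B j" for h
  proof -
    have "h ` (V \<inter> B j) = V \<inter> B j"
      using W_V[OF h(1)] h(2) image_Int[OF W_inj[OF h(1)], of V "B j"] by simp
    then have "(\<Sum>x\<in>V \<inter> B j. h x) = S"
      using sum.reindex[of h "V \<inter> B j" "\<lambda>x. x"] inj_on_subset[OF W_inj[OF h(1)]]
      by (simp add: S_def)
    then show ?thesis
      using linear_sum[OF W_linear[OF h(1)], of "\<lambda>x. x" "V \<inter> B j"] by (simp add: S_def)
  qed
  have "S \<bullet> al i = 0" if "i < 3" "i \<noteq> j" for i
  proof -
    have "s i S = S" using inv_sum[OF s_W] s_B that j by simp
    then show ?thesis using reflect_fix_iff[OF al_ne[OF that(1)]] by (simp add: inner_commute)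
  qed
  then have S: "S = (S \<bullet> al j) *\<^sub>R w j"
    using expand[of S] less_3_cases[OF j] by auto
  have "w j \<bullet> S = (\<Sum>x\<in>V \<inter> B j. w j \<bullet> x)" by (simp add: S_def inner_sum_right)
  also have "\<dots> = (\<Sum>x\<in>V \<inter> B j. w j \<bullet> v0)" by (rule sum.cong) (auto simp: B_def)
  also have "\<dots> > 0"
  proof -
    have "card (V \<inter> B j) > 0"
      using v0V v0_B finV by (auto simp: card_gt_0_iff)
    then show ?thesis using w_pos[OF j] by simp
  qed
  finally have "S \<noteq> 0" by auto
  then have c: "S \<bullet> al j \<noteq> 0" using S by auto
  have "(S \<bullet> al j) *\<^sub>R g (w j) = g S"
    using S linear_scale[OF W_linear[OF g]] by metis
  also have "\<dots> = (S \<bullet> al j) *\<^sub>R w j" using inv_sum[OF g gB] S by simp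
  finally show ?thesis using c by simp
qed

text \<open>An orthogonal map fixing two of the three vectors \<open>w j\<close> fixes the plane orthogonal to the third
  root pointwise, so it is the identity or the reflection in that plane.\<close>

lemma fixes_plane:
  assumes g: "g \<in> W" and i: "i < 3" and fixed: "\<And>j. j < 3 \<Longrightarrow> j \<noteq> i \<Longrightarrow> g (w j) = w j"
  shows "g = id \<or> g = s i"
proof -
  have perp: "g (al i) \<bullet> w j = 0" if "j < 3" "j \<noteq> i" for j
    using W_inner[OF g, of "al i" "w j"] fixed[OF that] dual[OF i that(1)] that(2) by simp
  have gx: "g x = x" if x: "x \<bullet> al i = 0" for x
  proof -
    have e: "g x = (x \<bullet> al 0) *\<^sub>R g (w 0) + (x \<bullet> al 1) *\<^sub>R g (w 1) + (x \<bullet> al 2) *\<^sub>R g (w 2)"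
      by (subst expand[of x]) (simp only: linear_add[OF W_linear[OF g]] linear_scale[OF W_linear[OF g]])
    also have "\<dots> = (x \<bullet> al 0) *\<^sub>R w 0 + (x \<bullet> al 1) *\<^sub>R w 1 + (x \<bullet> al 2) *\<^sub>R w 2"
      using fixed less_3_cases[OF i] x by auto
    finally show ?thesis using expand[of x] by simp
  qed
  let ?n = "al i \<bullet> al i"
  have n: "?n \<noteq> 0" using al_ne[OF i] by simp
  define c where "c = (g (al i) \<bullet> al i) / ?n"
  define r where "r = g (al i) - c *\<^sub>R al i"
  have r_al: "r \<bullet> al i = 0" using n by (simp add: r_def c_def inner_diff_left)
  have "r \<bullet> r = r \<bullet> g (al i)" using r_al by (simp add: r_def inner_diff_right)
  also have "\<dots> = g r \<bullet> g (al i)" using gx[OF r_al] by simp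
  also have "\<dots> = 0" using W_inner[OF g] r_al by simp
  finally have ga: "g (al i) = c *\<^sub>R al i" by (simp add: r_def)
  have "c * c * ?n = ?n" using W_inner[OF g, of "al i" "al i"] by (simp add: ga)
  then have "c * c = 1" using n by simp
  then have "c = 1 \<or> c = -1" by (simp add: square_eq_1_iff)
  moreover have "g x = x + ((c - 1) * (al i \<bullet> x) / ?n) *\<^sub>R al i" for x
  proof -
    define y where "y = x - ((al i \<bullet> x) / ?n) *\<^sub>R al i"
    have "y \<bullet> al i = 0" using n by (simp add: y_def inner_diff_left inner_commute[of "al i" x])
    then have "g y = y" by (rule gx)
    moreover have "x = y + ((al i \<bullet> x) / ?n) *\<^sub>R al i" by (simp add: y_def)
    then have "g x = g y + ((al i \<bullet> x) / ?n) *\<^sub>R g (al i)"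
      using linear_add[OF W_linear[OF g]] linear_scale[OF W_linear[OF g]] by metis
    ultimately show ?thesis
      by (simp add: ga y_def algebra_simps diff_divide_distrib)
  qed
  ultimately show ?thesis
    by (auto simp: fun_eq_iff reflect_def)
qed

lemma fixes_basis:
  assumes g: "g \<in> W" and fixed: "\<And>j. j < 3 \<Longrightarrow> g (w j) = w j"
  shows "g = id"
  using fixes_plane[OF g, of 0] fixes_plane[OF g, of 1] fixed s_w_ne[of 0] by auto

text \<open>A group element fixing all vertices preserves the three base faces, hence is the identity; so \<open>W\<close> acts
  faithfully on the finite set \<open>V\<close>.\<close>

lemma finite_W: "finite W"
proof (rule finite_imageD[of "\<lambda>g. restrict g V"])
  have "(\<lambda>g. restrict g V) ` W \<subseteq> V \<rightarrow>\<^sub>E V"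
    using W_V_sub by auto
  then show "finite ((\<lambda>g. restrict g V) ` W)"
    by (rule finite_subset) (simp add: finV finite_PiE)
  show "inj_on (\<lambda>g. restrict g V) W"
  proof (rule inj_onI)
    fix g h assume gh: "g \<in> W" "h \<in> W" "restrict g V = restrict h V"
    obtain h' where h': "h' \<in> W" "h \<circ> h' = id" "h' \<circ> h = id" by (rule W_inv[OF gh(2)])
    let ?k = "h' \<circ> g"
    have k: "?k \<in> W" by (rule W_comp[OF h'(1) gh(1)])
    have kV: "?k x = x" if "x \<in> V" for x
      using fun_cong[OF gh(3), of x] fun_cong[OF h'(3), of x] that by simp
    have "?k ` B j = B j" if "j < 3" for j
    proof -
      have "?k ` B j = ?k ` (convex hull (B j \<inter> V))" using face_hull[OF face_B[OF that]] by simp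
      also have "\<dots> = convex hull (?k ` (B j \<inter> V))"
        by (rule convex_hull_linear_image[OF W_linear[OF k]])
      also have "?k ` (B j \<inter> V) = B j \<inter> V" using kV by force
      finally show ?thesis using face_hull[OF face_B[OF that]] by simp
    qed
    then have "?k = id" using fixes_basis[OF k] stabilizer_fixes_w[OF k] by blast
    then have "h \<circ> (h' \<circ> g) = h" by simp
    then show "g = h" using h'(2) by (simp add: comp_assoc[symmetric])
  qed
qed

subsection \<open>Every chain of faces can be moved into the base flag\<close>

text \<open>Let \<open>\<delta>\<close> be an interior point of the chamber. If \<open>g\<close> maximizes \<open>g c \<bullet> \<delta>\<close> over the finite group \<open>W\<close>, then \<open>g c\<close> lies
  in the chamber, because otherwise a simple reflection would increase the value. Maximizing three
  inner products lexicographically controls three vectors at once: where the chamber inequality for the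
  first is an equality, it holds for the second, and so on.\<close>

lemma lex_chamber:
  obtains g where "g \<in> W"
    "\<And>i. i < 3 \<Longrightarrow> 0 \<le> g c2 \<bullet> al i"
    "\<And>i. i < 3 \<Longrightarrow> g c2 \<bullet> al i = 0 \<Longrightarrow> 0 \<le> g c1 \<bullet> al i"
    "\<And>i. i < 3 \<Longrightarrow> g c2 \<bullet> al i = 0 \<Longrightarrow> g c1 \<bullet> al i = 0 \<Longrightarrow> 0 \<le> g c0 \<bullet> al i"
proof -
  define \<delta> where "\<delta> = w 0 + w 1 + w 2"
  have \<delta>: "al i \<bullet> \<delta> = 1" if "i < 3" for i
    using dual[OF that] less_3_cases[OF that] by (auto simp: \<delta>_def inner_add_right)
  have step: "(s i \<circ> g) c \<bullet> \<delta> = g c \<bullet> \<delta> - 2 / (al i \<bullet> al i) * (g c \<bullet> al i)" if "i < 3" for i g c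
    using \<delta>[OF that] by (simp add: reflect_inner inner_commute[of "g c" "al i"])
  have pos: "2 / (al i \<bullet> al i) > 0" if "i < 3" for i
    using al_ne[OF that] by simp
  obtain g2 where g2: "g2 \<in> W" "\<And>h. h \<in> W \<Longrightarrow> h c2 \<bullet> \<delta> \<le> g2 c2 \<bullet> \<delta>"
    using finite_maximizer[OF finite_W, of "\<lambda>g. g c2 \<bullet> \<delta>"] W_id by blast
  define W2 where "W2 = {g \<in> W. g c2 \<bullet> \<delta> = g2 c2 \<bullet> \<delta>}"
  have W2: "finite W2" "W2 \<noteq> {}" using finite_W g2 by (auto simp: W2_def)
  obtain g1 where g1: "g1 \<in> W2" "\<And>h. h \<in> W2 \<Longrightarrow> h c1 \<bullet> \<delta> \<le> g1 c1 \<bullet> \<delta>"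
    using finite_maximizer[OF W2, of "\<lambda>g. g c1 \<bullet> \<delta>"] by blast
  define W1 where "W1 = {g \<in> W2. g c1 \<bullet> \<delta> = g1 c1 \<bullet> \<delta>}"
  have W1: "finite W1" "W1 \<noteq> {}" using W2 g1 by (auto simp: W1_def)
  obtain g where g: "g \<in> W1" "\<And>h. h \<in> W1 \<Longrightarrow> h c0 \<bullet> \<delta> \<le> g c0 \<bullet> \<delta>"
    using finite_maximizer[OF W1, of "\<lambda>g. g c0 \<bullet> \<delta>"] by blast
  have gW: "g \<in> W" "g \<in> W2" using g by (auto simp: W1_def W2_def)
  have sg: "s i \<circ> g \<in> W" if "i < 3" for i using W_comp[OF s_W[OF that] gW(1)] .
  have nonneg: "0 \<le> g c \<bullet> al i" if "i < 3" "(s i \<circ> g) c \<bullet> \<delta> \<le> g c \<bullet> \<delta>" for i c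
    using that(2) pos[OF that(1)] zero_le_mult_iff[of "2 / (al i \<bullet> al i)" "g c \<bullet> al i"]
    unfolding step[OF that(1)] by linarith
  have zero: "(s i \<circ> g) c \<bullet> \<delta> = g c \<bullet> \<delta>" if "i < 3" "g c \<bullet> al i = 0" for i c
    unfolding step[OF that(1)] using that(2) by simp
  have top2: "g c2 \<bullet> \<delta> = g2 c2 \<bullet> \<delta>" and top1: "g c1 \<bullet> \<delta> = g1 c1 \<bullet> \<delta>"
    using g gW by (auto simp: W1_def W2_def)
  have in2: "s i \<circ> g \<in> W2" if "i < 3" "g c2 \<bullet> al i = 0" for i
    using sg[OF that(1)] zero[OF that] top2 unfolding W2_def by simp
  have in1: "s i \<circ> g \<in> W1" if "i < 3" "g c2 \<bullet> al i = 0" "g c1 \<bullet> al i = 0" for i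
    using in2[OF that(1,2)] zero[OF that(1,3)] top1 unfolding W1_def by simp
  show ?thesis
  proof (rule that[OF gW(1)])
    fix i :: nat assume i: "i < 3"
    show "0 \<le> g c2 \<bullet> al i"
      by (rule nonneg[OF i]) (use g2(2)[OF sg[OF i]] top2 in simp)
    assume z2: "g c2 \<bullet> al i = 0"
    show "0 \<le> g c1 \<bullet> al i"
      by (rule nonneg[OF i]) (use g1(2)[OF in2[OF i z2]] top1 in simp)
    assume z1: "g c1 \<bullet> al i = 0"
    show "0 \<le> g c0 \<bullet> al i"
      by (rule nonneg[OF i]) (use g(2)[OF in1[OF i z2 z1]] in simp)
  qed
qed

text \<open>A linear functional \<open>c\<close> in the chamber is a nonnegative combination of the \<open>w i\<close>, all of which attain
  their maximum at \<open>v0\<close>. So \<open>c\<close> is maximal exactly on the intersection of the nested faces \<open>B i\<close> whose \<open>w i\<close>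
  occurs in \<open>c\<close>.\<close>

lemma chamber_face:
  assumes c: "\<And>i. i < 3 \<Longrightarrow> 0 \<le> c \<bullet> al i" and le: "\<And>x. x \<in> K \<Longrightarrow> c \<bullet> x \<le> b"
    and F: "F = K \<inter> {x. c \<bullet> x = b}" "F \<noteq> {}"
  shows "F \<in> {B 0, B 1, B 2, K}"
proof -
  have cx: "c \<bullet> x = (c \<bullet> al 0) * (w 0 \<bullet> x) + (c \<bullet> al 1) * (w 1 \<bullet> x) + (c \<bullet> al 2) * (w 2 \<bullet> x)" for x
    by (subst expand[of c]) (simp add: inner_add_left)
  have gap: "0 \<le> (c \<bullet> al i) * (w i \<bullet> v0 - w i \<bullet> x)" if "i < 3" "x \<in> K" for i x
    using c[OF that(1)] maximal_K[OF that] by simp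
  have diff: "c \<bullet> v0 - c \<bullet> x = (c \<bullet> al 0) * (w 0 \<bullet> v0 - w 0 \<bullet> x) + (c \<bullet> al 1) * (w 1 \<bullet> v0 - w 1 \<bullet> x)
      + (c \<bullet> al 2) * (w 2 \<bullet> v0 - w 2 \<bullet> x)" for x
    unfolding cx[of v0] cx[of x] by (simp add: algebra_simps)
  have sum0: "u + v + z = 0 \<longleftrightarrow> u = 0 \<and> v = 0 \<and> z = 0" if "0 \<le> u" "0 \<le> v" "0 \<le> z" for u v z :: real
    using that by (simp add: add_nonneg_eq_0_iff)
  have v0K: "v0 \<in> K" using v0V V_K by auto
  have b: "b = c \<bullet> v0"
  proof -
    obtain y where y: "y \<in> K" "c \<bullet> y = b" using F by auto
    have "c \<bullet> y \<le> c \<bullet> v0"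
      using diff[of y] gap[of 0 y] gap[of 1 y] gap[of 2 y] y(1) by simp
    then show ?thesis using y le[OF v0K] by simp
  qed
  have iff: "x \<in> F \<longleftrightarrow> x \<in> K \<and> (\<forall>i<3. c \<bullet> al i = 0 \<or> x \<in> B i)" for x
  proof (cases "x \<in> K")
    case True
    have "x \<in> F \<longleftrightarrow> c \<bullet> v0 - c \<bullet> x = 0"
      using True b F by auto
    also have "\<dots> \<longleftrightarrow> (\<forall>i<3. (c \<bullet> al i) * (w i \<bullet> v0 - w i \<bullet> x) = 0)"
      unfolding diff all_lt3 by (rule sum0) (rule gap[OF _ True]; simp)+
    also have "\<dots> \<longleftrightarrow> (\<forall>i<3. c \<bullet> al i = 0 \<or> x \<in> B i)"
      using True by (auto simp: B_def)
    finally show ?thesis using True by simp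
  qed (use F in auto)
  have sub: "B i \<subseteq> K" for i by (auto simp: B_def)
  consider "c \<bullet> al 0 \<noteq> 0" | "c \<bullet> al 0 = 0" "c \<bullet> al 1 \<noteq> 0" | "c \<bullet> al 0 = 0" "c \<bullet> al 1 = 0" "c \<bullet> al 2 \<noteq> 0"
    | "c \<bullet> al 0 = 0" "c \<bullet> al 1 = 0" "c \<bullet> al 2 = 0" by blast
  then show ?thesis
  proof cases
    case 1
    have "F = B 0"
      unfolding set_eq_iff iff all_lt3 using 1 B_nested sub[of 0] by blast
    then show ?thesis by simp
  next
    case 2
    have "F = B 1"
      unfolding set_eq_iff iff all_lt3 using 2 B_nested sub[of 1] by blast
    then show ?thesis by simp
  next
    case 3
    have "F = B 2"
      unfolding set_eq_iff iff all_lt3 using 3 B_nested sub[of 2] by blast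
    then show ?thesis by simp
  next
    case 4
    have "F = K"
      unfolding set_eq_iff iff all_lt3 using 4 by blast
    then show ?thesis by simp
  qed
qed

lemma polytope_K: "polytope K"
  unfolding K_def by (rule polytope_convex_hull[OF finV])

lemma face_exposed:
  assumes "F face_of K"
  obtains c b where "\<And>x. x \<in> K \<Longrightarrow> c \<bullet> x \<le> b" "F = K \<inter> {x. c \<bullet> x = b}"
proof -
  have "F exposed_face_of K"
    using assms exposed_face_of_polyhedron[OF polytope_imp_polyhedron[OF polytope_K]] by simp
  then show ?thesis
    using that unfolding exposed_face_of_def by blast
qed

lemma dominate:
  fixes a b :: "nat \<Rightarrow> real"
  assumes "\<And>i. i < 3 \<Longrightarrow> 0 \<le> a i"
  obtains M where "M > 0" "\<And>i. i < 3 \<Longrightarrow> a i > 0 \<Longrightarrow> b i + M * a i > 0"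
proof
  let ?M = "1 + (\<Sum>i<3. \<bar>b i\<bar> / a i)"
  show "?M > 0" by (smt (verit) assms divide_nonneg_nonneg abs_ge_zero lessThan_iff sum_nonneg)
  fix i :: nat assume i: "i < 3" "a i > 0"
  have "\<bar>b i\<bar> / a i \<le> (\<Sum>i<3. \<bar>b i\<bar> / a i)"
    by (rule member_le_sum) (use assms i in auto)
  then have "(\<bar>b i\<bar> / a i + 1) * a i \<le> ?M * a i"
    using i by (intro mult_right_mono) auto
  moreover have "(\<bar>b i\<bar> / a i + 1) * a i = \<bar>b i\<bar> + a i" using i by (simp add: field_simps)
  ultimately show "b i + ?M * a i > 0" using i by linarith
qed

text \<open>A face contained in a second face is also exposed by adding a positive multiple of the second functional. With
  a large multiple, the lexicographic chamber condition becomes the chamber condition.\<close>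

lemma section_combine:
  assumes "\<And>x. x \<in> K \<Longrightarrow> c \<bullet> x \<le> b" "\<And>x. x \<in> K \<Longrightarrow> c' \<bullet> x \<le> b'" "(M :: real) > 0"
    and "K \<inter> {x. c \<bullet> x = b} \<subseteq> K \<inter> {x. c' \<bullet> x = b'}"
  shows "K \<inter> {x. c \<bullet> x = b} = K \<inter> {x. (c + M *\<^sub>R c') \<bullet> x = b + M * b'}"
    "\<And>x. x \<in> K \<Longrightarrow> (c + M *\<^sub>R c') \<bullet> x \<le> b + M * b'"
proof -
  have le: "M * (c' \<bullet> x) \<le> M * b'" if "x \<in> K" for x
    using assms(2)[OF that] assms(3) by simp
  show "(c + M *\<^sub>R c') \<bullet> x \<le> b + M * b'" if "x \<in> K" for x
    using le[OF that] assms(1)[OF that] by (simp add: inner_add_left)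
  have "c \<bullet> x = b" if "x \<in> K" "(c + M *\<^sub>R c') \<bullet> x = b + M * b'" for x
    using that le[OF that(1)] assms(1)[OF that(1)] by (simp add: inner_add_left)
  then show "K \<inter> {x. c \<bullet> x = b} = K \<inter> {x. (c + M *\<^sub>R c') \<bullet> x = b + M * b'}"
    using assms(4) by (auto simp: inner_add_left)
qed

lemma nested_faces_to_base:
  assumes F: "F0 face_of K" "F1 face_of K" "F2 face_of K" "F0 \<noteq> {}" "F0 \<subseteq> F1" "F1 \<subseteq> F2"
  obtains g where "g \<in> W" "g ` F0 \<in> {B 0, B 1, B 2, K}" "g ` F1 \<in> {B 0, B 1, B 2, K}"
    "g ` F2 \<in> {B 0, B 1, B 2, K}"
proof -
  obtain c0 b0 where c0: "\<And>x. x \<in> K \<Longrightarrow> c0 \<bullet> x \<le> b0" "F0 = K \<inter> {x. c0 \<bullet> x = b0}"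
    using face_exposed[OF F(1)] by blast
  obtain c1 b1 where c1: "\<And>x. x \<in> K \<Longrightarrow> c1 \<bullet> x \<le> b1" "F1 = K \<inter> {x. c1 \<bullet> x = b1}"
    using face_exposed[OF F(2)] by blast
  obtain c2 b2 where c2: "\<And>x. x \<in> K \<Longrightarrow> c2 \<bullet> x \<le> b2" "F2 = K \<inter> {x. c2 \<bullet> x = b2}"
    using face_exposed[OF F(3)] by blast
  obtain g where g: "g \<in> W" "\<And>i. i < 3 \<Longrightarrow> 0 \<le> g c2 \<bullet> al i"
    "\<And>i. i < 3 \<Longrightarrow> g c2 \<bullet> al i = 0 \<Longrightarrow> 0 \<le> g c1 \<bullet> al i"
    "\<And>i. i < 3 \<Longrightarrow> g c2 \<bullet> al i = 0 \<Longrightarrow> g c1 \<bullet> al i = 0 \<Longrightarrow> 0 \<le> g c0 \<bullet> al i"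
    using lex_chamber[of c2 c1 c0] by blast
  note lin = linear_add[OF W_linear[OF g(1)]] linear_scale[OF W_linear[OF g(1)]]
  have base: "g ` F \<in> {B 0, B 1, B 2, K}"
    if chamber: "\<And>i. i < 3 \<Longrightarrow> 0 \<le> g c \<bullet> al i" and c: "\<And>x. x \<in> K \<Longrightarrow> c \<bullet> x \<le> b"
      and F': "F = K \<inter> {x. c \<bullet> x = b}" "F \<noteq> {}" for F c b
  proof (rule chamber_face[OF chamber])
    show "g ` F = K \<inter> {x. g c \<bullet> x = b}" unfolding F' by (rule W_section[OF g(1)])
    show "g ` F \<noteq> {}" using F' by simp
    fix x assume "x \<in> K"
    then obtain y where "y \<in> K" "x = g y" using W_K[OF g(1)] by blast
    then show "g c \<bullet> x \<le> b" using c W_inner[OF g(1)] by simp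
  qed
  have ne: "F1 \<noteq> {}" "F2 \<noteq> {}" using F by auto
  have base2: "g ` F2 \<in> {B 0, B 1, B 2, K}"
    by (rule base[OF g(2) c2 ne(2)])
  obtain M where M: "M > 0" "\<And>i. i < 3 \<Longrightarrow> g c2 \<bullet> al i > 0 \<Longrightarrow> g c1 \<bullet> al i + M * (g c2 \<bullet> al i) > 0"
    using dominate[of "\<lambda>i. g c2 \<bullet> al i" "\<lambda>i. g c1 \<bullet> al i"] g(2) by blast
  define d1 where "d1 = c1 + M *\<^sub>R c2"
  define e1 where "e1 = b1 + M * b2"
  have F1: "F1 = K \<inter> {x. d1 \<bullet> x = e1}" "\<And>x. x \<in> K \<Longrightarrow> d1 \<bullet> x \<le> e1"
    using section_combine[OF c1(1) c2(1) M(1)] c1(2) c2(2) F(6) unfolding d1_def e1_def by blast+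
  have gd1: "g d1 \<bullet> al i = g c1 \<bullet> al i + M * (g c2 \<bullet> al i)" for i
    by (simp add: d1_def lin inner_add_left)
  have ch1: "0 \<le> g d1 \<bullet> al i" if "i < 3" for i
    unfolding gd1 using g(2,3)[OF that] M(2)[OF that] by (cases "g c2 \<bullet> al i = 0") fastforce+
  have base1: "g ` F1 \<in> {B 0, B 1, B 2, K}"
    by (rule base[OF ch1 F1(2,1) ne(1)])
  obtain N where N: "N > 0" "\<And>i. i < 3 \<Longrightarrow> g d1 \<bullet> al i > 0 \<Longrightarrow> g c0 \<bullet> al i + N * (g d1 \<bullet> al i) > 0"
    using dominate[of "\<lambda>i. g d1 \<bullet> al i" "\<lambda>i. g c0 \<bullet> al i"] ch1 by blast
  define d0 where "d0 = c0 + N *\<^sub>R d1"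
  define e0 where "e0 = b0 + N * e1"
  have F0: "F0 = K \<inter> {x. d0 \<bullet> x = e0}" "\<And>x. x \<in> K \<Longrightarrow> d0 \<bullet> x \<le> e0"
    using section_combine[OF c0(1) F1(2) N(1)] c0(2) F1(1) F(5) unfolding d0_def e0_def by blast+
  have ch0: "0 \<le> g d0 \<bullet> al i" if i: "i < 3" for i
  proof -
    have gd0: "g d0 \<bullet> al i = g c0 \<bullet> al i + N * (g d1 \<bullet> al i)"
      by (simp add: d0_def lin inner_add_left)
    show ?thesis
    proof (cases "g d1 \<bullet> al i = 0")
      case True
      have "g c2 \<bullet> al i = 0"
      proof (rule ccontr)
        assume "g c2 \<bullet> al i \<noteq> 0"
        then have "g c2 \<bullet> al i > 0" using g(2)[OF i] by simp
        then show False using M(2)[OF i] True unfolding gd1 by simp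
      qed
      then have "g c1 \<bullet> al i = 0" using True unfolding gd1 by simp
      then show ?thesis using g(4)[OF i \<open>g c2 \<bullet> al i = 0\<close>] True unfolding gd0 by simp
    next
      case False
      then have "g d1 \<bullet> al i > 0" using ch1[OF i] by simp
      then show ?thesis using N(2)[OF i] unfolding gd0 by simp
    qed
  qed
  have base0: "g ` F0 \<in> {B 0, B 1, B 2, K}"
    by (rule base[OF ch0 F0(2,1) F(4)])
  show ?thesis using that[OF g(1) base0 base1 base2] .
qed

subsection \<open>The face lattice and its flags\<close>

abbreviation "P \<equiv> face_lattice K"

lemma P_simps: "faces P = {F. F face_of K}" "face_le P = (\<subseteq>)" "face_rank P = aff_dim"
  by (auto simp: face_lattice_def)

lemma base_distinct: "j < 3 \<Longrightarrow> B j \<noteq> K" "j < 3 \<Longrightarrow> k < 3 \<Longrightarrow> j \<noteq> k \<Longrightarrow> B j \<noteq> B k"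
proof -
  show "B j \<noteq> K" if j: "j < 3"
  proof
    assume "B j = K"
    then have "s j ` B j = B j" using W_K[OF s_W[OF j]] by simp
    then show False using stabilizer_fixes_w[OF s_W[OF j] j] s_w_ne[OF j] by simp
  qed
  show "B j \<noteq> B k" if j: "j < 3" and k: "k < 3" and jk: "j \<noteq> k"
  proof
    assume "B j = B k"
    then have "s j ` B j = B j" using s_B[OF j k jk] by simp
    then show False using stabilizer_fixes_w[OF s_W[OF j] j] s_w_ne[OF j] by simp
  qed
qed

lemma face_aff_dim_less:
  assumes "F face_of K" "F' face_of K" "F \<subseteq> F'" "F \<noteq> F'"
  shows "aff_dim F < aff_dim F'"
  using face_of_aff_dim_lt[OF face_of_imp_convex[OF assms(2)] face_of_subset[OF assms(1,3)]]
    face_of_imp_subset[OF assms(2)] assms(4) by blast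

lemma K_face: "K face_of K"
  by (rule face_of_refl[OF convex_K])

text \<open>The affine dimensions of \<open>B 0 \<subset> B 1 \<subset> B 2 \<subset> K\<close> increase strictly from 0 and are at most 3.\<close>

lemma base_aff_dim: "j < 3 \<Longrightarrow> aff_dim (B j) = int j" "aff_dim K = 3"
proof -
  have "aff_dim (B 0) = 0" by (simp add: B0)
  moreover have "aff_dim (B 0) < aff_dim (B 1)" "aff_dim (B 1) < aff_dim (B 2)" "aff_dim (B 2) < aff_dim K"
    using face_aff_dim_less[OF face_B[of 0] face_B[of 1]] face_aff_dim_less[OF face_B[of 1] face_B[of 2]]
      face_aff_dim_less[OF face_B[of 2] K_face] B_nested base_distinct(2)[of 0 1] base_distinct(2)[of 1 2]
      base_distinct(1)[of 2] face_of_imp_subset[OF face_B[of 2]] by auto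
  moreover have "aff_dim K \<le> 3" using aff_dim_le_DIM[of K] by simp
  ultimately have *: "aff_dim (B 0) = 0" "aff_dim (B 1) = 1" "aff_dim (B 2) = 2" "aff_dim K = 3"
    by linarith+
  show "aff_dim K = 3" by (rule *)
  show "aff_dim (B j) = int j" if "j < 3" using less_3_cases[OF that] * by (elim disjE) simp_all
qed

lemma W_aff_dim: "g \<in> W \<Longrightarrow> aff_dim (g ` F) = aff_dim F"
  by (rule aff_dim_injective_linear_image[OF W_linear W_inj])

lemma W_face: "g \<in> W \<Longrightarrow> g ` F face_of K \<longleftrightarrow> F face_of K"
  using face_of_linear_image[OF W_linear W_inj, of g F K] W_K by simp

definition base_flag :: "(real^3) set set" where
  "base_flag = {{}, B 0, B 1, B 2, K}"

lemma base_flag_cases: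
  assumes "X \<in> base_flag" obtains "X = {}" | "X = K" | j where "j < 3" "X = B j"
  using assms that(1,2) that(3)[of 0] that(3)[of 1] that(3)[of 2] unfolding base_flag_def by auto

lemma base_flag_chain: "face_chain P base_flag"
proof -
  have "base_flag \<subseteq> faces P"
    using face_B[of 0] face_B[of 1] face_B[of 2] K_face by (auto simp: base_flag_def P_simps)
  moreover have "B j \<subseteq> K" for j by (auto simp: B_def)
  ultimately show ?thesis
    using B_nested unfolding chain_faces_iff base_flag_def by (auto simp: P_simps(2))
qed

lemma card_base_flag: "card base_flag = 5"
proof -
  have ne: "B j \<noteq> {}" "K \<noteq> {}" for j using v0_B v0V V_K by auto
  show ?thesis
    unfolding base_flag_def
    using ne(2) ne(1)[of 0] ne(1)[of 1] ne(1)[of 2] base_distinct(1)[of 0] base_distinct(1)[of 1] base_distinct(1)[of 2]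
      base_distinct(2)[of 0 1] base_distinct(2)[of 0 2] base_distinct(2)[of 1 2]
    by auto
qed

definition A :: "(real^3 \<Rightarrow> real^3) \<Rightarrow> (real^3) set \<Rightarrow> (real^3) set" where
  "A g = (\<lambda>F\<in>faces P. g ` F)"

lemma A_apply: "F \<in> faces P \<Longrightarrow> A g F = g ` F"
  by (simp add: A_def)

lemma A_automorphism: assumes g: "g \<in> W" shows "A g \<in> automorphisms P"
proof (rule automorphismsI)
  obtain h where h: "h \<in> W" "g \<circ> h = id" "h \<circ> g = id" by (rule W_inv[OF g])
  have inv: "g (h x) = x" "h (g x) = x" for x using h(2,3) by (auto simp: fun_eq_iff)
  have "bij_betw (image g) (faces P) (faces P)"
    by (rule bij_betw_byWitness[where f' = "image h"])
      (use W_face[OF g] W_face[OF h(1)] inv in \<open>auto simp: P_simps image_image\<close>)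
  then show "bij_betw (A g) (faces P) (faces P)"
    unfolding A_def by (simp cong: bij_betw_cong)
qed (use W_aff_dim[OF g] W_inj[OF g] in \<open>auto simp: A_def P_simps inj_image_subset_iff\<close>)

definition wflag :: "(real^3 \<Rightarrow> real^3) \<Rightarrow> (real^3) set set" where
  "wflag g = (image g) ` base_flag"

text \<open>Faces of a chain have distinct dimensions; the whole polytope or the next larger face stands in for a
  missing one, so that three nested faces represent the chain.\<close>

lemma chain_in_wflag:
  assumes C: "face_chain P C"
  shows "\<exists>g\<in>W. C \<subseteq> wflag g"
proof -
  have face: "F face_of K" if "F \<in> C" for F
    using C that unfolding chain_faces_iff by (auto simp: P_simps)
  have comp: "F \<subseteq> F' \<or> F' \<subseteq> F" if "F \<in> C" "F' \<in> C" for F F'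
    using C that unfolding chain_faces_iff by (auto simp: P_simps)
  have mono: "F \<subseteq> F'" if "F \<in> C" "F' \<in> C" "aff_dim F \<le> aff_dim F'" for F F'
    using comp[OF that(1,2)] face_aff_dim_less[OF face[OF that(2)] face[OF that(1)]] that(3) by force
  have eq: "F = F'" if "F \<in> C" "F' \<in> C" "aff_dim F = aff_dim F'" for F F'
    using mono[of F F'] mono[of F' F] that by auto
  define pick where "pick d G = (if \<exists>F\<in>C. aff_dim F = d then THE F. F \<in> C \<and> aff_dim F = d else G)" for d G
  have pick_in: "pick d G = F" if "F \<in> C" "aff_dim F = d" for d G F
  proof -
    have "(THE F. F \<in> C \<and> aff_dim F = d) = F" by (rule the_equality) (use that eq in auto)
    then show ?thesis using that by (auto simp: pick_def)
  qed
  have pick_cases: "pick d G = G \<or> (pick d G \<in> C \<and> aff_dim (pick d G) = d)" for d G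
  proof (cases "\<exists>F\<in>C. aff_dim F = d")
    case True
    then show ?thesis using pick_in by auto
  qed (simp add: pick_def)
  define F2 where "F2 = pick 2 K"
  define F1 where "F1 = pick 1 F2"
  define F0 where "F0 = pick 0 F1"
  have F2: "F2 = K \<or> F2 \<in> C \<and> aff_dim F2 = 2" unfolding F2_def by (rule pick_cases)
  have F1: "F1 = F2 \<or> F1 \<in> C \<and> aff_dim F1 = 1" unfolding F1_def by (rule pick_cases)
  have F0: "F0 = F1 \<or> F0 \<in> C \<and> aff_dim F0 = 0" unfolding F0_def by (rule pick_cases)
  have faces: "F0 face_of K" "F1 face_of K" "F2 face_of K"
    using F0 F1 F2 face K_face by auto
  have sub: "F1 \<subseteq> F2" "F0 \<subseteq> F1"
  proof -
    have CK: "F \<subseteq> K" if "F \<in> C" for F using face_of_imp_subset[OF face[OF that]] .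
    show "F1 \<subseteq> F2"
      using F1 F2 CK mono[of F1 F2] by (elim disjE conjE) auto
    show "F0 \<subseteq> F1"
      using F0 F1 F2 CK mono[of F0 F1] by (elim disjE conjE) auto
  qed
  have "aff_dim F0 \<ge> 0" using F0 F1 F2 base_aff_dim(2) by auto
  then have ne: "F0 \<noteq> {}" by auto
  obtain g where g: "g \<in> W" "g ` F0 \<in> {B 0, B 1, B 2, K}" "g ` F1 \<in> {B 0, B 1, B 2, K}"
    "g ` F2 \<in> {B 0, B 1, B 2, K}"
    using nested_faces_to_base[OF faces ne sub(2,1)] by blast
  obtain h where h: "h \<in> W" "g \<circ> h = id" "h \<circ> g = id" by (rule W_inv[OF g(1)])
  have hg: "h (g x) = x" for x using h(3) by (auto simp: fun_eq_iff)
  have "F \<in> {{}, F0, F1, F2, K}" if F: "F \<in> C" for F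
  proof -
    have FK: "F \<subseteq> K" by (rule face_of_imp_subset[OF face[OF F]])
    have "aff_dim F \<le> 3" using aff_dim_subset[OF FK] base_aff_dim(2) by simp
    moreover have "aff_dim F \<ge> -1" by (rule aff_dim_geq)
    moreover have "F = K" if "aff_dim F = 3"
      using face_aff_dim_less[OF face[OF F] K_face FK] base_aff_dim(2) that by force
    moreover have "F = {}" if "aff_dim F = -1" using aff_dim_empty that by blast
    moreover have "aff_dim F = 0 \<Longrightarrow> F = F0" "aff_dim F = 1 \<Longrightarrow> F = F1" "aff_dim F = 2 \<Longrightarrow> F = F2"
      using pick_in[OF F] by (auto simp: F0_def F1_def F2_def)
    moreover have "aff_dim F = -1 \<or> aff_dim F = 0 \<or> aff_dim F = 1 \<or> aff_dim F = 2 \<or> aff_dim F = 3"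
      using calculation(1,2) by linarith
    ultimately show ?thesis by blast
  qed
  moreover have "g ` F \<in> base_flag" if "F \<in> {{}, F0, F1, F2, K}" for F
  proof -
    have sub: "{B 0, B 1, B 2, K} \<subseteq> base_flag" "{} \<in> base_flag" "K \<in> base_flag"
      by (auto simp: base_flag_def)
    note base = subsetD[OF sub(1) g(2)] subsetD[OF sub(1) g(3)] subsetD[OF sub(1) g(4)]
    show ?thesis
      using that base sub(2,3) W_K[OF g(1)] by (elim insertE emptyE) simp_all
  qed
  ultimately have gC: "g ` F \<in> base_flag" if "F \<in> C" for F
    using that by blast
  have "C \<subseteq> wflag h"
  proof
    fix F assume "F \<in> C"
    moreover have "F = h ` (g ` F)" using hg by (simp add: image_image)
    ultimately show "F \<in> wflag h" unfolding wflag_def using gC by (intro image_eqI[of _ _ "g ` F"])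
  qed
  then show ?thesis using h(1) by blast
qed

lemma wflag_A: "wflag g = A g ` base_flag"
proof -
  have "base_flag \<subseteq> faces P" using base_flag_chain unfolding chain_faces_iff by blast
  then show ?thesis
    unfolding wflag_def by (intro image_cong) (auto simp: A_apply)
qed

lemma flags_eq: "flags P = wflag ` W"
proof (rule flags_eqI)
  fix C assume "C \<in> wflag ` W"
  then obtain g where g: "g \<in> W" "C = wflag g" by blast
  show "face_chain P C"
    unfolding g(2) wflag_A by (rule automorphism_chain[OF A_automorphism[OF g(1)] base_flag_chain])
  have "inj_on (image g) base_flag"
    by (rule inj_onI) (use W_inj[OF g(1)] in \<open>simp add: inj_image_eq_iff\<close>)
  then have "card C = 5"
    unfolding g(2) wflag_def using card_base_flag by (simp only: card_image)
  then show "finite C \<and> card C = 5"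
    using card_ge_0_finite[of C] by simp
qed (use chain_in_wflag in blast)

subsection \<open>Automorphisms of the face lattice\<close>

lemma B_in_base: "j < 3 \<Longrightarrow> B j \<in> base_flag"
  unfolding base_flag_def by (drule less_3_cases) auto

lemma wflag_in_flags: "g \<in> W \<Longrightarrow> wflag g \<in> flags P"
  unfolding flags_eq by (rule imageI)

lemma wflag_sub: "g \<in> W \<Longrightarrow> wflag g \<subseteq> faces P"
  using wflag_in_flags[of g] unfolding flag_iff chain_faces_iff by blast

lemma base_flag_rank:
  assumes "X \<in> base_flag" "Y \<in> base_flag" "aff_dim X = aff_dim Y"
  shows "X = Y"
proof -
  have "aff_dim (B 0) = 0" "aff_dim (B 1) = 1" "aff_dim (B 2) = 2" "aff_dim K = 3"
    "aff_dim ({} :: (real^3) set) = -1"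
    using base_aff_dim(1)[of 0] base_aff_dim(1)[of 1] base_aff_dim(1)[of 2] base_aff_dim(2) by simp_all
  then show ?thesis
    using assms unfolding base_flag_def by (elim insertE emptyE) simp_all
qed

lemma wflag_rank_inj: "g \<in> W \<Longrightarrow> inj_on aff_dim (wflag g)"
  unfolding wflag_def by (rule inj_onI) (auto simp: W_aff_dim dest: base_flag_rank)

lemma wflag_off_rank:
  assumes "g \<in> W"
  shows "{F \<in> wflag g. aff_dim F \<noteq> d} = image g ` {X \<in> base_flag. aff_dim X \<noteq> d}"
  using W_aff_dim[OF assms] unfolding wflag_def by auto

text \<open>The diamond condition for all ranks at once: if the flags of \<open>g\<close> and \<open>h\<close> differ only in rank \<open>i\<close>, then
  \<open>inv g \<circ> h\<close> fixes the two other vectors \<open>w j\<close>, hence the plane that they span.\<close>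

lemma wflag_agree:
  assumes g: "g \<in> W" and h: "h \<in> W" and i: "i < 3"
    and eq: "{F \<in> wflag h. aff_dim F \<noteq> int i} = {F \<in> wflag g. aff_dim F \<noteq> int i}"
  shows "h = g \<or> h = g \<circ> s i"
proof -
  obtain g' where g': "g' \<in> W" "g \<circ> g' = id" "g' \<circ> g = id" by (rule W_inv[OF g])
  have gg': "g (g' x) = x" "g' (g x) = x" for x using g'(2,3) by (auto simp: fun_eq_iff)
  have k: "g' \<circ> h \<in> W" by (rule W_comp[OF g'(1) h])
  have "(g' \<circ> h) (w j) = w j" if j: "j < 3" "j \<noteq> i" for j
  proof (rule stabilizer_fixes_w[OF k j(1)])
    have "h ` B j \<in> {F \<in> wflag h. aff_dim F \<noteq> int i}"
      using B_in_base[OF j(1)] W_aff_dim[OF h] base_aff_dim(1)[OF j(1)] j(2) by (simp add: wflag_def)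
    then have "h ` B j \<in> wflag g" unfolding eq by simp
    then obtain X where X: "X \<in> base_flag" "h ` B j = g ` X" by (auto simp: wflag_def)
    then have "aff_dim X = aff_dim (B j)" using W_aff_dim[OF h, of "B j"] W_aff_dim[OF g, of X] by simp
    then have "X = B j" using base_flag_rank X(1) B_in_base[OF j(1)] by blast
    then have "h ` B j = g ` B j" using X(2) by simp
    then have "g' ` (h ` B j) = B j" using gg' by (simp add: image_image)
    then show "(g' \<circ> h) ` B j = B j" by (simp add: image_comp)
  qed
  then have "g' \<circ> h = id \<or> g' \<circ> h = s i" by (rule fixes_plane[OF k i])
  then show ?thesis
  proof
    assume "g' \<circ> h = id"
    then have "g' (h x) = x" for x by (simp add: fun_eq_iff)
    then have "h x = g x" for x using gg'(1)[of "h x"] by simp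
    then have "h = g" by (rule ext)
    then show ?thesis ..
  next
    assume "g' \<circ> h = s i"
    then have "g' (h x) = s i x" for x by (simp add: fun_eq_iff)
    then have "h x = g (s i x)" for x using gg'(1)[of "h x"] by simp
    then have "h = g \<circ> s i" by (simp add: fun_eq_iff)
    then show ?thesis ..
  qed
qed

lemma wflag_adjacent:
  assumes g: "g \<in> W" and i: "i < 3"
  shows "{F \<in> wflag (g \<circ> s i). aff_dim F \<noteq> int i} = {F \<in> wflag g. aff_dim F \<noteq> int i}"
    "wflag (g \<circ> s i) \<noteq> wflag g"
proof -
  have gs: "g \<circ> s i \<in> W" by (rule W_step[OF g i])
  have fixed: "s i ` X = X" if "X \<in> base_flag" "aff_dim X \<noteq> int i" for X
    using that(1)
  proof (rule base_flag_cases)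
    fix j assume j: "j < 3" "X = B j"
    then show ?thesis using s_B[OF i j(1)] base_aff_dim(1)[OF j(1)] that(2) by auto
  qed (use W_K[OF s_W[OF i]] in simp_all)
  show "{F \<in> wflag (g \<circ> s i). aff_dim F \<noteq> int i} = {F \<in> wflag g. aff_dim F \<noteq> int i}"
    unfolding wflag_off_rank[OF gs] wflag_off_rank[OF g]
  proof (rule image_cong[OF refl])
    fix X assume X: "X \<in> {X \<in> base_flag. aff_dim X \<noteq> int i}"
    have "(g \<circ> s i) ` X = g ` (s i ` X)" by (simp only: image_comp)
    then show "(g \<circ> s i) ` X = g ` X" using fixed X by simp
  qed
  show "wflag (g \<circ> s i) \<noteq> wflag g"
  proof
    assume eq: "wflag (g \<circ> s i) = wflag g"
    have "(g \<circ> s i) ` B i \<in> wflag (g \<circ> s i)" unfolding wflag_def using B_in_base[OF i] by (rule imageI)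
    moreover have "g ` B i \<in> wflag g" unfolding wflag_def using B_in_base[OF i] by (rule imageI)
    moreover have "aff_dim ((g \<circ> s i) ` B i) = aff_dim (g ` B i)"
      unfolding W_aff_dim[OF g] W_aff_dim[OF gs] ..
    ultimately have "(g \<circ> s i) ` B i = g ` B i"
      unfolding eq by (intro inj_onD[OF wflag_rank_inj[OF g]])
    then have "g ` (s i ` B i) = g ` B i" unfolding image_comp .
    then have "s i ` B i = B i" by (simp only: inj_image_eq_iff[OF W_inj[OF g]])
    then show False using stabilizer_fixes_w[OF s_W[OF i] i] s_w_ne[OF i] by simp
  qed
qed

lemma adjacent_flag_wflag:
  assumes g: "g \<in> W" and i: "i < 3"
  shows "adjacent_flag P (wflag g) i = wflag (g \<circ> s i)"
  unfolding adjacent_flag_def P_simps(3)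
proof (rule the_equality)
  show "wflag (g \<circ> s i) \<in> flags P \<and> wflag (g \<circ> s i) \<noteq> wflag g \<and>
    {F \<in> wflag (g \<circ> s i). aff_dim F \<noteq> int i} = {F \<in> wflag g. aff_dim F \<noteq> int i}"
    using wflag_adjacent[OF g i] wflag_in_flags[OF W_step[OF g i]] by blast
  fix \<Psi> assume \<Psi>: "\<Psi> \<in> flags P \<and> \<Psi> \<noteq> wflag g \<and>
    {F \<in> \<Psi>. aff_dim F \<noteq> int i} = {F \<in> wflag g. aff_dim F \<noteq> int i}"
  then obtain h where h: "h \<in> W" "\<Psi> = wflag h" unfolding flags_eq by blast
  then show "\<Psi> = wflag (g \<circ> s i)"
    using wflag_agree[OF g h(1) i] \<Psi> by blast
qed

text \<open>An automorphism fixing a flag pointwise fixes each adjacent flag, since there are only two flags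
  that agree off a given rank. The flags being connected by adjacency, it is the identity.\<close>

lemma wflag_rigid:
  assumes g: "g \<in> W" and f: "f \<in> automorphisms P" and fixed: "\<And>X. X \<in> wflag g \<Longrightarrow> f X = X"
    and F: "F \<in> faces P"
  shows "f F = F"
proof -
  have fix_all: "\<forall>X\<in>wflag (g \<circ> h). f X = X" if "h \<in> W" for h
    using that
  proof (induction rule: W_induct)
    case id
    show ?case using fixed by simp
  next
    case (step h i)
    let ?k = "g \<circ> h"
    have k: "?k \<in> W" by (rule W_comp[OF g step(1)])
    have i: "i < 3" by (rule step(2))
    have ks: "?k \<circ> s i \<in> W" by (rule W_step[OF k i])
    have IH: "f X = X" if "X \<in> wflag ?k" for X using step(3) that by blast
    let ?\<Psi> = "wflag (?k \<circ> s i)"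
    have sub: "?\<Psi> \<subseteq> faces P" by (rule wflag_sub[OF ks])
    have "f ` ?\<Psi> \<in> flags P" by (rule automorphism_flag[OF f wflag_in_flags[OF ks]])
    then obtain l where l: "l \<in> W" "f ` ?\<Psi> = wflag l" unfolding flags_eq by blast
    have rank: "aff_dim (f X) = aff_dim X" if "X \<in> faces P" for X
      using automorphismsD(4)[OF f that] by (simp add: P_simps)
    have off: "f X = X" if "X \<in> ?\<Psi>" "aff_dim X \<noteq> int i" for X
    proof (rule IH)
      have "X \<in> {F \<in> ?\<Psi>. aff_dim F \<noteq> int i}" using that by simp
      then show "X \<in> wflag ?k" unfolding wflag_adjacent(1)[OF k i] by simp
    qed
    have "{F \<in> wflag l. aff_dim F \<noteq> int i} = {F \<in> ?\<Psi>. aff_dim F \<noteq> int i}"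
      unfolding l(2)[symmetric]
    proof (intro equalityI subsetI)
      fix F assume "F \<in> {F \<in> f ` ?\<Psi>. aff_dim F \<noteq> int i}"
      then obtain X where X: "X \<in> ?\<Psi>" "F = f X" "aff_dim F \<noteq> int i" by blast
      then have "aff_dim X \<noteq> int i" using rank sub by auto
      then show "F \<in> {F \<in> ?\<Psi>. aff_dim F \<noteq> int i}" using off[OF X(1)] X by simp
    next
      fix F assume "F \<in> {F \<in> ?\<Psi>. aff_dim F \<noteq> int i}"
      then show "F \<in> {F \<in> f ` ?\<Psi>. aff_dim F \<noteq> int i}"
        using off[of F] by (auto intro: image_eqI[of _ f F])
    qed
    also have "\<dots> = {F \<in> wflag ?k. aff_dim F \<noteq> int i}" by (rule wflag_adjacent(1)[OF k i])
    finally have "l = ?k \<or> l = ?k \<circ> s i" by (rule wflag_agree[OF k l(1) i])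
    moreover have "l \<noteq> ?k"
    proof
      assume "l = ?k"
      then have "f ` ?\<Psi> = f ` wflag ?k" using l(2) IH by simp
      then have "?\<Psi> = wflag ?k"
        using automorphismsD(2)[OF f] inj_on_image_eq_iff[of f "faces P" ?\<Psi> "wflag ?k"] sub wflag_sub[OF k]
        by (simp add: bij_betw_def)
      then show False using wflag_adjacent(2)[OF k i] by blast
    qed
    ultimately have "f ` ?\<Psi> = ?\<Psi>" using l(2) by blast
    then have "f X = X" if "X \<in> ?\<Psi>" for X
    proof -
      have "f X \<in> ?\<Psi>" using \<open>f ` ?\<Psi> = ?\<Psi>\<close> that by blast
      moreover have "aff_dim (f X) = aff_dim X" using rank sub that by blast
      ultimately show ?thesis using wflag_rank_inj[OF ks] that by (auto dest: inj_onD)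
    qed
    then show ?case by (simp only: comp_assoc) blast
  qed
  obtain k where k: "k \<in> W" "{F} \<subseteq> wflag k"
    using chain_in_wflag[of "{F}"] F by (auto simp: chain_faces_iff)
  obtain g' where g': "g' \<in> W" "g \<circ> g' = id" by (rule W_inv[OF g])
  have "g \<circ> (g' \<circ> k) = k" using g'(2) by (simp add: comp_assoc[symmetric])
  then show ?thesis
    using fix_all[OF W_comp[OF g'(1) k(1)]] k(2) by simp
qed

lemma wflag_image: "g \<in> W \<Longrightarrow> h \<in> W \<Longrightarrow> A h ` wflag g = wflag (h \<circ> g)"
proof -
  assume g: "g \<in> W" and h: "h \<in> W"
  have "A h ` wflag g = image h ` wflag g"
    by (rule image_cong[OF refl]) (use wflag_sub[OF g] in \<open>auto simp: A_apply\<close>)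
  then show ?thesis
    by (simp add: wflag_def image_comp)
qed

lemma automorphism_eqI:
  assumes g: "g \<in> W" and f: "f \<in> automorphisms P" "f' \<in> automorphisms P" "f ` wflag g = f' ` wflag g"
  shows "f = f'"
proof (rule rigid_flag_imp_eq[OF f(1,2) wflag_sub[OF g] _ f(3)])
  show "inj_on (face_rank P) (wflag g)" using wflag_rank_inj[OF g] by (simp add: P_simps)
qed (rule wflag_rigid[OF g])

lemma rho_wflag:
  assumes g: "g \<in> W" and g': "g' \<in> W" "g \<circ> g' = id" "g' \<circ> g = id" and i: "i < 3"
  shows "rho P (wflag g) i = A (g \<circ> s i \<circ> g')"
  unfolding rho_def adjacent_flag_wflag[OF g i]
proof (rule the_equality)
  have k: "g \<circ> s i \<circ> g' \<in> W" by (rule W_comp[OF W_step[OF g i] g'(1)])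
  have "g \<circ> s i \<circ> g' \<circ> g = g \<circ> s i" using g'(3) by (simp add: comp_assoc)
  then show *: "A (g \<circ> s i \<circ> g') \<in> automorphisms P \<and> A (g \<circ> s i \<circ> g') ` wflag g = wflag (g \<circ> s i)"
    using A_automorphism[OF k] wflag_image[OF g k] by simp
  fix f assume "f \<in> automorphisms P \<and> f ` wflag g = wflag (g \<circ> s i)"
  then show "f = A (g \<circ> s i \<circ> g')"
    using automorphism_eqI[OF g] * by metis
qed

lemma A_mult:
  assumes "g \<in> W" "h \<in> W"
  shows "A g \<otimes>\<^bsub>aut_group P\<^esub> A h = A (g \<circ> h)"
proof -
  have "A g \<otimes>\<^bsub>aut_group P\<^esub> A h = compose (faces P) (A g) (A h)"
    by (rule aut_group_simps(3)[OF A_automorphism[OF assms(1)] A_automorphism[OF assms(2)]])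
  also have "\<dots> = A (g \<circ> h)"
  proof (rule ext)
    fix F show "compose (faces P) (A g) (A h) F = A (g \<circ> h) F"
    proof (cases "F \<in> faces P")
      case True
      then have "h ` F \<in> faces P" using W_face[OF assms(2)] by (simp add: P_simps)
      then show ?thesis using True by (simp add: compose_eq A_apply image_comp)
    qed (simp add: compose_def A_def)
  qed
  finally show ?thesis .
qed

lemma A_inj:
  assumes "g \<in> W" "h \<in> W" "A g = A h"
  shows "g = h"
proof -
  have "wflag g = wflag h" using assms(3) by (simp only: wflag_A)
  then have "h = g \<or> h = g \<circ> s 0" "h = g \<or> h = g \<circ> s 1"
    using wflag_agree[OF assms(1,2), of 0] wflag_agree[OF assms(1,2), of 1] by auto
  moreover have "g \<circ> s 0 \<noteq> h"
  proof
    assume "g \<circ> s 0 = h"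
    then have "wflag (g \<circ> s 0) = wflag g" using \<open>wflag g = wflag h\<close> by simp
    then show False using wflag_adjacent(2)[OF assms(1), of 0] by simp
  qed
  ultimately show ?thesis by blast
qed

subsection \<open>The rotation subgroup\<close>

abbreviation "a0 \<equiv> s 0 \<circ> s 1"
abbreviation "b0 \<equiv> s 1 \<circ> s 2"

text \<open>The determinant is the orientation character; it shows that the rotation group has index 2.\<close>

definition Wp :: "(real^3 \<Rightarrow> real^3) set" where
  "Wp = {g \<in> W. det (matrix g) = 1}"

lemma det_comp: "g \<in> W \<Longrightarrow> h \<in> W \<Longrightarrow> det (matrix (g \<circ> h)) = det (matrix g) * det (matrix h)"
  by (simp add: matrix_compose W_linear det_mul)

lemma det_s: "i < 3 \<Longrightarrow> det (matrix (s i)) = -1"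
  by (rule det_reflect[OF al_ne])

lemma det_id: "det (matrix (id :: real^3 \<Rightarrow> real^3)) = 1"
  by (simp add: matrix_id_mat_1)

lemma det_W: "g \<in> W \<Longrightarrow> det (matrix g) = 1 \<or> det (matrix g) = -1"
proof (induction rule: W_induct)
  case id
  show ?case by (rule disjI1[OF det_id])
next
  case (step g i)
  show ?case
    using step(3) unfolding det_comp[OF step(1) s_W[OF step(2)]] det_s[OF step(2)] by auto
qed

lemma Wp_W: "g \<in> Wp \<Longrightarrow> g \<in> W"
  by (simp add: Wp_def)

lemma Wp_id: "id \<in> Wp"
  by (simp add: Wp_def W_id det_id)

lemma Wp_comp: "g \<in> Wp \<Longrightarrow> h \<in> Wp \<Longrightarrow> g \<circ> h \<in> Wp"
  unfolding Wp_def using W_comp det_comp by simp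

lemma Wp_ss: "i < 3 \<Longrightarrow> j < 3 \<Longrightarrow> s i \<circ> s j \<in> Wp"
  unfolding Wp_def using W_comp[OF s_W s_W] det_comp[OF s_W s_W] det_s by simp

lemma Wp_a0: "a0 \<in> Wp" and Wp_b0: "b0 \<in> Wp"
  by (rule Wp_ss; simp)+

lemma Wp_inv: assumes "g \<in> Wp" obtains h where "h \<in> Wp" "g \<circ> h = id" "h \<circ> g = id"
proof -
  obtain h where h: "h \<in> W" "g \<circ> h = id" "h \<circ> g = id" by (rule W_inv[OF Wp_W[OF assms]])
  have "det (matrix g) * det (matrix h) = 1"
    using det_comp[OF Wp_W[OF assms] h(1)] unfolding h(2) det_id by simp
  then have "h \<in> Wp" using assms h(1) by (simp add: Wp_def)
  then show ?thesis using that h by blast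
qed

lemma Wp_conj: assumes "g \<in> Wp" "i < 3" shows "s i \<circ> g \<circ> s i \<in> Wp"
  using assms W_comp[OF W_comp[OF s_W[OF assms(2)] Wp_W[OF assms(1)]] s_W[OF assms(2)]]
    det_comp[OF W_comp[OF s_W[OF assms(2)] Wp_W[OF assms(1)]] s_W[OF assms(2)]]
    det_comp[OF s_W[OF assms(2)] Wp_W[OF assms(1)]] det_s[OF assms(2)]
  by (simp add: Wp_def)

lemma Wp_funpow: "g \<in> Wp \<Longrightarrow> g ^^ k \<in> Wp"
  by (induct k) (simp_all add: Wp_id Wp_comp)

lemma Wp_eq_id:
  assumes "g \<in> Wp" "i < 3" "\<And>j. j < 3 \<Longrightarrow> j \<noteq> i \<Longrightarrow> g (w j) = w j"
  shows "g = id"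
proof -
  have "g = id \<or> g = s i" by (rule fixes_plane[OF Wp_W[OF assms(1)] assms(2,3)])
  moreover have "g \<noteq> s i" using assms(1) det_s[OF assms(2)] by (auto simp: Wp_def)
  ultimately show ?thesis by blast
qed

lemma fixes_v0: "g \<in> W \<Longrightarrow> g v0 = v0 \<Longrightarrow> g (w 0) = w 0"
  using stabilizer_fixes_w[of g 0] B0 by simp

lemma fixes_v1: "g \<in> W \<Longrightarrow> g v0 = v0 \<Longrightarrow> g v1 = v1 \<Longrightarrow> g (w 1) = w 1"
  using stabilizer_fixes_w[of g 1] convex_hull_linear_image[OF W_linear, of g "{v0, v1}"]
  unfolding B1 by simp

lemma s_v0: "s 1 v0 = v0" "s 2 v0 = v0"
  using s_B[of 1 0] s_B[of 2 0] unfolding B0 by simp_all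

lemma rotation_eq_id:
  assumes g: "g \<in> Wp" and fixed: "g v0 = v0" "g v1 = v1"
  shows "g = id"
proof (rule Wp_eq_id[OF g])
  fix j :: nat assume "j < 3" "j \<noteq> 2"
  then have "j = 0 \<or> j = 1" by linarith
  then show "g (w j) = w j"
    using fixes_v0[OF Wp_W[OF g] fixed(1)] fixes_v1[OF Wp_W[OF g] fixed] by (elim disjE) simp_all
qed simp

lemma b0_v0: "(b0 ^^ k) v0 = v0"
  using s_v0 by (induct k) simp_all

lemma a0_w2: "(a0 ^^ k) (w 2) = w 2"
  using s_w[of 0 2] s_w[of 1 2] by (induct k) simp_all

lemma funpow_cycle_iff:
  assumes "(f ^^ n) x = x" "\<And>k. 0 < k \<Longrightarrow> k < n \<Longrightarrow> (f ^^ k) x \<noteq> x" "n > (1 :: nat)"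
  shows "(f ^^ k) x = x \<longleftrightarrow> n dvd k"
proof -
  have "(f ^^ (k mod n)) x = (f ^^ k) x" by (rule funpow_mod_eq[OF assms(1)])
  moreover have "k mod n < n" using assms(3) by simp
  ultimately show ?thesis
    using assms(2)[of "k mod n"] by (cases "k mod n = 0") (auto simp: dvd_eq_mod_eq_0)
qed

lemma funpow_id_if_dvd:
  assumes "f ^^ n = id" "n dvd k" shows "f ^^ k = id"
proof -
  obtain m where "k = n * m" using assms(2) by blast
  then have "f ^^ k = (f ^^ n) ^^ m" by (simp only: funpow_mult)
  also have "\<dots> = id" unfolding assms(1) by (induct m) simp_all
  finally show ?thesis .
qed

lemma a0_v0_iff: "(a0 ^^ k) v0 = v0 \<longleftrightarrow> p dvd k"
  by (rule funpow_cycle_iff[OF p_cycle p])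

lemma b0_v1_iff: "(b0 ^^ k) v1 = v1 \<longleftrightarrow> q dvd k"
  by (rule funpow_cycle_iff[OF q_cycle q])

lemma a0_id_iff: "a0 ^^ k = id \<longleftrightarrow> p dvd k"
proof
  assume "a0 ^^ k = id"
  then have "(a0 ^^ k) v0 = v0" by (simp only: id_apply)
  then show "p dvd k" by (simp only: a0_v0_iff)
next
  have m: "a0 ^^ p \<in> Wp" by (rule Wp_funpow[OF Wp_a0])
  have "a0 ^^ p = id"
  proof (rule Wp_eq_id[OF m, of 1])
    fix j :: nat assume "j < 3" "j \<noteq> 1"
    then have "j = 0 \<or> j = 2" by linarith
    then show "(a0 ^^ p) (w j) = w j"
      using fixes_v0[OF Wp_W[OF m] p_cycle(1)] a0_w2[of p] by (elim disjE) (simp_all only:)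
  qed simp
  then show "p dvd k \<Longrightarrow> a0 ^^ k = id" by (rule funpow_id_if_dvd)
qed

lemma b0_id_iff: "b0 ^^ k = id \<longleftrightarrow> q dvd k"
proof
  assume "b0 ^^ k = id"
  then have "(b0 ^^ k) v1 = v1" by (simp only: id_apply)
  then show "q dvd k" by (simp only: b0_v1_iff)
next
  have "b0 ^^ q = id"
    by (rule rotation_eq_id[OF Wp_funpow[OF Wp_b0] b0_v0 q_cycle(1)])
  then show "q dvd k \<Longrightarrow> b0 ^^ k = id" by (rule funpow_id_if_dvd)
qed

text \<open>Every point of \<open>V\<close> is a vertex because all of them have the same norm.\<close>

lemma W_transitive: assumes u: "u \<in> V" obtains g where "g \<in> W" "g v0 = u"
proof -
  have norm: "x \<bullet> x \<le> u \<bullet> u" if "x \<in> K" for x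
  proof -
    have "K \<subseteq> cball 0 (norm u)"
      unfolding K_def
    proof (rule hull_minimal)
      show "V \<subseteq> cball 0 (norm u)"
        using sphere sphere[OF u] by (auto simp: norm_eq_sqrt_inner)
    qed (rule convex_cball)
    then have "norm x \<le> norm u" using that by auto
    then show ?thesis by (simp add: norm_le)
  qed
  have dist: "(x - u) \<bullet> (x - u) \<le> 2 * (u \<bullet> u - u \<bullet> x)" if "x \<in> K" for x
    using norm[OF that] by (simp add: inner_diff_left inner_diff_right inner_commute)
  have le: "u \<bullet> x \<le> u \<bullet> u" if "x \<in> K" for x
    using order.trans[OF inner_ge_zero dist[OF that]] by simp
  have "x = u" if "x \<in> K" "u \<bullet> x = u \<bullet> u" for x
    using dist[OF that(1)] that(2) inner_ge_zero[of "x - u"] inner_eq_zero_iff[of "x - u"] by auto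
  then have "K \<inter> {x. u \<bullet> x = u \<bullet> u} = {u}" using u V_K by auto
  moreover have "K \<inter> {x. u \<bullet> x = u \<bullet> u} face_of K"
    by (rule face_of_Int_supporting_hyperplane_le[OF convex_K le])
  ultimately have "face_chain P {{u}}"
    unfolding chain_faces_iff by (simp add: P_simps)
  then obtain g where g: "g \<in> W" "{u} \<in> wflag g" using chain_in_wflag by blast
  then obtain X where X: "X \<in> base_flag" "{u} = g ` X" by (auto simp: wflag_def)
  then have "aff_dim X = aff_dim (B 0)" using W_aff_dim[OF g(1), of X] B0 by (metis aff_dim_sing)
  then have "X = {v0}" using base_flag_rank[OF X(1) B_in_base[of 0]] B0 by simp
  then show ?thesis using that[OF g(1)] X(2) by simp
qed

definition adj :: "real^3 \<Rightarrow> (real^3) set" where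
  "adj u = {x \<in> V. u \<bullet> x = v0 \<bullet> v1}"

lemma adj_v0: "adj v0 = (\<lambda>k. (b0 ^^ k) v1) ` {..<q}"
proof (intro equalityI subsetI)
  fix x assume "x \<in> adj v0"
  then show "x \<in> (\<lambda>k. (b0 ^^ k) v1) ` {..<q}"
    using neighbours[of x] unfolding adj_def by blast
next
  fix x assume "x \<in> (\<lambda>k. (b0 ^^ k) v1) ` {..<q}"
  then obtain k where x: "x = (b0 ^^ k) v1" by blast
  have m: "b0 ^^ k \<in> W" by (rule Wp_W[OF Wp_funpow[OF Wp_b0]])
  have "(b0 ^^ k) v0 \<bullet> (b0 ^^ k) v1 = v0 \<bullet> v1" by (rule W_inner[OF m])
  then show "x \<in> adj v0"
    using W_V_sub[OF m v1V] unfolding adj_def x b0_v0 by simp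
qed

lemma adj_image: assumes g: "g \<in> W" shows "adj (g u) = g ` adj u"
proof (intro equalityI subsetI)
  fix x assume x: "x \<in> adj (g u)"
  then have "x \<in> g ` V" using W_V[OF g] by (simp add: adj_def)
  then obtain y where "y \<in> V" "x = g y" by blast
  then show "x \<in> g ` adj u" using x W_inner[OF g] by (simp add: adj_def)
next
  fix x assume "x \<in> g ` adj u"
  then show "x \<in> adj (g u)" using W_inner[OF g] W_V_sub[OF g] by (auto simp: adj_def)
qed

lemma card_adj: assumes "u \<in> V" shows "card (adj u) = q"
proof -
  have "inj_on (\<lambda>k. (b0 ^^ k) v1) {..<q}"
  proof (rule linorder_inj_onI)
    fix k l :: nat assume kl: "k < l" "k \<in> {..<q}" "l \<in> {..<q}"
    show "(b0 ^^ k) v1 \<noteq> (b0 ^^ l) v1"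
    proof
      assume eq: "(b0 ^^ k) v1 = (b0 ^^ l) v1"
      have "b0 ^^ l = b0 ^^ k \<circ> b0 ^^ (l - k)" using kl(1) by (simp add: funpow_add[symmetric])
      then have "(b0 ^^ k) v1 = (b0 ^^ k) ((b0 ^^ (l - k)) v1)" using eq by (metis comp_apply)
      then have "v1 = (b0 ^^ (l - k)) v1"
        using injD[OF W_inj[OF Wp_W[OF Wp_funpow[OF Wp_b0]]]] by blast
      then have "q dvd l - k" using b0_v1_iff[of "l - k"] by simp
      then show False using kl by (auto dest: dvd_imp_le)
    qed
  qed auto
  then have "card (adj v0) = q" unfolding adj_v0 by (simp add: card_image)
  moreover obtain g where g: "g \<in> W" "g v0 = u" by (rule W_transitive[OF assms])
  then have "card (adj u) = card (adj v0)"
    using adj_image[OF g(1), of v0] card_image[OF inj_on_subset[OF W_inj[OF g(1)]]] by simp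
  ultimately show ?thesis by simp
qed

text \<open>Rotations are counted by their action on directed edges: they correspond to the pairs of adjacent
  vertices, and each of the \<open>card V\<close> vertices has \<open>q\<close> neighbours.\<close>

lemma card_Wp: "card Wp = card V * q"
proof -
  have "bij_betw (\<lambda>g. (g v0, g v1)) Wp (SIGMA u:V. adj u)"
  proof (rule bij_betw_imageI)
    show "inj_on (\<lambda>g. (g v0, g v1)) Wp"
    proof (rule inj_onI)
      fix g h assume gh: "g \<in> Wp" "h \<in> Wp" "(g v0, g v1) = (h v0, h v1)"
      obtain h' where h': "h' \<in> Wp" "h \<circ> h' = id" "h' \<circ> h = id" by (rule Wp_inv[OF gh(2)])
      have inv: "h' (h x) = x" "h (h' x) = x" for x using h'(2,3) by (auto simp: fun_eq_iff)
      have "h' \<circ> g = id"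
        by (rule rotation_eq_id[OF Wp_comp[OF h'(1) gh(1)]]) (use gh(3) inv in simp_all)
      then have "h' (g x) = x" for x by (simp add: fun_eq_iff)
      then show "g = h" using inv by (metis ext)
    qed
    show "(\<lambda>g. (g v0, g v1)) ` Wp = (SIGMA u:V. adj u)"
    proof (intro equalityI subsetI)
      fix y assume "y \<in> (\<lambda>g. (g v0, g v1)) ` Wp"
      then obtain g where "g \<in> W" "y = (g v0, g v1)" using Wp_W by blast
      then show "y \<in> (SIGMA u:V. adj u)"
        using W_V_sub[of g] v0V v1V W_inner[of g v0 v1] by (simp add: adj_def)
    next
      fix y assume "y \<in> (SIGMA u:V. adj u)"
      then obtain u u' where y: "y = (u, u')" "u \<in> V" "u' \<in> adj u" by blast
      obtain g where g: "g \<in> W" "g v0 = u" by (rule W_transitive[OF y(2)])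
      then obtain k where k: "u' = g ((b0 ^^ k) v1)"
        using y(3) adj_image[OF g(1), of v0] adj_v0 by auto
      let ?h = "g \<circ> b0 ^^ k"
      have hW: "?h \<in> W" by (rule W_comp[OF g(1) Wp_W[OF Wp_funpow[OF Wp_b0]]])
      have h: "?h v0 = u" "?h v1 = u'" using g(2) k b0_v0 by simp_all
      have s2: "(s 2) v0 = v0" "(s 2) v1 = v1"
        using s_v0(2) fun_cong[OF s_comm, of v0] by simp_all
      have "det (matrix ?h) = 1 \<or> det (matrix ?h) = -1"
        by (rule det_W[OF hW])
      then show "y \<in> (\<lambda>g. (g v0, g v1)) ` Wp"
      proof
        assume "det (matrix ?h) = 1"
        then have "?h \<in> Wp" using hW by (simp add: Wp_def)
        then show ?thesis using h y(1) by (intro image_eqI[of _ _ ?h]) simp_all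
      next
        assume "det (matrix ?h) = -1"
        then have "?h \<circ> s 2 \<in> Wp"
          using W_comp[OF hW s_W[of 2]] det_comp[OF hW s_W[of 2]] det_s[of 2] by (simp add: Wp_def)
        then show ?thesis using h s2 y(1) by (intro image_eqI[of _ _ "?h \<circ> s 2"]) simp_all
      qed
    qed
  qed
  then have "card Wp = card (SIGMA u:V. adj u)" by (rule bij_betw_same_card)
  also have "\<dots> = (\<Sum>u\<in>V. card (adj u))"
    by (rule card_SigmaI[OF finV]) (simp add: adj_def finV)
  finally show ?thesis using card_adj by simp
qed

text \<open>A word in the reflections is a word in \<open>a0\<close> and \<open>b0\<close>, up to one more reflection when its
  determinant is negative.\<close>

lemma Wp_generated:
  assumes G: "id \<in> G" "\<And>g h. g \<in> G \<Longrightarrow> h \<in> G \<Longrightarrow> g \<circ> h \<in> G"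
    and gens: "a0 \<in> G" "b0 \<in> G" "s 1 \<circ> s 0 \<in> G" "s 2 \<circ> s 1 \<in> G"
  shows "Wp \<subseteq> G"
proof -
  have "(det (matrix g) = 1 \<longrightarrow> g \<in> G) \<and> (det (matrix g) = -1 \<longrightarrow> g \<circ> s 1 \<in> G)" if "g \<in> W" for g
    using that
  proof (induction rule: W_induct)
    case id
    have "(1 :: real) \<noteq> -1" by simp
    then show ?case unfolding det_id using G(1) by blast
  next
    case (step g i)
    have d: "det (matrix (g \<circ> s i)) = - det (matrix g)"
      unfolding det_comp[OF step(1) s_W[OF step(2)]] det_s[OF step(2)] by simp
    have s1i: "s 1 \<circ> s i \<in> G" and si1: "s i \<circ> s 1 \<in> G"
      using less_3_cases[OF step(2)] gens G(1) reflect_comp[of "al 1"] by (elim disjE; simp)+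
    show ?case
    proof (intro conjI impI)
      assume "det (matrix (g \<circ> s i)) = 1"
      then have "det (matrix g) = -1" using d by simp
      then have "g \<circ> s 1 \<in> G" using step(3) by blast
      then have "(g \<circ> s 1) \<circ> (s 1 \<circ> s i) \<in> G" using s1i by (rule G(2))
      moreover have "(g \<circ> s 1) \<circ> (s 1 \<circ> s i) = g \<circ> s i" by (simp add: fun_eq_iff)
      ultimately show "g \<circ> s i \<in> G" by (simp only:)
    next
      assume "det (matrix (g \<circ> s i)) = -1"
      then have "det (matrix g) = 1" using d by simp
      then have "g \<in> G" using step(3) by blast
      then have "g \<circ> (s i \<circ> s 1) \<in> G" using si1 by (rule G(2))
      then show "g \<circ> s i \<circ> s 1 \<in> G" by (simp only: comp_assoc)
    qed
  qed
  then show ?thesis by (auto simp: Wp_def)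
qed

end

text \<open>An arbitrary flag is the image of the base flag under some \<open>g\<close>, whose inverse is \<open>g'\<close>. The generators
  attached to it are conjugate by \<open>g\<close> to the simple reflections, and \<open>\<psi>\<close> is the resulting embedding of the
  reflection group into the automorphism group.\<close>

locale polytope_flag = reflection_polytope +
  fixes g g' :: "real^3 \<Rightarrow> real^3"
  assumes gW: "g \<in> W" and g'W: "g' \<in> W" and gg': "g \<circ> g' = id" and g'g: "g' \<circ> g = id"
begin

definition \<psi> :: "(real^3 \<Rightarrow> real^3) \<Rightarrow> (real^3) set \<Rightarrow> (real^3) set" where
  "\<psi> x = A (g \<circ> x \<circ> g')"

abbreviation "\<A> \<equiv> aut_group P"
abbreviation "R \<equiv> rotation_group 3 P (wflag g)"
abbreviation "\<sigma> \<equiv> sigma P (wflag g)"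

lemma conj_W: "x \<in> W \<Longrightarrow> g \<circ> x \<circ> g' \<in> W"
  by (intro W_comp gW g'W)

lemma g'g_apply: "g' (g x) = x" and gg'_apply: "g (g' x) = x"
  using g'g gg' by (auto simp: fun_eq_iff)

lemma \<psi>_in: "x \<in> W \<Longrightarrow> \<psi> x \<in> carrier \<A>"
  unfolding \<psi>_def aut_group_simps(1) by (rule A_automorphism[OF conj_W])

lemma \<psi>_mult: assumes "x \<in> W" "y \<in> W" shows "\<psi> x \<otimes>\<^bsub>\<A>\<^esub> \<psi> y = \<psi> (x \<circ> y)"
proof -
  have "\<psi> x \<otimes>\<^bsub>\<A>\<^esub> \<psi> y = A ((g \<circ> x \<circ> g') \<circ> (g \<circ> y \<circ> g'))"
    unfolding \<psi>_def by (rule A_mult[OF conj_W[OF assms(1)] conj_W[OF assms(2)]])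
  also have "(g \<circ> x \<circ> g') \<circ> (g \<circ> y \<circ> g') = g \<circ> (x \<circ> y) \<circ> g'"
    by (simp add: fun_eq_iff g'g_apply)
  finally show ?thesis unfolding \<psi>_def .
qed

lemma \<psi>_one: "\<psi> id = \<one>\<^bsub>\<A>\<^esub>"
proof -
  have "\<psi> id = A id" unfolding \<psi>_def by (simp add: gg')
  then show ?thesis by (simp add: A_def aut_group_simps(2))
qed

lemma \<psi>_inj: assumes "x \<in> W" "y \<in> W" "\<psi> x = \<psi> y" shows "x = y"
proof -
  have "g \<circ> x \<circ> g' = g \<circ> y \<circ> g'"
    using assms(3) unfolding \<psi>_def by (rule A_inj[OF conj_W[OF assms(1)] conj_W[OF assms(2)]])
  then have "g (x (g' z)) = g (y (g' z))" for z by (simp add: fun_eq_iff)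
  then have "x (g' z) = y (g' z)" for z using injD[OF W_inj[OF gW]] by blast
  then have "x z = y z" for z using g'g_apply[of z] by metis
  then show ?thesis by (rule ext)
qed

lemma \<psi>_inv:
  assumes "x \<in> W" "y \<in> W" "y \<circ> x = id"
  shows "inv\<^bsub>\<A>\<^esub> (\<psi> x) = \<psi> y"
  by (rule group.inv_equality[OF group_aut_group])
    (use assms in \<open>simp_all only: \<psi>_mult \<psi>_one \<psi>_in\<close>)

lemma rho_eq: "i < 3 \<Longrightarrow> rho P (wflag g) i = \<psi> (s i)"
  unfolding \<psi>_def by (rule rho_wflag[OF gW g'W gg' g'g])

lemma \<sigma>_eq: "\<sigma> 1 = \<psi> a0" "\<sigma> 2 = \<psi> b0"
  unfolding sigma_def using rho_eq[of 0] rho_eq[of 1] rho_eq[of 2] \<psi>_mult[OF s_W s_W, of 0 1]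
    \<psi>_mult[OF s_W s_W, of 1 2] by simp_all

lemma R_eq: "R = subgroup_generated \<A> {\<psi> a0, \<psi> b0}"
proof -
  have "{1..3 - 1} = {1, 2 :: nat}" by auto
  then show ?thesis
    unfolding rotation_group_def using \<sigma>_eq by simp
qed

lemma carrier_R: "carrier R = \<psi> ` Wp"
proof -
  have gens: "{\<psi> a0, \<psi> b0} \<subseteq> carrier \<A>"
    using \<psi>_in[OF Wp_W[OF Wp_a0]] \<psi>_in[OF Wp_W[OF Wp_b0]] by simp
  then have R: "carrier R = generate \<A> {\<psi> a0, \<psi> b0}"
    unfolding R_eq carrier_subgroup_generated by (simp add: Int_absorb1)
  have "subgroup (\<psi> ` Wp) \<A>"
  proof (rule group.subgroupI[OF group_aut_group])
    show "\<psi> ` Wp \<subseteq> carrier \<A>" using \<psi>_in Wp_W by blast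
    show "\<psi> ` Wp \<noteq> {}" using Wp_id by blast
    fix x assume "x \<in> \<psi> ` Wp"
    then obtain u where u: "u \<in> Wp" "x = \<psi> u" by blast
    obtain u' where u': "u' \<in> Wp" "u' \<circ> u = id" by (rule Wp_inv[OF u(1)])
    show "inv\<^bsub>\<A>\<^esub> x \<in> \<psi> ` Wp"
      unfolding u(2) \<psi>_inv[OF Wp_W[OF u(1)] Wp_W[OF u'(1)] u'(2)] using u'(1) by (rule imageI)
    fix y assume "y \<in> \<psi> ` Wp"
    then obtain v where v: "v \<in> Wp" "y = \<psi> v" by blast
    show "x \<otimes>\<^bsub>\<A>\<^esub> y \<in> \<psi> ` Wp"
      unfolding u(2) v(2) \<psi>_mult[OF Wp_W[OF u(1)] Wp_W[OF v(1)]] using Wp_comp[OF u(1) v(1)] by (rule imageI)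
  qed
  then have sub: "generate \<A> {\<psi> a0, \<psi> b0} \<subseteq> \<psi> ` Wp"
    using Wp_a0 Wp_b0 by (intro group.generate_subgroup_incl[OF group_aut_group]) auto
  define G where "G = {x \<in> Wp. \<psi> x \<in> generate \<A> {\<psi> a0, \<psi> b0}}"
  have "Wp \<subseteq> G"
  proof (rule Wp_generated)
    show "id \<in> G" unfolding G_def using Wp_id \<psi>_one generate.one by simp
    show "x \<circ> y \<in> G" if "x \<in> G" "y \<in> G" for x y
      using that Wp_comp[of x y] \<psi>_mult[of x y] Wp_W generate.eng[of "\<psi> x" \<A> _ "\<psi> y"] by (simp add: G_def)
    show "a0 \<in> G" "b0 \<in> G"
      unfolding G_def using Wp_a0 Wp_b0 by (auto intro: generate.incl)
    have inv: "(s 1 \<circ> s 0) \<circ> a0 = id" "(s 2 \<circ> s 1) \<circ> b0 = id"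
      by (simp_all add: fun_eq_iff)
    have "inv\<^bsub>\<A>\<^esub> (\<psi> a0) = \<psi> (s 1 \<circ> s 0)" "inv\<^bsub>\<A>\<^esub> (\<psi> b0) = \<psi> (s 2 \<circ> s 1)"
      using \<psi>_inv[OF Wp_W[OF Wp_a0] Wp_W[OF Wp_ss] inv(1)] \<psi>_inv[OF Wp_W[OF Wp_b0] Wp_W[OF Wp_ss] inv(2)]
      by simp_all
    moreover have "inv\<^bsub>\<A>\<^esub> (\<psi> a0) \<in> generate \<A> {\<psi> a0, \<psi> b0}" "inv\<^bsub>\<A>\<^esub> (\<psi> b0) \<in> generate \<A> {\<psi> a0, \<psi> b0}"
      by (rule generate.inv; simp)+
    ultimately show "s 1 \<circ> s 0 \<in> G" "s 2 \<circ> s 1 \<in> G"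
      unfolding G_def using Wp_ss[of 1 0] Wp_ss[of 2 1] by simp_all
  qed
  then show ?thesis using sub R by (auto simp: G_def)
qed

lemma group_R: "group R"
  unfolding R_eq by (rule group.group_subgroup_generated[OF group_aut_group])

lemma R_mult: "x \<in> Wp \<Longrightarrow> y \<in> Wp \<Longrightarrow> \<psi> x \<otimes>\<^bsub>R\<^esub> \<psi> y = \<psi> (x \<circ> y)"
  unfolding R_eq mult_subgroup_generated by (rule \<psi>_mult[OF Wp_W Wp_W])

lemma R_one: "\<one>\<^bsub>R\<^esub> = \<psi> id"
  unfolding R_eq one_subgroup_generated \<psi>_one ..

lemma R_in: "x \<in> Wp \<Longrightarrow> \<psi> x \<in> carrier R"
  unfolding carrier_R by (rule imageI)

lemma R_pow: "x \<in> Wp \<Longrightarrow> \<psi> x [^]\<^bsub>R\<^esub> (k :: nat) = \<psi> (x ^^ k)"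
proof (induct k)
  case 0
  show ?case unfolding funpow.simps(1) R_one[symmetric] by simp
next
  case (Suc k)
  show ?case
    unfolding funpow_Suc_right nat_pow_Suc Suc(1)[OF Suc(2)] R_mult[OF Wp_funpow[OF Suc(2)] Suc(2)] ..
qed

lemma R_eq_one_iff: "x \<in> Wp \<Longrightarrow> \<psi> x = \<one>\<^bsub>R\<^esub> \<longleftrightarrow> x = id"
  unfolding R_one using \<psi>_inj[OF Wp_W W_id] by blast

lemma ord_\<sigma>: "group.ord R (\<psi> a0) = p" "group.ord R (\<psi> b0) = q"
  using group.ord_unique[OF group_R R_in[OF Wp_a0]] group.ord_unique[OF group_R R_in[OF Wp_b0]]
    R_pow[OF Wp_a0] R_pow[OF Wp_b0] R_eq_one_iff[OF Wp_funpow[OF Wp_a0]] R_eq_one_iff[OF Wp_funpow[OF Wp_b0]]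
    a0_id_iff b0_id_iff by simp_all

lemma finite_R: "finite (carrier R)"
  unfolding carrier_R by (rule finite_imageI) (rule finite_subset[OF _ finite_W], auto simp: Wp_def)

lemma rotation_pair_R:
  "rotation_pair R (\<psi> a0) (\<psi> b0) (\<lambda>y. \<psi> (s 2) \<otimes>\<^bsub>\<A>\<^esub> y \<otimes>\<^bsub>\<A>\<^esub> \<psi> (s 2))"
proof (intro rotation_pair.intro rotation_pair_axioms.intro group_R finite_R R_in Wp_a0 Wp_b0)
  let ?\<alpha> = "\<lambda>y. \<psi> (s 2) \<otimes>\<^bsub>\<A>\<^esub> y \<otimes>\<^bsub>\<A>\<^esub> \<psi> (s 2)"
  have s2: "s 2 \<in> W" by (rule s_W) simp
  have \<alpha>: "?\<alpha> (\<psi> x) = \<psi> (s 2 \<circ> x \<circ> s 2)" if "x \<in> Wp" for x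
    unfolding \<psi>_mult[OF s2 Wp_W[OF that]] \<psi>_mult[OF W_comp[OF s2 Wp_W[OF that]] s2] ..
  have conj: "s 2 \<circ> x \<circ> s 2 \<in> Wp" if "x \<in> Wp" for x
    by (rule Wp_conj[OF that]) simp
  have comm: "s 0 (s 2 x) = s 2 (s 0 x)" for x using fun_cong[OF s_comm, of x] by simp
  have "carrier (subgroup_generated R {\<psi> a0, \<psi> b0}) = carrier R"
    unfolding R_eq by (simp add: group.subgroup_generated2[OF group_aut_group])
  then show "generate R {\<psi> a0, \<psi> b0} = carrier R"
    unfolding carrier_subgroup_generated using R_in[OF Wp_a0] R_in[OF Wp_b0] by (simp add: Int_absorb1)
  have "(a0 \<circ> b0) \<circ> (a0 \<circ> b0) = id"
    by (simp add: fun_eq_iff comm)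
  then show "\<psi> a0 \<otimes>\<^bsub>R\<^esub> \<psi> b0 \<otimes>\<^bsub>R\<^esub> (\<psi> a0 \<otimes>\<^bsub>R\<^esub> \<psi> b0) = \<one>\<^bsub>R\<^esub>"
    unfolding R_mult[OF Wp_a0 Wp_b0] R_mult[OF Wp_comp[OF Wp_a0 Wp_b0] Wp_comp[OF Wp_a0 Wp_b0]] R_one
    by (simp only:)
  show "\<psi> a0 \<noteq> \<one>\<^bsub>R\<^esub>"
    using R_eq_one_iff[OF Wp_a0] a0_id_iff[of 1] p by simp
  show "\<psi> b0 \<noteq> \<one>\<^bsub>R\<^esub>"
    using R_eq_one_iff[OF Wp_b0] b0_id_iff[of 1] q by simp
  have "y = \<one>\<^bsub>R\<^esub>" if y: "y \<in> generate R {\<psi> a0}" "y \<in> generate R {\<psi> b0}" for y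
  proof -
    obtain k where k: "y = \<psi> a0 [^]\<^bsub>R\<^esub> (k :: nat)"
      using y(1) group.generate_pow_on_finite_carrier[OF group_R finite_R R_in[OF Wp_a0]] by blast
    obtain l where l: "y = \<psi> b0 [^]\<^bsub>R\<^esub> (l :: nat)"
      using y(2) group.generate_pow_on_finite_carrier[OF group_R finite_R R_in[OF Wp_b0]] by blast
    have "\<psi> (a0 ^^ k) = \<psi> (b0 ^^ l)"
      using k l R_pow[OF Wp_a0] R_pow[OF Wp_b0] by simp
    then have eq: "a0 ^^ k = b0 ^^ l"
      by (rule \<psi>_inj[OF Wp_W[OF Wp_funpow[OF Wp_a0]] Wp_W[OF Wp_funpow[OF Wp_b0]]])
    then have "(a0 ^^ k) v0 = v0" using b0_v0[of l] by (simp only:)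
    then have "a0 ^^ k = id" unfolding a0_id_iff by (simp only: a0_v0_iff)
    then show ?thesis using k R_pow[OF Wp_a0] R_one by simp
  qed
  then show "generate R {\<psi> a0} \<inter> generate R {\<psi> b0} = {\<one>\<^bsub>R\<^esub>}"
    by (auto intro: generate.one)
  show "?\<alpha> \<in> hom R R"
  proof (rule homI)
    fix x assume "x \<in> carrier R"
    then obtain u where u: "u \<in> Wp" "x = \<psi> u" unfolding carrier_R by blast
    show "?\<alpha> x \<in> carrier R" unfolding u(2) \<alpha>[OF u(1)] by (rule R_in[OF conj[OF u(1)]])
    fix y assume "y \<in> carrier R"
    then obtain v where v: "v \<in> Wp" "y = \<psi> v" unfolding carrier_R by blast
    have "s 2 \<circ> (u \<circ> v) \<circ> s 2 = (s 2 \<circ> u \<circ> s 2) \<circ> (s 2 \<circ> v \<circ> s 2)"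
      by (simp add: fun_eq_iff)
    then show "?\<alpha> (x \<otimes>\<^bsub>R\<^esub> y) = ?\<alpha> x \<otimes>\<^bsub>R\<^esub> ?\<alpha> y"
      unfolding u(2) v(2) R_mult[OF u(1) v(1)] \<alpha>[OF u(1)] \<alpha>[OF v(1)] \<alpha>[OF Wp_comp[OF u(1) v(1)]]
        R_mult[OF conj[OF u(1)] conj[OF v(1)]] by (simp only:)
  qed
  have "s 2 \<circ> a0 \<circ> s 2 = a0 \<circ> b0 \<circ> b0"
    by (simp add: fun_eq_iff comm)
  then show "?\<alpha> (\<psi> a0) = \<psi> a0 \<otimes>\<^bsub>R\<^esub> \<psi> b0 \<otimes>\<^bsub>R\<^esub> \<psi> b0"
    unfolding \<alpha>[OF Wp_a0] R_mult[OF Wp_a0 Wp_b0] R_mult[OF Wp_comp[OF Wp_a0 Wp_b0] Wp_b0] by (simp only:)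
  have "(s 2 \<circ> b0 \<circ> s 2) \<circ> b0 = id"
    by (simp add: fun_eq_iff)
  then show "?\<alpha> (\<psi> b0) = inv\<^bsub>R\<^esub> (\<psi> b0)"
    unfolding \<alpha>[OF Wp_b0]
    by (intro group.inv_equality[OF group_R, symmetric] R_in conj Wp_b0)
      (simp only: R_mult[OF conj[OF Wp_b0] Wp_b0] R_one)
qed

lemma rotary_wflag: "rotary P (wflag g) p q (card V * q)"
proof -
  have "inj_on \<psi> Wp" by (rule inj_onI) (rule \<psi>_inj[OF Wp_W Wp_W])
  then have "card (carrier R) = card V * q"
    unfolding carrier_R by (simp add: card_image card_Wp)
  then show ?thesis
    unfolding rotary_def \<sigma>_eq using rotation_pair_R ord_\<sigma> by blast
qed

end

theorem (in reflection_polytope) rotary_flag: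
  assumes "\<Phi> \<in> flags P"
  shows "rotary P \<Phi> p q (card V * q)"
proof -
  obtain g where g: "g \<in> W" "\<Phi> = wflag g" using assms unfolding flags_eq by blast
  obtain g' where g': "g' \<in> W" "g \<circ> g' = id" "g' \<circ> g = id" by (rule W_inv[OF g(1)])
  interpret polytope_flag V al w v0 p q g g'
    by (intro polytope_flag.intro polytope_flag_axioms.intro reflection_polytope_axioms g(1) g')
  show ?thesis unfolding g(2) by (rule rotary_wflag)
qed

section \<open>The five regular polyhedra\<close>

definition triple :: "'a \<Rightarrow> 'a \<Rightarrow> 'a \<Rightarrow> nat \<Rightarrow> 'a" where
  "triple x y z i = (if i = 0 then x else if i = 1 then y else z)"

lemma funpow_cycle:
  assumes "map f xs = rotate1 xs" "xs \<noteq> []"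
  shows "(f ^^ k) (hd xs) = xs ! (k mod length xs)"
proof (induct k)
  case 0
  show ?case using assms(2) by (simp add: hd_conv_nth)
next
  case (Suc k)
  have k: "k mod length xs < length xs" using assms(2) by simp
  have "f (xs ! (k mod length xs)) = rotate1 xs ! (k mod length xs)"
    using k assms(1) by (metis nth_map)
  also have "\<dots> = xs ! (Suc k mod length xs)"
    using nth_rotate1[OF k] by (simp add: mod_Suc_eq)
  finally show ?case using Suc by simp
qed

text \<open>The hypotheses in a form that is checked by calculation: the orbits of the two rotations are given
  as lists, \<open>us\<close> starting at the base vertex and \<open>ns\<close> at its neighbour.\<close>

lemma reflection_polytopeI:
  fixes a0 a1 a2 w0 w1 w2 v0 :: "real^3"
  assumes V: "finite V" "v0 \<in> V"
    and dual: "a0 \<bullet> w0 = 1" "a0 \<bullet> w1 = 0" "a0 \<bullet> w2 = 0" "a1 \<bullet> w0 = 0" "a1 \<bullet> w1 = 1" "a1 \<bullet> w2 = 0"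
      "a2 \<bullet> w0 = 0" "a2 \<bullet> w1 = 0" "a2 \<bullet> w2 = 1"
    and expand: "\<And>x y z. vector [x, y, z] = (vector [x, y, z] \<bullet> a0) *\<^sub>R w0 +
      (vector [x, y, z] \<bullet> a1) *\<^sub>R w1 + (vector [x, y, z] \<bullet> a2) *\<^sub>R w2"
    and ortho: "a0 \<bullet> a2 = 0"
    and closed: "\<forall>x\<in>V. reflect a0 x \<in> V" "\<forall>x\<in>V. reflect a1 x \<in> V" "\<forall>x\<in>V. reflect a2 x \<in> V"
    and maximal: "\<forall>x\<in>V. w0 \<bullet> x \<le> w0 \<bullet> v0" "\<forall>x\<in>V. w1 \<bullet> x \<le> w1 \<bullet> v0" "\<forall>x\<in>V. w2 \<bullet> x \<le> w2 \<bullet> v0"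
    and pos: "w0 \<bullet> v0 > 0" "w1 \<bullet> v0 > 0" "w2 \<bullet> v0 > 0"
    and vertex: "\<forall>x\<in>V. w0 \<bullet> x = w0 \<bullet> v0 \<longrightarrow> x = v0"
    and edge: "\<forall>x\<in>V. w1 \<bullet> x = w1 \<bullet> v0 \<longrightarrow> x = v0 \<or> x = hd ns"
    and sphere: "\<forall>x\<in>V. x \<bullet> x = v0 \<bullet> v0"
    and us: "hd us = v0" "distinct us" "length us > 1" "map (reflect a0 \<circ> reflect a1) us = rotate1 us"
    and ns: "reflect a0 v0 = hd ns" "distinct ns" "length ns > 1" "map (reflect a1 \<circ> reflect a2) ns = rotate1 ns"
    and neighbours: "\<forall>x\<in>V. v0 \<bullet> x = v0 \<bullet> hd ns \<longrightarrow> x \<in> set ns"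
    and pq: "p = length us" "q = length ns"
  shows "reflection_polytope V (triple a0 a1 a2) (triple w0 w1 w2) v0 p q"
proof
  have t: "triple x y z 0 = x" "triple x y z 1 = y" "triple x y z 2 = z" for x y z :: "real^3"
    by (simp_all add: triple_def)
  show "finite V" "v0 \<in> V" by (rule V)+
  show "triple a0 a1 a2 i \<bullet> triple w0 w1 w2 j = (if i = j then 1 else 0)" if "i < 3" "j < 3" for i j
    using less_3_cases[OF that(1)] less_3_cases[OF that(2)] dual by (elim disjE) (simp_all add: triple_def)
  show "x = (x \<bullet> triple a0 a1 a2 0) *\<^sub>R triple w0 w1 w2 0 + (x \<bullet> triple a0 a1 a2 1) *\<^sub>R triple w0 w1 w2 1 +
      (x \<bullet> triple a0 a1 a2 2) *\<^sub>R triple w0 w1 w2 2" for x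
  proof -
    have "x = vector [x $ 1, x $ 2, x $ 3]" by (simp add: vec_eq_iff forall_3)
    then show ?thesis unfolding t using expand by metis
  qed
  show "triple a0 a1 a2 0 \<bullet> triple a0 a1 a2 2 = 0" unfolding t by (rule ortho)
  show "reflect (triple a0 a1 a2 i) x \<in> V" if "i < 3" "x \<in> V" for i x
    using less_3_cases[OF that(1)] closed that(2) by (elim disjE) (simp_all add: triple_def)
  show "triple w0 w1 w2 i \<bullet> x \<le> triple w0 w1 w2 i \<bullet> v0" if "i < 3" "x \<in> V" for i x
    using less_3_cases[OF that(1)] maximal that(2) by (elim disjE) (simp_all add: triple_def)
  show "triple w0 w1 w2 i \<bullet> v0 > 0" if "i < 3" for i
    using less_3_cases[OF that] pos by (elim disjE) (simp_all add: triple_def)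
  show "x = v0" if "x \<in> V" "triple w0 w1 w2 0 \<bullet> x = triple w0 w1 w2 0 \<bullet> v0" for x
    using vertex that unfolding t by blast
  show "x = v0 \<or> x = reflect (triple a0 a1 a2 0) v0"
    if "x \<in> V" "triple w0 w1 w2 1 \<bullet> x = triple w0 w1 w2 1 \<bullet> v0" for x
    using edge that ns(1) unfolding t by simp
  show "x \<bullet> x = v0 \<bullet> v0" if "x \<in> V" for x using sphere that by blast
  show "1 < p" "1 < q" using us(3) ns(3) pq by simp_all
  have ne: "us \<noteq> []" "ns \<noteq> []" using us(3) ns(3) by auto
  note cu = funpow_cycle[OF us(4) ne(1)] and cn = funpow_cycle[OF ns(4) ne(2)]
  show "((reflect (triple a0 a1 a2 0) \<circ> reflect (triple a0 a1 a2 1)) ^^ p) v0 = v0"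
    unfolding t using cu[of p] ne us(1) pq by (simp add: hd_conv_nth)
  show "((reflect (triple a0 a1 a2 0) \<circ> reflect (triple a0 a1 a2 1)) ^^ k) v0 \<noteq> v0" if "0 < k" "k < p" for k
    unfolding t using cu[of k] ne us(1,2) pq that nth_eq_iff_index_eq[of us k 0] by (simp add: hd_conv_nth)
  show "((reflect (triple a0 a1 a2 1) \<circ> reflect (triple a0 a1 a2 2)) ^^ q) (reflect (triple a0 a1 a2 0) v0) =
      reflect (triple a0 a1 a2 0) v0"
    unfolding t ns(1) using cn[of q] ne pq by (simp add: hd_conv_nth)
  show "((reflect (triple a0 a1 a2 1) \<circ> reflect (triple a0 a1 a2 2)) ^^ k) (reflect (triple a0 a1 a2 0) v0) \<noteq>
      reflect (triple a0 a1 a2 0) v0" if "0 < k" "k < q" for k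
    unfolding t ns(1) using cn[of k] ne ns(2) pq that nth_eq_iff_index_eq[of ns k 0] by (simp add: hd_conv_nth)
  show "\<exists>k<q. x = ((reflect (triple a0 a1 a2 1) \<circ> reflect (triple a0 a1 a2 2)) ^^ k) (reflect (triple a0 a1 a2 0) v0)"
    if x: "x \<in> V" "v0 \<bullet> x = v0 \<bullet> reflect (triple a0 a1 a2 0) v0" for x
  proof -
    have "x \<in> set ns" using neighbours x unfolding t ns(1) by blast
    then obtain k where "k < length ns" "x = ns ! k" by (auto simp: in_set_conv_nth)
    then show ?thesis unfolding t ns(1) pq(2) using cn[of k] by auto
  qed
qed

lemma vec3_eq: "(vector [a, b, c] :: real^3) = vector [x, y, z] \<longleftrightarrow> a = x \<and> b = y \<and> c = z"
  by (simp add: vec_eq_iff forall_3)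

lemma vec3_inner: "(vector [a, b, c] :: real^3) \<bullet> vector [x, y, z] = a * x + b * y + c * z"
  by (simp add: inner_vec_def sum_3)

lemma vec3_reflect: "reflect (vector [a, b, c]) (vector [x, y, z] :: real^3) =
  (let t = 2 * (a * x + b * y + c * z) / (a * a + b * b + c * c) in vector [x - t * a, y - t * b, z - t * c])"
  by (simp add: vec_eq_iff forall_3 reflect_def vec3_inner Let_def)

lemma vec3_scale: "k *\<^sub>R (vector [a, b, c] :: real^3) = vector [k * a, k * b, k * c]"
  and vec3_add: "(vector [a, b, c] :: real^3) + vector [x, y, z] = vector [a + x, b + y, c + z]"
  by (simp_all add: vec_eq_iff forall_3)

lemmas vec3_simps = vec3_eq vec3_inner vec3_reflect vec3_scale vec3_add Let_def

lemma golden_square: "golden_ratio * golden_ratio = golden_ratio + 1"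
proof -
  have "sqrt 5 * sqrt 5 = (5 :: real)" by simp
  then show ?thesis unfolding golden_ratio_def by (simp add: field_simps)
qed

lemma golden_square': "golden_ratio * (golden_ratio * x) = golden_ratio * x + x"
  using golden_square by (metis (no_types) distrib_right mult.assoc mult_1)

lemma golden_bounds: "16 / 10 < golden_ratio" "golden_ratio < 17 / 10"
proof -
  have "22 / 10 < sqrt 5" by (rule real_less_rsqrt) (simp add: power2_eq_square)
  moreover have "sqrt 5 < 24 / 10" by (rule real_less_lsqrt) (simp_all add: power2_eq_square)
  ultimately show "16 / 10 < golden_ratio" "golden_ratio < 17 / 10"
    unfolding golden_ratio_def by simp_all
qed

lemma golden_inverse: "1 / golden_ratio = golden_ratio - 1"
  using golden_square golden_bounds by (simp add: field_simps)

lemma reflect_axes: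
  "reflect (vector [1, 0, 0]) (vector [x, y, z] :: real^3) = vector [- x, y, z]"
  "reflect (vector [0, 1, 0]) (vector [x, y, z] :: real^3) = vector [x, - y, z]"
  by (simp_all add: vec3_simps)

lemma golden_norm:
  "- golden_ratio * - golden_ratio + - 1 * - 1 + (golden_ratio - 1) * (golden_ratio - 1) = 4"
  "- 1 * - 1 + - golden_ratio * - golden_ratio + (golden_ratio - 1) * (golden_ratio - 1) = 4"
  by (simp_all add: algebra_simps golden_square)

text \<open>The root has squared length 4, which clears the denominator of the reflection.\<close>

lemma golden_reflect:
  "reflect (vector [- golden_ratio, - 1, golden_ratio - 1]) (vector [x, y, z] :: real^3) =
    (let t = (- (golden_ratio * x) - y + (golden_ratio - 1) * z) / 2
     in vector [x + t * golden_ratio, y + t, z - t * (golden_ratio - 1)])"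
  "reflect (vector [- 1, - golden_ratio, golden_ratio - 1]) (vector [x, y, z] :: real^3) =
    (let t = (- x - golden_ratio * y + (golden_ratio - 1) * z) / 2
     in vector [x + t, y + t * golden_ratio, z - t * (golden_ratio - 1)])"
  unfolding vec3_reflect golden_norm Let_def by (simp_all add: vec3_eq field_simps)

definition tetrahedron_vertices :: "(real^3) set" where
  "tetrahedron_vertices = {vector [1, 1, 1], vector [1, -1, -1], vector [-1, 1, -1], vector [-1, -1, 1]}"

definition octahedron_vertices :: "(real^3) set" where
  "octahedron_vertices = (\<Union>s\<in>{-1, 1}. {vector [s, 0, 0], vector [0, s, 0], vector [0, 0, s]})"

definition cube_vertices :: "(real^3) set" where
  "cube_vertices = (\<Union>s\<in>{-1, 1}. \<Union>t\<in>{-1, 1}. {vector [s, t, 1], vector [s, t, -1]})"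

definition icosahedron_vertices :: "(real^3) set" where
  "icosahedron_vertices = (\<Union>s\<in>{-1, 1}. \<Union>t\<in>{- golden_ratio, golden_ratio}.
     {vector [0, s, t], vector [s, t, 0], vector [t, 0, s]})"

definition dodecahedron_vertices :: "(real^3) set" where
  "dodecahedron_vertices = cube_vertices \<union>
     (\<Union>s\<in>{1 - golden_ratio, golden_ratio - 1}. \<Union>t\<in>{- golden_ratio, golden_ratio}.
       {vector [0, s, t], vector [s, t, 0], vector [t, 0, s]})"

lemma reflection_polytope_tetrahedron:
  "reflection_polytope tetrahedron_vertices
     (triple (vector [0, 1, 1]) (vector [1, -1, 0]) (vector [0, 1, -1]))
     (triple (vector [1/2, 1/2, 1/2]) (vector [1, 0, 0]) (vector [1/2, 1/2, -1/2]))
     (vector [1, 1, 1]) 3 3"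
  by (rule reflection_polytopeI[where
        us = "[vector [1, 1, 1], vector [1, -1, -1], vector [-1, 1, -1]]" and
        ns = "[vector [1, -1, -1], vector [-1, 1, -1], vector [-1, -1, 1]]"])
    (auto simp: tetrahedron_vertices_def vec3_simps field_simps)+

lemma reflection_polytope_octahedron:
  "reflection_polytope octahedron_vertices
     (triple (vector [1, -1, 0]) (vector [0, 1, -1]) (vector [0, 0, 1]))
     (triple (vector [1, 0, 0]) (vector [1, 1, 0]) (vector [1, 1, 1]))
     (vector [1, 0, 0]) 3 4"
  by (rule reflection_polytopeI[where
        us = "[vector [1, 0, 0], vector [0, 1, 0], vector [0, 0, 1]]" and
        ns = "[vector [0, 1, 0], vector [0, 0, 1], vector [0, -1, 0], vector [0, 0, -1]]"])
    (auto simp: octahedron_vertices_def vec3_simps field_simps)+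

lemma reflection_polytope_cube:
  "reflection_polytope cube_vertices
     (triple (vector [0, 0, 1]) (vector [0, 1, -1]) (vector [1, -1, 0]))
     (triple (vector [1, 1, 1]) (vector [1, 1, 0]) (vector [1, 0, 0]))
     (vector [1, 1, 1]) 4 3"
  by (rule reflection_polytopeI[where
        us = "[vector [1, 1, 1], vector [1, 1, -1], vector [1, -1, -1], vector [1, -1, 1]]" and
        ns = "[vector [1, 1, -1], vector [1, -1, 1], vector [-1, 1, 1]]"])
    (auto simp: cube_vertices_def vec3_simps field_simps)+

lemma reflection_polytope_icosahedron:
  "reflection_polytope icosahedron_vertices
     (triple (vector [0, 1, 0]) (vector [- golden_ratio, -1, golden_ratio - 1]) (vector [1, 0, 0]))
     (triple (vector [0, 1, golden_ratio]) (vector [0, 0, golden_ratio]) (vector [1, 0, (1 + golden_ratio)]))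
     (vector [0, 1, golden_ratio]) 3 5"
  by (rule reflection_polytopeI[where
        us = "[vector [0, 1, golden_ratio], vector [0, -1, golden_ratio], vector [golden_ratio, 0, 1]]" and
        ns = "[vector [0, -1, golden_ratio], vector [golden_ratio, 0, 1], vector [1, golden_ratio, 0], vector [-1, golden_ratio, 0], vector [- golden_ratio, 0, 1]]"])
    ((insert golden_bounds, simp add: icosahedron_vertices_def vec3_eq vec3_inner vec3_scale
      vec3_add Let_def reflect_axes golden_reflect golden_square golden_square'
      algebra_simps add_divide_distrib diff_divide_distrib)[1])+

lemma reflection_polytope_dodecahedron:
  "reflection_polytope dodecahedron_vertices
     (triple (vector [0, 1, 0]) (vector [-1, - golden_ratio, golden_ratio - 1]) (vector [1, 0, 0]))
     (triple (vector [0, 1, (1 + golden_ratio)]) (vector [0, 0, golden_ratio]) (vector [1, 0, golden_ratio]))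
     (vector [0, golden_ratio - 1, golden_ratio]) 5 3"
  by (rule reflection_polytopeI[where
        us = "[vector [0, golden_ratio - 1, golden_ratio], vector [0, 1 - golden_ratio, golden_ratio], vector [1, -1, 1], vector [golden_ratio, 0, golden_ratio - 1], vector [1, 1, 1]]" and
        ns = "[vector [0, 1 - golden_ratio, golden_ratio], vector [1, 1, 1], vector [-1, 1, 1]]"])
    ((insert golden_bounds, simp add: dodecahedron_vertices_def cube_vertices_def vec3_eq vec3_inner vec3_scale
      vec3_add Let_def reflect_axes golden_reflect golden_square golden_square'
      algebra_simps add_divide_distrib diff_divide_distrib)[1])+

lemma card_vertices:
  "card tetrahedron_vertices = 4" "card octahedron_vertices = 6" "card cube_vertices = 8"
  "card icosahedron_vertices = 12" "card dodecahedron_vertices = 20"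
  using golden_bounds
  by (simp_all add: tetrahedron_vertices_def octahedron_vertices_def cube_vertices_def
      icosahedron_vertices_def dodecahedron_vertices_def vec3_eq card_insert_if)

lemma face_lattice_eqs:
  "tetrahedron = convex hull tetrahedron_vertices" "octahedron = convex hull octahedron_vertices"
  "cube = convex hull cube_vertices" "icosahedron = convex hull icosahedron_vertices"
  "dodecahedron = convex hull dodecahedron_vertices"
proof -
  show "tetrahedron = convex hull tetrahedron_vertices"
    by (simp add: tetrahedron_def tetrahedron_vertices_def)
  have axes: "axis 1 c = (vector [c, 0, 0] :: real^3)" "axis 2 c = (vector [0, c, 0] :: real^3)"
    "axis 3 c = (vector [0, 0, c] :: real^3)" for c
    by (simp_all add: axis_def vec_eq_iff forall_3)
  have "{axis i c :: real^3 | i c. c \<in> {-1, 1}} = (\<Union>c\<in>{-1, 1}. {axis 1 c, axis 2 c, axis 3 c})"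
  proof -
    have "{axis i c :: real^3 | i c. c \<in> {-1, 1}} = (\<Union>c\<in>{-1, 1}. range (\<lambda>i. axis i c))" by auto
    then show ?thesis by (simp only: UNIV_3 image_insert image_empty)
  qed
  then show "octahedron = convex hull octahedron_vertices"
    unfolding octahedron_def octahedron_vertices_def axes by (simp only:)
  have cube: "{vector [s, t, u] :: real^3 | s t u. s \<in> {-1, 1} \<and> t \<in> {-1, 1} \<and> u \<in> {-1, 1}} = cube_vertices"
    unfolding cube_vertices_def by blast
  show "cube = convex hull cube_vertices"
    unfolding cube_def cube ..
  show "icosahedron = convex hull icosahedron_vertices"
    unfolding icosahedron_def icosahedron_vertices_def ..
  have "- 1 / golden_ratio = 1 - golden_ratio"
    using golden_inverse by simp
  then show "dodecahedron = convex hull dodecahedron_vertices"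
    unfolding dodecahedron_def dodecahedron_vertices_def cube golden_inverse by (simp only:)
qed

section \<open>The table of mixes\<close>

text \<open>A polyhedron of type \<open>{p, q}\<close> has \<open>2pq / (2p + 2q - pq)\<close> edges by Euler's formula, and
  \<open>4 - (p - 2)(q - 2) = 2p + 2q - pq\<close>; its rotations correspond to its directed edges.\<close>

definition rotation_order :: "nat \<Rightarrow> nat \<Rightarrow> nat" where
  "rotation_order p q = 4 * p * q div (4 - (p - 2) * (q - 2))"

definition has_type :: "('a ranked_poset \<times> 'a set) \<Rightarrow> nat \<times> nat \<Rightarrow> bool" where
  "has_type P t \<longleftrightarrow> rotary (fst P) (snd P) (fst t) (snd t) (rotation_order (fst t) (snd t))"

theorem has_parameters_mixI:
  assumes types: "list_all2 has_type Ps ts" "Ps \<noteq> []" "distinct ts"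
    "set ts \<subseteq> {(3, 3), (3, 4), (3, 5), (4, 3), (5, 3)}"
    and M: "M = prod_list (map (\<lambda>t. rotation_order (fst t) (snd t)) ts)"
    and f: "f0 = M div Lcm (snd ` set ts)" "f1 = M div 2" "f2 = M div Lcm (fst ` set ts)" "g = 2 * M"
  shows "has_parameters (mix 3 Ps) (f0, f1, f2, g)"
proof -
  have len: "length ts = length Ps" using list_all2_lengthD[OF types(1)] by simp
  have img: "(\<lambda>r. F (ts ! r)) ` {..<length Ps} = F ` set ts" for F :: "nat \<times> nat \<Rightarrow> nat"
    unfolding len[symmetric] by (auto simp: set_conv_nth)
  have "has_parameters (mix 3 Ps)
     (M div (LCM r\<in>{..<length Ps}. snd (ts ! r)), M div 2, M div (LCM r\<in>{..<length Ps}. fst (ts ! r)), 2 * M)"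
  proof (rule has_parameters_mix[OF types(2)])
    show "rotary (fst (Ps ! r)) (snd (Ps ! r)) (fst (ts ! r)) (snd (ts ! r))
        (rotation_order (fst (ts ! r)) (snd (ts ! r)))" if "r < length Ps" for r
      using list_all2_nthD[OF types(1) that] by (simp add: has_type_def)
    show "(fst (ts ! r), snd (ts ! r)) \<in> {(3, 3), (3, 4), (3, 5), (4, 3), (5, 3)}" if "r < length Ps" for r
      using subsetD[OF types(4) nth_mem[of r ts]] that len by simp
    show "inj_on (\<lambda>r. (fst (ts ! r), snd (ts ! r))) {..<length Ps}"
      using types(3) len by (auto simp: inj_on_def nth_eq_iff_index_eq)
    show "M = (\<Prod>r<length Ps. rotation_order (fst (ts ! r)) (snd (ts ! r)))"
      unfolding M by (simp add: prod.list_conv_set_nth len atLeast0LessThan)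
  qed
  then show ?thesis unfolding img f .
qed

lemma has_type_polyhedra:
  "\<Phi> \<in> flags P33 \<Longrightarrow> has_type (P33, \<Phi>) (3, 3)" "\<Phi> \<in> flags P34 \<Longrightarrow> has_type (P34, \<Phi>) (3, 4)"
  "\<Phi> \<in> flags P35 \<Longrightarrow> has_type (P35, \<Phi>) (3, 5)" "\<Phi> \<in> flags P43 \<Longrightarrow> has_type (P43, \<Phi>) (4, 3)"
  "\<Phi> \<in> flags P53 \<Longrightarrow> has_type (P53, \<Phi>) (5, 3)"
proof -
  have rotary: "rotary (face_lattice (convex hull V)) \<Phi> p q (card V * q)"
    if "reflection_polytope V al w v0 p q" "\<Phi> \<in> flags (face_lattice (convex hull V))" for V al w v0 p q \<Phi>
    using reflection_polytope.rotary_flag[OF that(1)] that(2)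
    unfolding reflection_polytope.K_def[OF that(1)] by blast
  show "\<Phi> \<in> flags P33 \<Longrightarrow> has_type (P33, \<Phi>) (3, 3)" "\<Phi> \<in> flags P34 \<Longrightarrow> has_type (P34, \<Phi>) (3, 4)"
    "\<Phi> \<in> flags P35 \<Longrightarrow> has_type (P35, \<Phi>) (3, 5)" "\<Phi> \<in> flags P43 \<Longrightarrow> has_type (P43, \<Phi>) (4, 3)"
    "\<Phi> \<in> flags P53 \<Longrightarrow> has_type (P53, \<Phi>) (5, 3)"
    unfolding face_lattice_eqs has_type_def fst_conv snd_conv
    using rotary[OF reflection_polytope_tetrahedron] rotary[OF reflection_polytope_octahedron]
      rotary[OF reflection_polytope_icosahedron] rotary[OF reflection_polytope_cube]
      rotary[OF reflection_polytope_dodecahedron]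
    by (simp_all add: rotation_order_def card_vertices)
qed

theorem mainTheorem7:
  fixes \<Phi>33 \<Phi>34 \<Phi>35 \<Phi>43 \<Phi>53 :: "(real ^ 3) set set"
  assumes "\<Phi>33 \<in> flags P33"
    and "\<Phi>34 \<in> flags P34"
    and "\<Phi>35 \<in> flags P35"
    and "\<Phi>43 \<in> flags P43"
    and "\<Phi>53 \<in> flags P53"
  shows "has_parameters (mix 3 [(P33, \<Phi>33), (P34, \<Phi>34)]) (24, 144, 96, 576) \<and>
    has_parameters (mix 3 [(P33, \<Phi>33), (P35, \<Phi>35)]) (48, 360, 240, 1440) \<and>
    has_parameters (mix 3 [(P33, \<Phi>33), (P43, \<Phi>43)]) (96, 144, 24, 576) \<and>
    has_parameters (mix 3 [(P33, \<Phi>33), (P53, \<Phi>53)]) (240, 360, 48, 1440) \<and>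
    has_parameters (mix 3 [(P34, \<Phi>34), (P35, \<Phi>35)]) (72, 720, 480, 2880) \<and>
    has_parameters (mix 3 [(P34, \<Phi>34), (P43, \<Phi>43)]) (48, 288, 48, 1152) \<and>
    has_parameters (mix 3 [(P34, \<Phi>34), (P53, \<Phi>53)]) (120, 720, 96, 2880) \<and>
    has_parameters (mix 3 [(P35, \<Phi>35), (P43, \<Phi>43)]) (96, 720, 120, 2880) \<and>
    has_parameters (mix 3 [(P35, \<Phi>35), (P53, \<Phi>53)]) (240, 1800, 240, 7200) \<and>
    has_parameters (mix 3 [(P43, \<Phi>43), (P53, \<Phi>53)]) (480, 720, 72, 2880) \<and>
    has_parameters (mix 3 [(P33, \<Phi>33), (P34, \<Phi>34), (P35, \<Phi>35)]) (288, 8640, 5760, 34560) \<and>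
    has_parameters (mix 3 [(P33, \<Phi>33), (P34, \<Phi>34), (P43, \<Phi>43)]) (576, 3456, 576, 13824) \<and>
    has_parameters (mix 3 [(P33, \<Phi>33), (P34, \<Phi>34), (P53, \<Phi>53)]) (1440, 8640, 1152, 34560) \<and>
    has_parameters (mix 3 [(P33, \<Phi>33), (P35, \<Phi>35), (P43, \<Phi>43)]) (1152, 8640, 1440, 34560) \<and>
    has_parameters (mix 3 [(P33, \<Phi>33), (P35, \<Phi>35), (P53, \<Phi>53)]) (2880, 21600, 2880, 86400) \<and>
    has_parameters (mix 3 [(P33, \<Phi>33), (P43, \<Phi>43), (P53, \<Phi>53)]) (5760, 8640, 288, 34560) \<and>
    has_parameters (mix 3 [(P34, \<Phi>34), (P35, \<Phi>35), (P43, \<Phi>43)]) (576, 17280, 2880, 69120) \<and>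
    has_parameters (mix 3 [(P34, \<Phi>34), (P35, \<Phi>35), (P53, \<Phi>53)]) (1440, 43200, 5760, 172800) \<and>
    has_parameters (mix 3 [(P34, \<Phi>34), (P43, \<Phi>43), (P53, \<Phi>53)]) (2880, 17280, 576, 69120) \<and>
    has_parameters (mix 3 [(P35, \<Phi>35), (P43, \<Phi>43), (P53, \<Phi>53)]) (5760, 43200, 1440, 172800) \<and>
    has_parameters (mix 3 [(P33, \<Phi>33), (P34, \<Phi>34), (P35, \<Phi>35), (P43, \<Phi>43)]) (6912, 207360, 34560, 829440) \<and>
    has_parameters (mix 3 [(P33, \<Phi>33), (P34, \<Phi>34), (P35, \<Phi>35), (P53, \<Phi>53)]) (17280, 518400, 69120, 2073600) \<and>
    has_parameters (mix 3 [(P33, \<Phi>33), (P34, \<Phi>34), (P43, \<Phi>43), (P53, \<Phi>53)]) (34560, 207360, 6912, 829440) \<and>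
    has_parameters (mix 3 [(P33, \<Phi>33), (P35, \<Phi>35), (P43, \<Phi>43), (P53, \<Phi>53)]) (69120, 518400, 17280, 2073600) \<and>
    has_parameters (mix 3 [(P34, \<Phi>34), (P35, \<Phi>35), (P43, \<Phi>43), (P53, \<Phi>53)]) (34560, 1036800, 34560, 4147200) \<and>
    has_parameters (mix 3 [(P33, \<Phi>33), (P34, \<Phi>34), (P35, \<Phi>35), (P43, \<Phi>43), (P53, \<Phi>53)]) (414720, 12441600, 414720, 49766400)"
proof -
  note types = has_type_polyhedra(1)[OF assms(1)] has_type_polyhedra(2)[OF assms(2)]
    has_type_polyhedra(3)[OF assms(3)] has_type_polyhedra(4)[OF assms(4)] has_type_polyhedra(5)[OF assms(5)]
  show ?thesis
    by (intro conjI)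
      ((rule has_parameters_mixI, (rule list.rel_intros types)+,
        simp_all add: rotation_order_def lcm_nat_def gcd_non_0_nat)[1])+
qed

end
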